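(* Let $l\ge 3$, $t\ge 1$ and $n\ge \max\{1.27\times 10^7,\ 6.5025\times 2^{(t-1)(l-1)+l}\}$ be integers. Then the following graph $B$ is (up to isomorphism) the extremal graph for $\mathrm{spex}_{\mathcal{OP}}(n,B_{tl})$, i.e. the unique $n$-vertex $B_{tl}$-free outerplanar graph with spectral radius equal to $\mathrm{spex}_{\mathcal{OP}}(n,B_{tl})$: (i) if $t=1$ and $l\ge 3$, $B\cong K_1\vee H_{\mathcal{OP}}(l-2,l-2)$; (ii) if $t\ge 2$ and $l\ge 3$, $B\cong K_1\vee H_{\mathcal{OP}}(tl-t-1,l-2)$.
   Context: All graphs are finite and simple. The spectral radius of a graph is the maximum modulus of the eigenvalues of its adjacency matrix. A graph is $F$-free if it does not contain $F$ as a (not necessarily induced) subgraph. $\mathrm{spex}_{\mathcal{OP}}(n,F)$ is the maximum spectral radius over all $n$-vertex $F$-free outerplanar graphs. $B_{tl}$ is the graph obtained from $t$ edge-disjoint cycles of length $l$ by sharing one common vertex (the $t$ cycles pairwise intersect exactly in that vertex); in particular $B_{1l}=C_l$. $G_1\vee G_2$ is the join, $\cup$ is disjoint union, $mH$ is the disjoint union of $m$ copies of $H$, and $P_k$ is the path on $k$ vertices. For positive integers $n,n_1,n_2$ with $n-1\ge n_1\ge n_2\ge 1$, $H_{\mathcal{OP}}(n_1,n_2)$ is the following graph on $n-1$ vertices: $$H_{\mathcal{OP}}(n_1,n_2)=\begin{cases}P_{n_1}\cup \frac{n-1-n_1}{n_2}P_{n_2}, & \text{if } n_2\mid (n-1-n_1);\\[2pt]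 P_{n_1}\cup\left\lfloor\frac{n-1-n_1}{n_2}\right\rfloor P_{n_2}\cup P_{n-1-n_1-\lfloor\frac{n-1-n_1}{n_2}\rfloor n_2}, & \text{otherwise.}\end{cases}$$ *)

theory Defs
  imports "HOL-Analysis.Analysis" "Jordan_Normal_Form.Spectral_Radius"
begin

section \<open>Finite simple graphs\<close>

record 'a sgraph =
  verts :: "'a set"
  edges :: "'a set set"

definition simple_graph :: "'a sgraph \<Rightarrow> bool" where
  "simple_graph G \<longleftrightarrow>
     finite (verts G) \<and> (\<forall>e\<in>edges G. e \<subseteq> verts G \<and> card e = 2)"

definition isomorphic :: "'a sgraph \<Rightarrow> 'b sgraph \<Rightarrow> bool"  (infix \<open>\<cong>\<^sub>g\<close> 50) where
  "G \<cong>\<^sub>g H \<longleftrightarrow>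
     (\<exists>f. bij_betw f (verts G) (verts H) \<and> edges H = (\<lambda>e. f ` e) ` edges G)"

definition contains_subgraph :: "'a sgraph \<Rightarrow> 'b sgraph \<Rightarrow> bool" where
  "contains_subgraph G F \<longleftrightarrow>
     (\<exists>f. inj_on f (verts F) \<and> f ` verts F \<subseteq> verts G \<and> (\<forall>e\<in>edges F. f ` e \<in> edges G))"

abbreviation free_of :: "'b sgraph \<Rightarrow> 'a sgraph \<Rightarrow> bool" where
  "free_of F G \<equiv> \<not> contains_subgraph G F"


section \<open>Spectral radius\<close>

text \<open>For finite \<open>S\<close>, \<open>from_nat_into S\<close> is a bijection from \<open>{..<card S}\<close> to \<open>S\<close>. Another
  enumeration of the vertices conjugates the matrix by a permutation matrix, so the spectral
  radius does not depend on this choice.\<close>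

definition adjacency_matrix :: "'a sgraph \<Rightarrow> complex mat" where
  "adjacency_matrix G =
     Matrix.mat (card (verts G)) (card (verts G))
       (\<lambda>(i, j). if {from_nat_into (verts G) i, from_nat_into (verts G) j} \<in> edges G
                 then 1 else 0)"

definition graph_spectral_radius :: "'a sgraph \<Rightarrow> real" where
  "graph_spectral_radius G = Spectral_Radius.spectral_radius (adjacency_matrix G)"


section \<open>Outerplanar graphs\<close>

definition drawing_points :: "'a sgraph \<Rightarrow> ('a \<Rightarrow> complex) \<Rightarrow> ('a set \<Rightarrow> real \<Rightarrow> complex) \<Rightarrow> complex set"
  where
  "drawing_points G p \<gamma> = p ` verts G \<union> (\<Union>e\<in>edges G. path_image (\<gamma> e))"

definition plane_drawing :: "'a sgraph \<Rightarrow> ('a \<Rightarrow> complex) \<Rightarrow> ('a set \<Rightarrow> real \<Rightarrow> complex) \<Rightarrow> bool"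
  where
  "plane_drawing G p \<gamma> \<longleftrightarrow>
     inj_on p (verts G) \<and>
     (\<forall>e\<in>edges G. arc (\<gamma> e) \<and> {pathstart (\<gamma> e), pathfinish (\<gamma> e)} = p ` e \<and>
                  path_image (\<gamma> e) \<inter> p ` verts G = p ` e) \<and>
     (\<forall>e\<in>edges G. \<forall>e'\<in>edges G. e \<noteq> e' \<longrightarrow>
        path_image (\<gamma> e) \<inter> path_image (\<gamma> e') \<subseteq> p ` (e \<inter> e'))"

text \<open>The drawing is a compact subset of the plane, so \<open>outside\<close> is the unbounded component of
  its complement, i.e. the outer face.\<close>

definition outerplanar :: "'a sgraph \<Rightarrow> bool" where
  "outerplanar G \<longleftrightarrow>
     (\<exists>p \<gamma>. plane_drawing G p \<gamma> \<and> p ` verts G \<subseteq> frontier (outside (drawing_points G p \<gamma>)))"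


section \<open>The outerplanar spectral extremal problem\<close>

text \<open>Every \<open>n\<close>-vertex graph is isomorphic to one on \<open>{..<n}\<close>, so the maximum may be
  taken over the finitely many graphs with this vertex set.\<close>

definition spex_op :: "nat \<Rightarrow> 'b sgraph \<Rightarrow> real" where
  "spex_op n F =
     Max {graph_spectral_radius G | G :: nat sgraph.
            simple_graph G \<and> verts G = {..<n} \<and> outerplanar G \<and> free_of F G}"

definition spex_op_extremal :: "nat \<Rightarrow> 'b sgraph \<Rightarrow> 'a sgraph \<Rightarrow> bool" where
  "spex_op_extremal n F G \<longleftrightarrow>
     simple_graph G \<and> card (verts G) = n \<and> outerplanar G \<and> free_of F G \<and>
     graph_spectral_radius G = spex_op n F"


section \<open>The graphs involved\<close>

definition K1 :: "unit sgraph" where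
  "K1 = \<lparr>verts = {()}, edges = {}\<rparr>"

definition path_graph :: "nat \<Rightarrow> nat sgraph" where
  "path_graph k = \<lparr>verts = {..<k}, edges = {{i, Suc i} | i. Suc i < k}\<rparr>"

definition disjoint_union :: "'a sgraph list \<Rightarrow> (nat \<times> 'a) sgraph" where
  "disjoint_union Gs =
     \<lparr>verts = {(i, v) | i v. i < length Gs \<and> v \<in> verts (Gs ! i)},
      edges = {Pair i ` e | i e. i < length Gs \<and> e \<in> edges (Gs ! i)}\<rparr>"

definition join_graph :: "'a sgraph \<Rightarrow> 'b sgraph \<Rightarrow> ('a + 'b) sgraph"  (infixr \<open>\<or>\<^sub>g\<close> 65) where
  "G \<or>\<^sub>g H =
     \<lparr>verts = verts G <+> verts H,
      edges = (\<lambda>e. Inl ` e) ` edges G \<union> (\<lambda>e. Inr ` e) ` edges H \<union>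
              {{Inl u, Inr v} | u v. u \<in> verts G \<and> v \<in> verts H}\<rparr>"

text \<open>\<open>B\<^sub>t\<^sub>l\<close> for \<open>l \<ge> 3\<close>: vertex number \<open>k < l\<close> of cycle number \<open>j < t\<close> is \<open>j * (l - 1) + k\<close>,
  except that vertex number \<open>0\<close> of every cycle is the common vertex \<open>0\<close>.\<close>

definition bouquet_vertex :: "nat \<Rightarrow> nat \<Rightarrow> nat \<Rightarrow> nat" where
  "bouquet_vertex l j k = (if k = 0 then 0 else j * (l - 1) + k)"

definition bouquet :: "nat \<Rightarrow> nat \<Rightarrow> nat sgraph" where
  "bouquet t l =
     \<lparr>verts = {bouquet_vertex l j k | j k. j < t \<and> k < l},
      edges = {{bouquet_vertex l j k, bouquet_vertex l j (Suc k mod l)} | j k. j < t \<and> k < l}\<rparr>"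

definition H_op :: "nat \<Rightarrow> nat \<Rightarrow> nat \<Rightarrow> (nat \<times> nat) sgraph" where
  "H_op n n1 n2 =
     (let q = (n - 1 - n1) div n2 in
      if n2 dvd n - 1 - n1
      then disjoint_union (path_graph n1 # replicate q (path_graph n2))
      else disjoint_union (path_graph n1 # replicate q (path_graph n2) @
             [path_graph (n - 1 - n1 - q * n2)]))"

end

theory Submission
  imports Defs
begin

text \<open>Of outerplanarity only two consequences matter: there are no three paths with inner
  vertices and common ends that are otherwise disjoint, and there is no \<open>K\<^sub>4\<close>; conversely, a
  fan (a vertex joined to disjoint paths) is outerplanar. If the spectral radius \<open>\<rho>\<close> is at
  least \<open>sqrt (n - 1)\<close>, counting walks of length two at the maximum of the Perron vector
  shows that all but \<open>O(\<rho>)\<close> vertices are adjacent to one vertex \<open>u\<close>, and that attaching the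
  others to \<open>u\<close> as pendant vertices increases \<open>\<rho>\<close>. So the extremal graph is a fan. For a fan
  with paths of orders \<open>n\<^sub>i\<close> and \<open>\<rho> = r + 1 / r\<close>, the eigenvalue equation depends on the
  \<open>n\<^sub>i\<close> only through the sum of \<open>(1 - r ^ n\<^sub>i) / (1 + r ^ (n\<^sub>i + 1))\<close>, which has to be as
  small as possible. The summand is strictly concave in \<open>n\<^sub>i\<close>, so moving vertices from
  shorter to longer paths helps as long as \<open>B\<^sub>t\<^sub>l\<close> stays excluded, that is, as long as the
  sum of \<open>n\<^sub>i div (l - 1)\<close> is less than \<open>t\<close>.\<close>

section \<open>Theta curves in the plane\<close>

text \<open>The obstacle is that the graphs to be compared have different, unknown spectral radii.
  Fixing \<open>\<rho>\<close> as the radius of one fan removes it: for any fan of the same order,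
  the eigenvalue equation is solved away from the hub with hub entry \<open>1\<close>, and the
  resulting test vector has a Rayleigh quotient above \<open>\<rho>\<close> as soon as its entries
  off the hub add up to more than \<open>\<rho>\<close>. The substitution
  \<open>\<rho> = r + 1 / r\<close> makes these entries explicit, because powers of \<open>r\<close>
  and of \<open>1 / r\<close> solve the homogeneous recurrence along a path. The comparison of path
  lengths is exact for every \<open>r\<close> between \<open>0\<close> and \<open>1\<close>, without
  asymptotics. The lower bound on \<open>n\<close> is spent on \<open>\<rho> \<ge> 100\<close>,
  which absorbs the errors in the search for \<open>u\<close>, and on room for a path with
  \<open>t * (l - 1) - 1\<close> vertices, the longest one that serves only \<open>t - 1\<close>
  cycles. Pendant vertices at \<open>u\<close> are harmless because a path of one vertex contributes
  \<open>1 div (l - 1) = 0\<close> to the number of cycles.\<close>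

lemma closed_curve_of_arcs:
  fixes c1 c2 :: "real \<Rightarrow> complex"
  assumes "arc c1" "arc c2" "pathstart c1 = a" "pathfinish c1 = b" "pathstart c2 = a" "pathfinish c2 = b"
    and "path_image c1 \<inter> path_image c2 = {a, b}"
  shows "\<exists>c. simple_path c \<and> pathfinish c = pathstart c \<and> path_image c = path_image c1
    \<union> path_image c2"
proof -
  have "simple_path (c1 +++ reversepath c2)"
    by (rule simple_path_join_loop) (use assms in \<open>auto intro: arc_reversepath\<close>)
  moreover have "path_image (c1 +++ reversepath c2) = path_image c1 \<union> path_image c2"
    by (subst path_image_join) (use assms in auto)
  moreover have "pathfinish (c1 +++ reversepath c2) = pathstart (c1 +++ reversepath c2)"
    using assms by auto
  ultimately show ?thesis by blast
qed

text \<open>The Jordan curve theorem in terms of two arcs, so that later arguments can treat the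
  closed curve as a point set without a parametrisation.\<close>

lemma Jordan_arcs:
  fixes c1 c2 :: "real \<Rightarrow> complex"
  assumes "arc c1" "arc c2" "pathstart c1 = a" "pathfinish c1 = b" "pathstart c2 = a" "pathfinish c2 = b"
    and "path_image c1 \<inter> path_image c2 = {a, b}"
  defines "J \<equiv> path_image c1 \<union> path_image c2"
  shows "inside J \<noteq> {}" "open (inside J)" "connected (inside J)" "connected (outside J)"
    "frontier (inside J) = J" "bounded (inside J)" "\<not> bounded (outside J)" "compact J"
proof -
  obtain c where c: "simple_path c" "pathfinish c = pathstart c" "path_image c = J"
    using closed_curve_of_arcs[OF assms(1-7)] unfolding J_def by blast
  show "inside J \<noteq> {}" "open (inside J)" "connected (inside J)" "connected (outside J)"
    "frontier (inside J) = J" "bounded (inside J)" "\<not> bounded (outside J)"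
    using Jordan_inside_outside[OF c(1,2)] c(3) by auto
  show "compact J"
    using c compact_path_image simple_path_imp_path by metis
qed

text \<open>The inside of \<open>S\<close> is a union of components of the complement, and a
  connected set that avoids \<open>S\<close> stays in one component.\<close>

lemma connected_outside_component:
  fixes S :: "complex set"
  assumes "connected T" "T \<inter> S = {}" "T \<inter> inside S \<noteq> {}"
  shows "T \<subseteq> inside S"
proof
  fix y assume y: "y \<in> T"
  obtain x where x: "x \<in> T" "x \<in> inside S" using assms(3) by blast
  have "connected_component (- S) x y"
    unfolding connected_component_def using assms(1,2) x(1) y by blast
  then show "y \<in> inside S" using x(2) inside_same_component by blast
qed

text \<open>If no arc met the inside of the closed curve formed by the two others, Janiszewski's
  theorem, applied to two of the three closed curves (which intersect in a connected arc),
  would make the inside of the third curve reachable from infinity, unless two of the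
  insides coincide; but then their frontiers coincide.\<close>

theorem theta_curve:
  fixes c1 c2 c3 :: "real \<Rightarrow> complex"
  assumes arcs: "arc c1" "arc c2" "arc c3"
    and ends: "pathstart c1 = a" "pathfinish c1 = b" "pathstart c2 = a" "pathfinish c2 = b"
      "pathstart c3 = a" "pathfinish c3 = b"
    and int: "path_image c1 \<inter> path_image c2 = {a, b}" "path_image c1 \<inter> path_image c3 = {a, b}"
      "path_image c2 \<inter> path_image c3 = {a, b}"
    and ne: "path_image c1 \<noteq> {a, b}" "path_image c2 \<noteq> {a, b}" "path_image c3 \<noteq> {a, b}"
  shows "path_image c1 \<inter> inside (path_image c2 \<union> path_image c3) \<noteq> {} \<or>
    path_image c2 \<inter> inside (path_image c1 \<union> path_image c3) \<noteq> {} \<or>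
    path_image c3 \<inter> inside (path_image c1 \<union> path_image c2) \<noteq> {}"
proof (rule ccontr)
  let ?A = "path_image c1" and ?B = "path_image c2" and ?C = "path_image c3"
  assume "\<not> ?thesis"
  then have dis: "?A \<inter> inside (?B \<union> ?C) = {}" "?B \<inter> inside (?A \<union> ?C) = {}"
    "?C \<inter> inside (?A \<union> ?B) = {}" by auto
  note J12 = Jordan_arcs[OF arcs(1,2) ends(1-4) int(1)]
  note J13 = Jordan_arcs[OF arcs(1,3) ends(1,2,5,6) int(2)]
  note J23 = Jordan_arcs[OF arcs(2,3) ends(3-6) int(3)]
  have eq: "inside X = inside Y"
    if "connected (inside X)" "connected (inside Y)" "inside X \<inter> Y = {}" "inside Y \<inter> X = {}"
      "inside X \<inter> inside Y \<noteq> {}" for X Y :: "complex set"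
    using connected_outside_component[of "inside X" Y] connected_outside_component[of "inside Y" X] that
    by blast
  have no_in: "inside (X \<union> Y) \<inter> X = {}" "inside (X \<union> Y) \<inter> Y = {}" for X Y ::
    "complex set"
    using inside_no_overlap[of "X \<union> Y"] by blast+
  have dis': "inside (?B \<union> ?C) \<inter> ?A = {}" "inside (?A \<union> ?C) \<inter> ?B = {}" "inside
    (?A \<union> ?B) \<inter> ?C = {}"
    using dis by (simp_all add: Int_commute)
  have ne': "\<not> ?A \<subseteq> {a, b}" "\<not> ?B \<subseteq> {a, b}" "\<not> ?C \<subseteq> {a, b}"
    using int ne by blast+
  have no12: "inside (?B \<union> ?C) \<inter> inside (?A \<union> ?B) = {}"
  proof (rule ccontr)
    assume meet: "inside (?B \<union> ?C) \<inter> inside (?A \<union> ?B) \<noteq> {}"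
    have "inside (?B \<union> ?C) = inside (?A \<union> ?B)"
      by (rule eq[OF J23(3) J12(3) _ _ meet]) (simp_all add: Int_Un_distrib dis' no_in)
    then have "?B \<union> ?C = ?A \<union> ?B" using J12(5) J23(5) by metis
    then have "?A \<subseteq> (?A \<inter> ?B) \<union> (?A \<inter> ?C)" by blast
    then show False using ne'(1) unfolding int by simp
  qed
  have no13: "inside (?B \<union> ?C) \<inter> inside (?A \<union> ?C) = {}"
  proof (rule ccontr)
    assume meet: "inside (?B \<union> ?C) \<inter> inside (?A \<union> ?C) \<noteq> {}"
    have "inside (?B \<union> ?C) = inside (?A \<union> ?C)"
      by (rule eq[OF J23(3) J13(3) _ _ meet]) (simp_all add: Int_Un_distrib dis' no_in)
    then have "?B \<union> ?C = ?A \<union> ?C" using J13(5) J23(5) by metis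
    then have "?A \<subseteq> (?A \<inter> ?B) \<union> (?A \<inter> ?C)" by blast
    then show False using ne'(1) unfolding int by simp
  qed
  \<comment> \<open>\<open>x\<close> lies inside one closed curve and, by the two preceding facts,
    outside the two others. Janiszewski's theorem is to join it to a point \<open>y\<close> that
    lies outside all three.\<close>
  obtain x where x: "x \<in> inside (?B \<union> ?C)" using J23(1) by blast
  have "x \<notin> ?A" "x \<notin> ?B" "x \<notin> ?C" using x dis(1) no_in[of ?B ?C] by blast+
  then have x12: "x \<in> outside (?A \<union> ?B)" and x13: "x \<in> outside (?A \<union> ?C)"
    using no12 no13 x inside_Un_outside by blast+
  have comp: "compact (?A \<union> ?B \<union> ?C)" using arcs by (simp add: arc_imp_path compact_Un
    compact_path_image)
  obtain y where y: "y \<in> outside (?A \<union> ?B \<union> ?C)"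
    using outside_bounded_nonempty[OF compact_imp_bounded[OF comp]] by blast
  have y12: "y \<in> outside (?A \<union> ?B)" and y13: "y \<in> outside (?A \<union> ?C)" and y23: "y
    \<in> outside (?B \<union> ?C)"
    using y outside_mono[of "?A \<union> ?B" "?A \<union> ?B \<union> ?C"] outside_mono[of "?A \<union> ?C"
      "?A \<union> ?B \<union> ?C"]
      outside_mono[of "?B \<union> ?C" "?A \<union> ?B \<union> ?C"] by blast+
  have cc: "connected_component (- S) x y" if "connected (outside S)" "x \<in> outside S" "y \<in> outside S"
    for S :: "complex set"
    unfolding connected_component_def using that inside_Un_outside[of S] by blast
  \<comment> \<open>Janiszewski's theorem needs a connected intersection. The two common points of
    \<open>?B\<close> and \<open>?C\<close> already lie on \<open>?A\<close>, so the intersection is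
    the arc \<open>?A\<close>.\<close>
  have "(?A \<union> ?B) \<inter> (?A \<union> ?C) = ?A \<union> (?B \<inter> ?C)" by blast
  also have "\<dots> = ?A \<union> (?A \<inter> ?B)" unfolding int ..
  finally have "(?A \<union> ?B) \<inter> (?A \<union> ?C) = ?A" by blast
  then have "connected ((?A \<union> ?B) \<inter> (?A \<union> ?C))"
    using arcs(1) by (simp add: arc_imp_path connected_path_image)
  then have "connected_component (- ((?A \<union> ?B) \<union> (?A \<union> ?C))) x y"
    using Janiszewski[of "?A \<union> ?B" "?A \<union> ?C" x y] J12(8) J13(8) compact_imp_closed
      cc[OF J12(4) x12 y12] cc[OF J13(4) x13 y13] by blast
  then have "connected_component (- (?B \<union> ?C)) x y"
    by (rule connected_component_of_subset) blast
  then have "y \<in> inside (?B \<union> ?C)" using x inside_same_component[of "?B \<union> ?C" x y]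
    by blast
  then show False using y23 inside_Int_outside[of "?B \<union> ?C"] by blast
qed

section \<open>Forbidden configurations in outerplanar graphs\<close>

fun path_edges :: "'a list \<Rightarrow> 'a set set" where
  "path_edges (x # y # zs) = insert {x, y} (path_edges (y # zs))"
| "path_edges _ = {}"

lemma path_edges_nth: "path_edges vs = {{vs ! i, vs ! Suc i} | i. Suc i < length vs}"
proof (induction vs rule: path_edges.induct)
  case (1 x y zs)
  have "{{(x # y # zs) ! i, (x # y # zs) ! Suc i} | i. Suc i < length (x # y # zs)} =
    insert {x, y} {{(y # zs) ! i, (y # zs) ! Suc i} | i. Suc i < length (y # zs)}" (is "?L = ?R")
  proof
    show "?L \<subseteq> ?R"
    proof
      fix e assume "e \<in> ?L"
      then obtain i where i: "e = {(x # y # zs) ! i, (x # y # zs) ! Suc i}" "Suc i < length (x # y # zs)"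
        by blast
      show "e \<in> ?R" using i by (cases i) auto
    qed
    show "?R \<subseteq> ?L"
    proof
      fix e assume "e \<in> ?R"
      then consider "e = {x, y}" | i where "e = {(y # zs) ! i, (y # zs) ! Suc i}" "Suc i < length (y # zs)"
        by blast
      then show "e \<in> ?L"
      proof cases
        case 1 then show ?thesis by (auto intro!: exI[of _ 0])
      next
        case 2 then show ?thesis by (auto intro!: exI[of _ "Suc i"])
      qed
    qed
  qed
  then show ?case using 1 by simp
qed auto

lemma path_edges_subset: "e \<in> path_edges vs \<Longrightarrow> e \<subseteq> set vs"
  by (auto simp: path_edges_nth)

lemma path_vertex_edge:
  assumes "v \<in> set vs" "length vs \<ge> 2"
  shows "\<exists>e\<in>path_edges vs. v \<in> e"
proof -
  obtain i where i: "i < length vs" "v = vs ! i" using assms(1) by (metis in_set_conv_nth)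
  show ?thesis
  proof (cases "Suc i < length vs")
    case True then show ?thesis using i unfolding path_edges_nth by blast
  next
    case False
    then obtain j where "i = Suc j" using i assms(2) by (cases i) auto
    then show ?thesis using i unfolding path_edges_nth by blast
  qed
qed

lemma plane_drawing_edge:
  assumes "plane_drawing G p \<gamma>" "e \<in> edges G"
  shows "arc (\<gamma> e)" "{pathstart (\<gamma> e), pathfinish (\<gamma> e)} = p ` e"
  using assms unfolding plane_drawing_def by auto

lemma plane_drawing_Int:
  assumes "plane_drawing G p \<gamma>" "e \<in> edges G" "e' \<in> edges G" "e \<noteq> e'"
  shows "path_image (\<gamma> e) \<inter> path_image (\<gamma> e') \<subseteq> p ` (e \<inter> e')"
  using assms unfolding plane_drawing_def by auto

lemma plane_drawing_inj: "plane_drawing G p \<gamma> \<Longrightarrow> inj_on p (verts G)"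
  unfolding plane_drawing_def by auto

lemma edge_image_ends:
  assumes "plane_drawing G p \<gamma>" "e \<in> edges G" "v \<in> e"
  shows "p v \<in> path_image (\<gamma> e)"
  using plane_drawing_edge(2)[OF assms(1,2)] assms(3) pathstart_in_path_image[of "\<gamma> e"]
    pathfinish_in_path_image[of "\<gamma> e"] by (metis imageI insertE singletonD)

text \<open>The inside of \<open>S\<close> is open and disjoint from the outside of the larger
  drawing, hence also from the closure of that outside. This turns the frontier condition into an
  obstruction: no closed curve of the drawing encloses a vertex.\<close>

lemma drawing_outer_vertex:
  assumes "p v \<in> frontier (outside (drawing_points G p \<gamma>))" "closed S" "S \<subseteq>
    drawing_points G p \<gamma>"
  shows "p v \<notin> inside S"
proof
  assume "p v \<in> inside S"
  moreover have "outside (drawing_points G p \<gamma>) \<subseteq> outside S" using assms(3) by (rule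
    outside_mono)
  then have "closure (outside (drawing_points G p \<gamma>)) \<inter> inside S = {}"
    using open_Int_closure_eq_empty[OF open_inside[OF assms(2)], of "outside (drawing_points G p \<gamma>)"]
      inside_Int_outside[of S] by blast
  ultimately show False using assms(1) unfolding frontier_def by blast
qed

lemma edge_arc:
  assumes "plane_drawing G p \<gamma>" "{x, y} \<in> edges G" "x \<noteq> y"
  shows "\<exists>c. arc c \<and> pathstart c = p x \<and> pathfinish c = p y \<and> path_image c =
    path_image (\<gamma> {x, y})"
proof -
  have a: "arc (\<gamma> {x, y})" and e: "{pathstart (\<gamma> {x, y}), pathfinish (\<gamma> {x, y})} = {p
    x, p y}"
    using plane_drawing_edge[OF assms(1,2)] by auto
  show ?thesis
  proof (cases "pathstart (\<gamma> {x, y}) = p x")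
    case True
    then show ?thesis using a e arc_distinct_ends by (metis doubleton_eq_iff)
  next
    case False
    then have "pathstart (\<gamma> {x, y}) = p y" "pathfinish (\<gamma> {x, y}) = p x"
      using e by (auto simp: doubleton_eq_iff)
    then show ?thesis using a
      by (intro exI[of _ "reversepath (\<gamma> {x, y})"]) (auto intro: arc_reversepath)
  qed
qed

text \<open>Arcs of consecutive edges can be joined because, in a \<open>distinct\<close> list, the
  first edge shares with the later ones at most the point \<open>p y\<close>.\<close>

lemma path_arc:
  assumes "plane_drawing G p \<gamma>" "distinct vs" "length vs \<ge> 2" "path_edges vs \<subseteq> edges G"
  shows "\<exists>c. arc c \<and> pathstart c = p (hd vs) \<and> pathfinish c = p (last vs) \<and>
    path_image c = (\<Union>e\<in>path_edges vs. path_image (\<gamma> e))"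
  using assms(2-)
proof (induction vs rule: path_edges.induct)
  case (1 x y zs)
  have xy: "{x, y} \<in> edges G" "x \<noteq> y" using 1 by auto
  obtain c where c: "arc c" "pathstart c = p x" "pathfinish c = p y" "path_image c = path_image (\<gamma>
    {x, y})"
    using edge_arc[OF assms(1) xy] by blast
  show ?case
  proof (cases zs)
    case Nil
    then show ?thesis using c by auto
  next
    case (Cons z zs')
    obtain d where d: "arc d" "pathstart d = p y" "pathfinish d = p (last (y # zs))"
      "path_image d = (\<Union>e\<in>path_edges (y # zs). path_image (\<gamma> e))"
      using 1 Cons by auto
    have "path_image (\<gamma> {x, y}) \<inter> path_image (\<gamma> e) \<subseteq> {p y}" if e: "e \<in>
      path_edges (y # zs)" for e
    proof -
      have sub: "e \<subseteq> set (y # zs)" using e by (rule path_edges_subset)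
      then have "{x, y} \<inter> e \<subseteq> {y}" "e \<noteq> {x, y}" using 1(2) by auto
      then show ?thesis using plane_drawing_Int[OF assms(1) xy(1), of e] e 1(4) by auto
    qed
    then have "path_image c \<inter> path_image d \<subseteq> {p y}" unfolding c(4) d(4) by blast
    then have "arc (c +++ d)" using arc_join[of c d] c d by simp
    then show ?thesis using c d
      by (intro exI[of _ "c +++ d"]) (auto simp: path_image_join)
  qed
qed auto

lemma path_arc_Int:
  assumes "plane_drawing G p \<gamma>" "path_edges vs \<subseteq> edges G" "path_edges ws \<subseteq> edges G"
    "path_edges vs \<inter> path_edges ws = {}"
  shows "(\<Union>e\<in>path_edges vs. path_image (\<gamma> e)) \<inter> (\<Union>e\<in>path_edges ws.
    path_image (\<gamma> e)) \<subseteq> p ` (set vs \<inter> set ws)"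
proof -
  have "path_image (\<gamma> e) \<inter> path_image (\<gamma> e') \<subseteq> p ` (set vs \<inter> set ws)"
    if "e \<in> path_edges vs" "e' \<in> path_edges ws" for e e'
  proof -
    have "path_image (\<gamma> e) \<inter> path_image (\<gamma> e') \<subseteq> p ` (e \<inter> e')"
      using plane_drawing_Int[OF assms(1), of e e'] that assms by blast
    then show ?thesis using path_edges_subset[OF that(1)] path_edges_subset[OF that(2)] by blast
  qed
  then show ?thesis by blast
qed

lemma path_vertex_in_arc:
  assumes "plane_drawing G p \<gamma>" "path_edges vs \<subseteq> edges G" "length vs \<ge> 2" "v \<in> set vs"
  shows "p v \<in> (\<Union>e\<in>path_edges vs. path_image (\<gamma> e))"
  using path_vertex_edge[OF assms(4,3)] edge_image_ends[OF assms(1)] assms(2) by blast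

text \<open>A path edge joins consecutive positions, so it joins the first to the last only if there
  are no inner vertices. This excludes common edges of two branches of a theta, since such an edge
  would have both ends in \<open>{a, b}\<close>.\<close>

lemma path_edge_ends_distinct:
  assumes "distinct vs" "e \<in> path_edges vs" "e \<subseteq> {hd vs, last vs}" shows "length vs \<le> 2"
proof -
  obtain i where i: "e = {vs ! i, vs ! Suc i}" "Suc i < length vs" using assms(2) unfolding path_edges_nth
    by blast
  have ne: "vs \<noteq> []" using i by auto
  then have hl: "hd vs = vs ! 0" "last vs = vs ! (length vs - 1)" by (simp_all add: hd_conv_nth last_conv_nth)
  have "vs ! i = vs ! 0 \<or> vs ! i = vs ! (length vs - 1)"
    "vs ! Suc i = vs ! 0 \<or> vs ! Suc i = vs ! (length vs - 1)"
    using assms(3) unfolding i(1) hl by auto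
  moreover have "vs ! j = vs ! k \<longleftrightarrow> j = k" if "j < length vs" "k < length vs" for j k
    using nth_eq_iff_index_eq[OF assms(1) that] .
  moreover have "i < length vs" "0 < length vs" "length vs - 1 < length vs" using i(2) by linarith+
  ultimately have "i = 0 \<or> i = length vs - 1" "Suc i = 0 \<or> Suc i = length vs - 1"
    using i(2) by blast+
  then show ?thesis using i by auto
qed

text \<open>Without its ends the arc is still connected and avoids \<open>S\<close>; one point
  inside \<open>S\<close> therefore pulls all of it inside.\<close>

lemma connected_arc_meets_inside:
  fixes c :: "real \<Rightarrow> complex"
  assumes "arc c" "path_image c \<inter> S = {pathstart c, pathfinish c}" "path_image c \<inter> inside S
    \<noteq> {}"
    and "z \<in> path_image c" "z \<noteq> pathstart c" "z \<noteq> pathfinish c"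
  shows "z \<in> inside S"
proof -
  have "connected (path_image c - {pathstart c, pathfinish c})"
    using connected_simple_path_endless[OF arc_imp_simple_path[OF assms(1)]] .
  moreover have "{pathstart c, pathfinish c} \<inter> inside S = {}"
    using assms(2) inside_no_overlap[of S] by blast
  ultimately have "path_image c - {pathstart c, pathfinish c} \<subseteq> inside S"
    using assms(2,3) by (intro connected_outside_component) auto
  then show ?thesis using assms by blast
qed

text \<open>By \<open>theta_curve\<close> one branch enters the closed curve formed by the two
  others, and then runs entirely inside it. Length at least \<open>3\<close> gives this branch an
  inner vertex, which would be hidden from the outer face.\<close>

theorem outerplanar_no_theta:
  assumes G: "outerplanar G" "simple_graph G"
    and d: "distinct P" "distinct Q" "distinct R"
    and len: "length P \<ge> 3" "length Q \<ge> 3" "length R \<ge> 3"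
    and E: "path_edges P \<subseteq> edges G" "path_edges Q \<subseteq> edges G" "path_edges R \<subseteq>
      edges G"
    and hd: "hd P = a" "hd Q = a" "hd R = a" and last: "last P = b" "last Q = b" "last R = b"
    and int: "set P \<inter> set Q = {a, b}" "set P \<inter> set R = {a, b}" "set Q \<inter> set R = {a, b}"
  shows False
proof -
  obtain p \<gamma> where pg: "plane_drawing G p \<gamma>" and outer: "p ` verts G \<subseteq> frontier
    (outside (drawing_points G p \<gamma>))"
    using G(1) unfolding outerplanar_def by blast
  have V: "set vs \<subseteq> verts G" if "path_edges vs \<subseteq> edges G" "length vs \<ge> 2" for vs
    using path_vertex_edge[of _ vs] that G(2) unfolding simple_graph_def by blast
  let ?I = "\<lambda>vs. \<Union>e\<in>path_edges vs. path_image (\<gamma> e)"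
  have arcs: "\<exists>c. arc c \<and> pathstart c = p a \<and> pathfinish c = p b \<and> path_image c = ?I vs"
    if "distinct vs" "length vs \<ge> 3" "path_edges vs \<subseteq> edges G" "hd vs = a" "last vs = b" for vs
    using path_arc[OF pg, of vs] that by auto
  obtain c1 where c1: "arc c1" "pathstart c1 = p a" "pathfinish c1 = p b" "path_image c1 = ?I P"
    using arcs[of P] d len E hd last by auto
  obtain c2 where c2: "arc c2" "pathstart c2 = p a" "pathfinish c2 = p b" "path_image c2 = ?I Q"
    using arcs[of Q] d len E hd last by auto
  obtain c3 where c3: "arc c3" "pathstart c3 = p a" "pathfinish c3 = p b" "path_image c3 = ?I R"
    using arcs[of R] d len E hd last by auto
  \<comment> \<open>The witness is the entry at position \<open>1\<close>: it differs from those at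
    \<open>0\<close> and \<open>length vs - 1\<close> because the list has at least three
    entries.\<close>
  have mid: "\<exists>m\<in>verts G. m \<noteq> a \<and> m \<noteq> b \<and> p m \<in> ?I vs \<and> p m
    \<noteq> p a \<and> p m \<noteq> p b"
    if vs: "distinct vs" "length vs \<ge> 3" "path_edges vs \<subseteq> edges G" "hd vs = a" "last vs = b"
      for vs
  proof -
    have ne: "vs \<noteq> []" using vs by auto
    have "vs ! 1 \<noteq> vs ! 0"
      by (subst nth_eq_iff_index_eq[OF vs(1)]) (use vs(2) in linarith)+
    moreover have "vs ! 1 \<noteq> vs ! (length vs - 1)"
      by (subst nth_eq_iff_index_eq[OF vs(1)]) (use vs(2) in linarith)+
    ultimately have "vs ! 1 \<noteq> vs ! 0" "vs ! 1 \<noteq> vs ! (length vs - 1)" by blast+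
    then have "vs ! 1 \<noteq> a" "vs ! 1 \<noteq> b"
      using vs ne by (auto simp: hd_conv_nth last_conv_nth)
    moreover have "vs ! 1 \<in> set vs" "a \<in> set vs" "b \<in> set vs" using vs ne by auto
    moreover have "set vs \<subseteq> verts G" using V vs by auto
    moreover have "inj_on p (verts G)" using plane_drawing_inj[OF pg] .
    ultimately have "vs ! 1 \<in> verts G" "p (vs ! 1) \<noteq> p a" "p (vs ! 1) \<noteq> p b"
      unfolding inj_on_def by blast+
    moreover have "p (vs ! 1) \<in> ?I vs" using path_vertex_in_arc[OF pg vs(3)] \<open>vs ! 1 \<in> set
      vs\<close> vs(2) by auto
    ultimately show ?thesis using \<open>vs ! 1 \<noteq> a\<close> \<open>vs ! 1 \<noteq> b\<close> by blast
  qed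
  have Int: "?I vs \<inter> ?I ws = {p a, p b}"
    if vs: "distinct vs" "length vs \<ge> 3" "path_edges vs \<subseteq> edges G" "hd vs = a" "last vs = b"
      and ws: "distinct ws" "length ws \<ge> 3" "path_edges ws \<subseteq> edges G" "hd ws = a" "last ws = b"
      and i: "set vs \<inter> set ws = {a, b}" for vs ws
  proof
    have "path_edges vs \<inter> path_edges ws = {}"
    proof (rule ccontr)
      assume "\<not> ?thesis"
      then obtain e where e: "e \<in> path_edges vs" "e \<in> path_edges ws" by blast
      then have "e \<subseteq> {a, b}" using path_edges_subset[OF e(1)] path_edges_subset[OF e(2)] i by blast
      then show False using path_edge_ends_distinct[OF vs(1) e(1)] vs by auto
    qed
    then have "?I vs \<inter> ?I ws \<subseteq> p ` (set vs \<inter> set ws)"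
      by (rule path_arc_Int[OF pg vs(3) ws(3)])
    then show "?I vs \<inter> ?I ws \<subseteq> {p a, p b}" using i by auto
    have "a \<in> set vs" "b \<in> set vs" "a \<in> set ws" "b \<in> set ws" using i by auto
    then show "{p a, p b} \<subseteq> ?I vs \<inter> ?I ws"
      using path_vertex_in_arc[OF pg vs(3)] path_vertex_in_arc[OF pg ws(3)] vs(2) ws(2) by auto
  qed
  have no: False if c: "arc c" "pathstart c = p a" "pathfinish c = p b"
    and m: "m \<in> verts G" "p m \<in> path_image c" "p m \<noteq> p a" "p m \<noteq> p b"
    and S: "path_image c \<inter> S = {p a, p b}" "path_image c \<inter> inside S \<noteq> {}" "compact S"
      "S \<subseteq> drawing_points G p \<gamma>" for c m S
  proof -
    have "p m \<in> inside S"
      using connected_arc_meets_inside[of c S "p m"] c m S by auto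
    moreover have "p m \<notin> inside S"
      using drawing_outer_vertex[of p m G \<gamma> S] outer m(1) S compact_imp_closed by blast
    ultimately show False by blast
  qed
  have sub: "?I vs \<subseteq> drawing_points G p \<gamma>" if "path_edges vs \<subseteq> edges G" for vs
    using that unfolding drawing_points_def by blast
  note mP = mid[OF d(1) len(1) E(1) hd(1) last(1)] and mQ = mid[OF d(2) len(2) E(2) hd(2) last(2)]
    and mR = mid[OF d(3) len(3) E(3) hd(3) last(3)]
  have PQ: "path_image c1 \<inter> path_image c2 = {p a, p b}" unfolding c1(4) c2(4)
    using Int[of P Q] d len E hd last int by blast
  have PR: "path_image c1 \<inter> path_image c3 = {p a, p b}" unfolding c1(4) c3(4)
    using Int[of P R] d len E hd last int by blast
  have QR: "path_image c2 \<inter> path_image c3 = {p a, p b}" unfolding c2(4) c3(4)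
    using Int[of Q R] d len E hd last int by blast
  have comp: "compact (path_image c1)" "compact (path_image c2)" "compact (path_image c3)"
    by (rule compact_path_image[OF arc_imp_path], fact)+
  have ne: "path_image c1 \<noteq> {p a, p b}" "path_image c2 \<noteq> {p a, p b}" "path_image c3 \<noteq>
    {p a, p b}"
    unfolding c1(4) c2(4) c3(4) using mP mQ mR by blast+
  from theta_curve[OF c1(1) c2(1) c3(1) c1(2,3) c2(2,3) c3(2,3) PQ PR QR ne]
  consider "path_image c1 \<inter> inside (path_image c2 \<union> path_image c3) \<noteq> {}"
    | "path_image c2 \<inter> inside (path_image c1 \<union> path_image c3) \<noteq> {}"
    | "path_image c3 \<inter> inside (path_image c1 \<union> path_image c2) \<noteq> {}" by blast
  then show False
  proof cases
    case 1
    obtain m where "m \<in> verts G" "p m \<in> path_image c1" "p m \<noteq> p a" "p m \<noteq> p b" using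
      mP c1(4) by auto
    then show False
      by (rule no[OF c1(1-3) _ _ _ _ _ 1])
        (use PQ PR comp sub E c2(4) c3(4) in \<open>simp_all add: Int_Un_distrib compact_Un\<close>)
  next
    case 2
    obtain m where "m \<in> verts G" "p m \<in> path_image c2" "p m \<noteq> p a" "p m \<noteq> p b" using
      mQ c2(4) by auto
    then show False
      by (rule no[OF c2(1-3) _ _ _ _ _ 2])
        (use PQ QR comp sub E c1(4) c3(4) in \<open>simp_all add: Int_Un_distrib compact_Un Int_commute\<close>)
  next
    case 3
    obtain m where "m \<in> verts G" "p m \<in> path_image c3" "p m \<noteq> p a" "p m \<noteq> p b" using
      mR c3(4) by auto
    then show False
      by (rule no[OF c3(1-3) _ _ _ _ _ 3])
        (use QR PR comp sub E c2(4) c1(4) in \<open>simp_all add: Int_Un_distrib compact_Un Int_commute\<close>)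
  qed
qed

section \<open>The complete graph on four vertices\<close>

lemma connected_arc_minus_end:
  fixes c :: "real \<Rightarrow> 'a::topological_space"
  assumes "arc c"
  shows "connected (path_image c - {pathstart c})" "connected (path_image c - {pathfinish c})"
proof -
  have cont: "continuous_on {0..1} c" and inj: "inj_on c {0..1}"
    using assms unfolding arc_def path_def by auto
  have "{0<..1::real} = {0..1} - {0}" "{0..<1::real} = {0..1} - {1}" by auto
  then have "c ` {0<..1} = path_image c - {pathstart c}" "c ` {0..<1} = path_image c - {pathfinish c}"
    unfolding path_image_def pathstart_def pathfinish_def
    using inj_on_image_set_diff[OF inj, of "{0..1}" "{0}"] inj_on_image_set_diff[OF inj, of "{0..1}" "{1}"]
    by auto
  moreover have "connected (c ` {0<..1})" "connected (c ` {0..<1})"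
    by (intro connected_continuous_image continuous_on_subset[OF cont]; force)+
  ultimately show "connected (path_image c - {pathstart c})" "connected (path_image c - {pathfinish c})"
    by auto
qed

text \<open>The 4-cycle \<open>a c b d\<close> encloses both remaining edges \<open>a b\<close> and \<open>c d\<close>, because it cannot
  enclose a vertex; but the edge \<open>a b\<close> separates \<open>c\<close> from \<open>d\<close> inside the cycle.\<close>

theorem outerplanar_no_K4:
  assumes G: "outerplanar G" "simple_graph G"
    and d: "distinct [a, b, c, d]"
    and E: "{a, b} \<in> edges G" "{a, c} \<in> edges G" "{a, d} \<in> edges G"
      "{b, c} \<in> edges G" "{b, d} \<in> edges G" "{c, d} \<in> edges G"
  shows False
proof -
  obtain p \<gamma> where pg: "plane_drawing G p \<gamma>" and outer: "p ` verts G \<subseteq> frontier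
    (outside (drawing_points G p \<gamma>))"
    using G(1) unfolding outerplanar_def by blast
  let ?g = "\<lambda>x y. path_image (\<gamma> {x, y})"
  have V: "a \<in> verts G" "b \<in> verts G" "c \<in> verts G" "d \<in> verts G"
    using G(2) E unfolding simple_graph_def by auto
  then have pd: "p a \<noteq> p b" "p a \<noteq> p c" "p a \<noteq> p d" "p b \<noteq> p c" "p b \<noteq> p
    d" "p c \<noteq> p d"
    using d plane_drawing_inj[OF pg] unfolding inj_on_def by auto
  have arc2: "\<exists>g. arc g \<and> pathstart g = p x \<and> pathfinish g = p y \<and> path_image g = ?g x y"
    if "{x, y} \<in> edges G" "x \<noteq> y" for x y
    using edge_arc[OF pg that] .
  have arc3: "\<exists>g. arc g \<and> pathstart g = p x \<and> pathfinish g = p y \<and> path_image g = ?g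
    x z \<union> ?g z y"
    if "{x, z} \<in> edges G" "{z, y} \<in> edges G" "distinct [x, y, z]" for x y z
    using path_arc[OF pg, of "[x, z, y]"] that by (auto simp: insert_commute)
  have I: "?g x y \<inter> ?g z w = p ` ({x, y} \<inter> {z, w})"
    if "{x, y} \<in> edges G" "{z, w} \<in> edges G" "{x, y} \<noteq> {z, w}" for x y z w
  proof
    show "?g x y \<inter> ?g z w \<subseteq> p ` ({x, y} \<inter> {z, w})" by (rule plane_drawing_Int[OF pg
      that])
    show "p ` ({x, y} \<inter> {z, w}) \<subseteq> ?g x y \<inter> ?g z w"
      using edge_image_ends[OF pg that(1)] edge_image_ends[OF pg that(2)] by blast
  qed
  have ne: "{a, b} \<noteq> {a, c}" "{a, b} \<noteq> {a, d}" "{a, b} \<noteq> {b, c}" "{a, b} \<noteq> {b,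
    d}" "{a, b} \<noteq> {c, d}"
    "{a, c} \<noteq> {a, d}" "{a, c} \<noteq> {b, c}" "{a, c} \<noteq> {b, d}" "{a, c} \<noteq> {c, d}"
    "{a, d} \<noteq> {b, c}" "{a, d} \<noteq> {b, d}" "{a, d} \<noteq> {c, d}"
    "{b, c} \<noteq> {b, d}" "{b, c} \<noteq> {c, d}" "{b, d} \<noteq> {c, d}"
    using d by (auto simp: doubleton_eq_iff)
  have dd: "a \<noteq> b" "b \<noteq> a" "a \<noteq> c" "c \<noteq> a" "a \<noteq> d" "d \<noteq> a" "b
    \<noteq> c" "c \<noteq> b" "b \<noteq> d" "d \<noteq> b" "c \<noteq> d" "d \<noteq> c"
    using d by auto
  have Is: "?g a b \<inter> ?g a c = {p a}" "?g a b \<inter> ?g a d = {p a}" "?g a b \<inter> ?g b c = {p b}"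
    "?g a b \<inter> ?g b d = {p b}" "?g a b \<inter> ?g c d = {}" "?g a c \<inter> ?g a d = {p a}"
    "?g a c \<inter> ?g b c = {p c}" "?g a c \<inter> ?g b d = {}" "?g a c \<inter> ?g c d = {p c}"
    "?g a d \<inter> ?g b c = {}" "?g a d \<inter> ?g b d = {p d}" "?g a d \<inter> ?g c d = {p d}"
    "?g b c \<inter> ?g b d = {p b}" "?g b c \<inter> ?g c d = {p c}" "?g b d \<inter> ?g c d = {p d}"
    using I[OF E(1) E(2) ne(1)] I[OF E(1) E(3) ne(2)] I[OF E(1) E(4) ne(3)] I[OF E(1) E(5) ne(4)]
      I[OF E(1) E(6) ne(5)] I[OF E(2) E(3) ne(6)] I[OF E(2) E(4) ne(7)] I[OF E(2) E(5) ne(8)]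
      I[OF E(2) E(6) ne(9)] I[OF E(3) E(4) ne(10)] I[OF E(3) E(5) ne(11)] I[OF E(3) E(6) ne(12)]
      I[OF E(4) E(5) ne(13)] I[OF E(4) E(6) ne(14)] I[OF E(5) E(6) ne(15)] dd
    by (simp_all add: Int_insert_left)
  have sub: "?g x y \<subseteq> drawing_points G p \<gamma>" if "{x, y} \<in> edges G" for x y
    using that unfolding drawing_points_def by blast
  have out: "p v \<notin> inside S" if "v \<in> verts G" "compact S" "S \<subseteq> drawing_points G p
    \<gamma>" for v S
    using drawing_outer_vertex[of p v G \<gamma> S] outer that compact_imp_closed by blast
  have comp: "compact (?g x y)" if "{x, y} \<in> edges G" for x y
    using plane_drawing_edge(1)[OF pg that] by (simp add: compact_path_image arc_imp_path)
  have bc: "{c, b} = {b, c}" "{d, b} = {b, d}" "{c, a} = {a, c}" "{d, a} = {a, d}" "{d, c} = {c, d}" by auto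
  obtain ab where ab: "arc ab" "pathstart ab = p a" "pathfinish ab = p b" "path_image ab = ?g a b"
    using arc2[OF E(1)] d by auto
  obtain cd where cd: "arc cd" "pathstart cd = p c" "pathfinish cd = p d" "path_image cd = ?g c d"
    using arc2[OF E(6)] d by auto
  obtain acb where acb: "arc acb" "pathstart acb = p a" "pathfinish acb = p b" "path_image acb = ?g a c
    \<union> ?g b c"
    using arc3[of a c b] E d bc by auto
  obtain adb where adb: "arc adb" "pathstart adb = p a" "pathfinish adb = p b" "path_image adb = ?g a d
    \<union> ?g b d"
    using arc3[of a d b] E d bc by auto
  obtain cad where cad: "arc cad" "pathstart cad = p c" "pathfinish cad = p d" "path_image cad = ?g a c
    \<union> ?g a d"
    using arc3[of c a d] E d bc by auto
  obtain cbd where cbd: "arc cbd" "pathstart cbd = p c" "pathfinish cbd = p d" "path_image cbd = ?g b c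
    \<union> ?g b d"
    using arc3[of c b d] E d bc by auto
  define Q where "Q = ?g a c \<union> ?g b c \<union> (?g a d \<union> ?g b d)"
  have comm: "X \<inter> Y = Z" if "Y \<inter> X = Z" for X Y Z :: "complex set" using that by blast
  note Is' = Is Is[THEN comm]
  have i1: "path_image ab \<inter> path_image acb = {p a, p b}" "path_image ab \<inter> path_image adb = {p
    a, p b}"
    "path_image acb \<inter> path_image adb = {p a, p b}"
    unfolding ab acb adb by (simp_all add: Int_Un_distrib Int_Un_distrib2 Is' insert_commute)
  have i2: "path_image cd \<inter> path_image cad = {p c, p d}" "path_image cd \<inter> path_image cbd = {p
    c, p d}"
    "path_image cad \<inter> path_image cbd = {p c, p d}"
    unfolding cd cad cbd by (simp_all add: Int_Un_distrib Int_Un_distrib2 Is' insert_commute)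
  have Qeq: "path_image acb \<union> path_image adb = Q" "path_image cad \<union> path_image cbd = Q"
    unfolding acb adb cad cbd Q_def by blast+
  have no_arc: "path_image x \<noteq> {pathstart x, pathfinish x}" if "arc x" for x :: "real \<Rightarrow>
    complex"
  proof
    assume e: "path_image x = {pathstart x, pathfinish x}"
    have "infinite (path_image x)"
      using that by (simp add: arc_def path_image_def finite_image_iff)
    then show False using e by simp
  qed
  \<comment> \<open>In a theta whose branches \<open>f\<close> and \<open>g\<close> carry the
    vertices \<open>z\<close> and \<open>w\<close>, only \<open>e\<close> can be the enclosed
    branch. This locates a single edge, which has no inner vertex to which
    \<open>outerplanar_no_theta\<close> could appeal.\<close>
  have enc: "path_image e \<inter> inside (path_image f \<union> path_image g) \<noteq> {}"
    if e: "arc e" "pathstart e = p x" "pathfinish e = p y" and f: "arc f" "pathstart f = p x" "pathfinish f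
      = p y"
      and g: "arc g" "pathstart g = p x" "pathfinish g = p y"
      and int: "path_image e \<inter> path_image f = {p x, p y}" "path_image e \<inter> path_image g = {p
        x, p y}"
        "path_image f \<inter> path_image g = {p x, p y}"
      and zw: "z \<in> verts G" "w \<in> verts G" "p z \<in> path_image f" "p w \<in> path_image g"
        "p z \<noteq> p x" "p z \<noteq> p y" "p w \<noteq> p x" "p w \<noteq> p y"
      and sb: "path_image e \<subseteq> drawing_points G p \<gamma>" "path_image f \<subseteq>
        drawing_points G p \<gamma>"
        "path_image g \<subseteq> drawing_points G p \<gamma>"
    for e f g x y z w
  proof (rule ccontr)
    assume n: "\<not> ?thesis"
    have cm: "compact (path_image e)" "compact (path_image f)" "compact (path_image g)"
      using e f g by (auto intro: compact_path_image arc_imp_path)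
    have "path_image f \<inter> inside (path_image e \<union> path_image g) = {}"
      using connected_arc_meets_inside[OF f(1), of "path_image e \<union> path_image g" "p z"]
        out[OF zw(1), of "path_image e \<union> path_image g"] int zw f sb cm
      by (auto simp: Int_Un_distrib Int_commute compact_Un)
    moreover have "path_image g \<inter> inside (path_image e \<union> path_image f) = {}"
      using connected_arc_meets_inside[OF g(1), of "path_image e \<union> path_image f" "p w"]
        out[OF zw(2), of "path_image e \<union> path_image f"] int zw g sb cm
      by (auto simp: Int_Un_distrib Int_commute compact_Un)
    ultimately show False
      using theta_curve[OF e(1) f(1) g(1) e(2,3) f(2,3) g(2,3) int] n no_arc[OF e(1)] no_arc[OF f(1)]
        no_arc[OF g(1)]
        e f g by simp
  qed
  have abQ: "path_image ab \<inter> inside (path_image acb \<union> path_image adb) \<noteq> {}"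
    by (rule enc[OF ab(1-3) acb(1-3) adb(1-3) i1 V(3,4)])
      (use pd edge_image_ends[OF pg E(2)] edge_image_ends[OF pg E(3)] sub E ab acb adb in auto)
  have cdQ: "path_image cd \<inter> inside (path_image cad \<union> path_image cbd) \<noteq> {}"
    by (rule enc[OF cd(1-3) cad(1-3) cbd(1-3) i2 V(1,2)])
      (use pd edge_image_ends[OF pg E(2)] edge_image_ends[OF pg E(4)] sub E cd cad cbd in auto)
  \<comment> \<open>Apart from the points of the arc \<open>ab\<close> itself, the inside of the
    4-cycle falls into the insides of two closed curves, one through \<open>c\<close> and one
    through \<open>d\<close>.\<close>
  obtain split: "inside (path_image acb \<union> path_image ab) \<inter> inside (path_image adb \<union>
    path_image ab) = {}"
      "inside (path_image acb \<union> path_image ab) \<union> inside (path_image adb \<union> path_image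
        ab) \<union>
        (path_image ab - {p a, p b}) = inside (path_image acb \<union> path_image adb)"
    using split_inside_simple_closed_curve[OF arc_imp_simple_path[OF acb(1)] acb(2,3)
      arc_imp_simple_path[OF adb(1)] adb(2,3) arc_imp_simple_path[OF ab(1)] ab(2,3) pd(1)
      i1(3) i1(1)[THEN comm] i1(2)[THEN comm] abQ] by blast
  obtain z where z: "z \<in> ?g c d" "z \<in> inside Q" using cdQ unfolding cd Qeq by blast
  then have "z \<notin> path_image ab" using Is(5) ab(4) by blast
  then consider "z \<in> inside (path_image acb \<union> path_image ab)" | "z \<in> inside (path_image adb
    \<union> path_image ab)"
    using split(2) z(2) unfolding Qeq by blast
  then show False
  proof cases
    case 1
    \<comment> \<open>This curve meets the edge from \<open>c\<close> to \<open>d\<close> only in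
      \<open>p c\<close>, so the rest of the edge lies inside together with \<open>z\<close>, and
      with it the vertex \<open>d\<close>. The other case exchanges \<open>c\<close> and
      \<open>d\<close>.\<close>
    let ?S = "path_image acb \<union> path_image ab"
    have "connected (?g c d - {p c})" using connected_arc_minus_end(1)[OF cd(1)] cd by simp
    moreover have "?g c d \<inter> ?S = {p c}" unfolding acb ab by (simp add: Int_Un_distrib Is')
    moreover have "p c \<notin> inside ?S" using out[OF V(3)] sub E comp acb ab by (simp add: compact_Un)
    ultimately have "?g c d - {p c} \<subseteq> inside ?S"
      using z(1) 1 by (intro connected_outside_component) auto
    then have "p d \<in> inside ?S" using edge_image_ends[OF pg E(6), of d] pd by auto
    then show False using out[OF V(4), of ?S] sub E comp acb ab by (simp add: compact_Un)
  next
    case 2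
    let ?S = "path_image adb \<union> path_image ab"
    have "connected (?g c d - {p d})" using connected_arc_minus_end(2)[OF cd(1)] cd by simp
    moreover have "?g c d \<inter> ?S = {p d}" unfolding adb ab by (simp add: Int_Un_distrib Is')
    moreover have "p d \<notin> inside ?S" using out[OF V(4)] sub E comp adb ab by (simp add: compact_Un)
    ultimately have "?g c d - {p d} \<subseteq> inside ?S"
      using z(1) 2 by (intro connected_outside_component) auto
    then have "p c \<in> inside ?S" using edge_image_ends[OF pg E(6), of c] pd by auto
    then show False using out[OF V(3), of ?S] sub E comp adb ab by (simp add: compact_Un)
  qed
qed

section \<open>Fans\<close>

lemma subset_outside:
  fixes S :: "'a::real_normed_vector set"
  assumes "connected T" "\<not> bounded T" "T \<inter> S = {}"
  shows "T \<subseteq> outside S"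
proof
  fix x assume x: "x \<in> T"
  then have "T \<subseteq> connected_component_set (- S) x"
    using assms by (intro connected_component_maximal) auto
  then have "\<not> bounded (connected_component_set (- S) x)" using assms(2) bounded_subset by blast
  then show "x \<in> outside S" using x assms(3) unfolding outside_def by blast
qed

lemma unbounded_halfplanes: "\<not> bounded {z. Im z > 1}" "\<not> bounded {z. Im z < 0}"
proof -
  have "\<exists>z\<in>{z. Im z > 1}. \<not> norm z \<le> B" for B
    using abs_Im_le_cmod[of "Complex 0 (\<bar>B\<bar> + 2)"] by (intro bexI[of _ "Complex 0 (\<bar>B\<bar>
      + 2)"]) auto
  moreover have "\<exists>z\<in>{z. Im z < 0}. \<not> norm z \<le> B" for B
    using abs_Im_le_cmod[of "Complex 0 (- \<bar>B\<bar> - 2)"] by (intro bexI[of _ "Complex 0 (-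
      \<bar>B\<bar> - 2)"]) auto
  ultimately show "\<not> bounded {z. Im z > 1}" "\<not> bounded {z. Im z < 0}"
    unfolding bounded_iff by blast+
qed

lemma connected_halfplanes: "connected {z. Im z > 1}" "connected {z. Im z < 0}"
  by (intro convex_connected convex_halfspace_Im_gt convex_halfspace_Im_lt)+

text \<open>The hub is drawn at the origin and the spine on the line \<open>Im z = 1\<close>.\<close>

theorem outerplanar_hub_spine:
  fixes f :: "'a \<Rightarrow> nat"
  assumes G: "simple_graph G" and u: "u \<in> verts G"
    and inj: "inj_on f (verts G - {u})"
    and spine: "\<And>a b. {a, b} \<in> edges G \<Longrightarrow> a \<noteq> u \<Longrightarrow> b \<noteq>
      u \<Longrightarrow> f b = Suc (f a) \<or> f a = Suc (f b)"
  shows "outerplanar G"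
proof -
  define p where "p v = (if v = u then 0 else Complex (f v) 1)" for v
  define A where "A e = (SOME a. a \<in> e)" for e :: "'a set"
  define B where "B e = (SOME b. b \<in> e \<and> b \<noteq> A e)" for e :: "'a set"
  define \<gamma> where "\<gamma> e = linepath (p (A e)) (p (B e))" for e
  have AB: "e = {A e, B e}" "A e \<noteq> B e" if "e \<in> edges G" for e
  proof -
    obtain x y where xy: "e = {x, y}" "x \<noteq> y" using G \<open>e \<in> edges G\<close> unfolding
      simple_graph_def
      by (metis card_2_iff)
    have A: "A e \<in> e" unfolding A_def by (rule someI[of _ x]) (use xy in auto)
    have "B e \<in> e \<and> B e \<noteq> A e" unfolding B_def by (rule someI_ex) (use xy A in auto)
    then show "e = {A e, B e}" "A e \<noteq> B e" using A xy by auto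
  qed
  have ev: "e \<subseteq> verts G" if "e \<in> edges G" for e using G that unfolding simple_graph_def by blast
  have inj_p: "inj_on p (verts G)"
    using inj unfolding inj_on_def p_def by (auto simp: complex_eq_iff)
  have ends: "{pathstart (\<gamma> e), pathfinish (\<gamma> e)} = p ` e" if "e \<in> edges G" for e
    unfolding \<gamma>_def using AB[OF that] by (metis image_insert image_empty pathfinish_linepath
      pathstart_linepath)
  have arc: "arc (\<gamma> e)" if "e \<in> edges G" for e
    unfolding \<gamma>_def using AB[OF that] ev[OF that] inj_p by (metis arc_linepath inj_on_contraD
      insert_subset)
  \<comment> \<open>A spoke lies on the line through the origin and the point of \<open>v\<close>, a
    spine edge on the line \<open>Im z = 1\<close> between consecutive integers. The crossing
    arguments work with these equations and bounds.\<close>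
  have edge_cases: "(\<exists>v. e = {u, v} \<and> v \<in> verts G \<and> v \<noteq> u \<and>
        (\<forall>z\<in>path_image (\<gamma> e). 0 \<le> Im z \<and> Im z \<le> 1 \<and> Re z = f v * Im
          z)) \<or>
      (\<exists>v w. e = {v, w} \<and> v \<in> verts G \<and> w \<in> verts G \<and> v \<noteq> u \<and> w
        \<noteq> u \<and> f w = Suc (f v) \<and>
        (\<forall>z\<in>path_image (\<gamma> e). Im z = 1 \<and> f v \<le> Re z \<and> Re z \<le> f v +
          1))" (is "?H e \<or> ?S e")
    if e: "e \<in> edges G" for e
  proof -
    have img: "path_image (\<gamma> e) = closed_segment (p x) (p y)" if "e = {x, y}" for x y
      using AB[OF e] that unfolding \<gamma>_def by (auto simp: doubleton_eq_iff closed_segment_commute)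
    show ?thesis
    proof (cases "u \<in> e")
      case True
      then have "A e = u \<or> B e = u" using AB(1)[OF e] by (metis insert_iff singletonD)
      then obtain v where v: "e = {u, v}" "v \<noteq> u" using AB[OF e] by (metis insert_commute)
      have "0 \<le> Im z \<and> Im z \<le> 1 \<and> Re z = f v * Im z" if "z \<in> path_image (\<gamma> e)"
        for z
        using that v unfolding img[OF v(1)] p_def closed_segment_def by auto
      then show ?thesis using v ev[OF e] by blast
    next
      case False
      have "\<exists>v w. e = {v, w} \<and> f w = Suc (f v)"
        using spine[of "A e" "B e"] AB[OF e] e False by (metis insert_commute insertI1)
      then obtain v w where vw: "e = {v, w}" "f w = Suc (f v)" by blast
      have ne: "v \<noteq> u" "w \<noteq> u" using False vw by auto
      have "Im z = 1 \<and> f v \<le> Re z \<and> Re z \<le> f v + 1" if z: "z \<in> path_image (\<gamma>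
        e)" for z
      proof -
        obtain s where s: "0 \<le> s" "s \<le> 1" "z = (1 - s) *\<^sub>R Complex (f v) 1 + s *\<^sub>R
          Complex (f w) 1"
          using z ne unfolding img[OF vw(1)] p_def closed_segment_def by auto
        have "Re z = f v + s" "Im z = 1" unfolding s(3) vw(2) by (simp_all add: algebra_simps)
        then show ?thesis using s by auto
      qed
      then show ?thesis using vw ne ev[OF e] by blast
    qed
  qed
  have real_between: "x = k \<or> x = Suc k" if "real k \<le> real x" "real x \<le> real k + 1" for x k :: nat
    using that by linarith
  have f_eq: "v = w" if "f v = f w" "v \<in> verts G" "w \<in> verts G" "v \<noteq> u" "w \<noteq> u" for v w
    using inj that unfolding inj_on_def by auto
  have vert: "path_image (\<gamma> e) \<inter> p ` verts G = p ` e" if e: "e \<in> edges G" for e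
  proof
    show "p ` e \<subseteq> path_image (\<gamma> e) \<inter> p ` verts G"
      using ends[OF e] ev[OF e] pathstart_in_path_image pathfinish_in_path_image
      by (metis Int_subset_iff empty_subsetI image_mono insert_subset)
    show "path_image (\<gamma> e) \<inter> p ` verts G \<subseteq> p ` e"
    proof
      fix z assume "z \<in> path_image (\<gamma> e) \<inter> p ` verts G"
      then obtain x where x: "x \<in> verts G" "z = p x" "p x \<in> path_image (\<gamma> e)" by blast
      have "x \<in> e"
        using edge_cases[OF e]
      proof
        assume "?H e"
        then obtain v where v: "e = {u, v}" "v \<in> verts G" "v \<noteq> u" "Re (p x) = f v * Im (p x)"
          using x(3) by blast
        show ?thesis
        proof (cases "x = u")
          case False
          then have "f x = f v" using v unfolding p_def by simp
          then show ?thesis using f_eq[of x v] v x False by auto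
        qed (use v in auto)
      next
        assume "?S e"
        then obtain v w where vw: "e = {v, w}" "v \<in> verts G" "w \<in> verts G" "v \<noteq> u" "w
          \<noteq> u" "f w = Suc (f v)"
          "Im (p x) = 1" "f v \<le> Re (p x)" "Re (p x) \<le> f v + 1" using x(3) by blast
        then have "x \<noteq> u" unfolding p_def by auto
        then have "f x = f v \<or> f x = f w" using vw real_between[of "f v" "f x"] unfolding p_def by auto
        then show ?thesis using f_eq[of x v] f_eq[of x w] vw x \<open>x \<noteq> u\<close> by auto
      qed
      then show "z \<in> p ` e" using x by blast
    qed
  qed
  have HS: "z \<in> p ` (e \<inter> e')"
    if H: "?H e" "z \<in> path_image (\<gamma> e)" and S: "?S e'" "z \<in> path_image (\<gamma> e')" for e e' z
  proof -
    obtain v where v: "e = {u, v}" "v \<in> verts G" "v \<noteq> u" "Re z = f v * Im z" using H by blast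
    obtain a b where ab: "e' = {a, b}" "a \<in> verts G" "b \<in> verts G" "a \<noteq> u" "b \<noteq> u" "f
      b = Suc (f a)"
      "Im z = 1" "f a \<le> Re z" "Re z \<le> f a + 1" using S by blast
    have "f v = f a \<or> f v = f b" using v ab real_between[of "f a" "f v"] by auto
    then have "v \<in> e'" using f_eq[of v a] f_eq[of v b] v ab by auto
    moreover have "z = p v" using v ab unfolding p_def by (simp add: complex_eq_iff)
    ultimately show ?thesis using v by auto
  qed
  have cross: "path_image (\<gamma> e) \<inter> path_image (\<gamma> e') \<subseteq> p ` (e \<inter> e')"
    if e: "e \<in> edges G" "e' \<in> edges G" "e \<noteq> e'" for e e'
  proof
    fix z assume z: "z \<in> path_image (\<gamma> e) \<inter> path_image (\<gamma> e')"
    consider "?H e" "?H e'" | "?H e" "?S e'" | "?S e" "?H e'" | "?S e" "?S e'"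
      using edge_cases[OF e(1)] edge_cases[OF e(2)] by argo
    then show "z \<in> p ` (e \<inter> e')"
    proof cases
      case 1
      obtain v where v: "e = {u, v}" "v \<in> verts G" "v \<noteq> u" "Re z = f v * Im z" using 1(1) z by blast
      obtain w where w: "e' = {u, w}" "w \<in> verts G" "w \<noteq> u" "Re z = f w * Im z" using 1(2) z by blast
      have "f v \<noteq> f w" using f_eq[of v w] v w e(3) by auto
      then have "z = 0" using v w by (simp add: complex_eq_iff)
      then show ?thesis using v w unfolding p_def by auto
    next
      case 2 then show ?thesis using HS[of e z e'] z by blast
    next
      case 3 then show ?thesis using HS[of e' z e] z by blast
    next
      case 4
      obtain a b where ab: "e = {a, b}" "a \<in> verts G" "b \<in> verts G" "a \<noteq> u" "b \<noteq> u"
        "f b = Suc (f a)"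
        "Im z = 1" "f a \<le> Re z" "Re z \<le> f a + 1" using 4(1) z by blast
      obtain c d where cd: "e' = {c, d}" "c \<in> verts G" "d \<in> verts G" "c \<noteq> u" "d \<noteq> u"
        "f d = Suc (f c)"
        "f c \<le> Re z" "Re z \<le> f c + 1" using 4(2) z by blast
      have "f a \<noteq> f c"
      proof
        assume "f a = f c"
        then have "a = c" "b = d" using f_eq[of a c] f_eq[of b d] ab cd by auto
        then show False using e(3) ab cd by auto
      qed
      then consider "f c = f b" "Re z = f b" | "f a = f d" "Re z = f d"
        using ab(6,8,9) cd(6-8) by linarith
      then show ?thesis
      proof cases
        case 1
        then have "c = b" using f_eq[of c b] ab cd by auto
        moreover have "z = p b" using 1 ab unfolding p_def by (simp add: complex_eq_iff)
        ultimately show ?thesis using ab cd by auto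
      next
        case 2
        then have "a = d" using f_eq[of a d] ab cd by auto
        moreover have "z = p d" using 2 ab cd unfolding p_def by (simp add: complex_eq_iff)
        ultimately show ?thesis using ab cd by auto
      qed
    qed
  qed
  have draw: "plane_drawing G p \<gamma>"
    unfolding plane_drawing_def using inj_p arc ends vert cross by blast
  let ?D = "drawing_points G p \<gamma>"
  have strip: "0 \<le> Im z \<and> Im z \<le> 1" if z: "z \<in> ?D" for z
  proof -
    consider "z \<in> p ` verts G" | e where "e \<in> edges G" "z \<in> path_image (\<gamma> e)"
      using z unfolding drawing_points_def by blast
    then show ?thesis
    proof cases
      case 1 then show ?thesis unfolding p_def by auto
    next
      case 2
      from edge_cases[OF 2(1)] show ?thesis
      proof
        assume "?H e" then show ?thesis using 2(2) by blast
      next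
        assume "?S e"
        then have "Im z = 1" using 2(2) by blast
        then show ?thesis by simp
      qed
    qed
  qed
  \<comment> \<open>Both half-planes beside the strip belong to the outer face; spine vertices are
    approached from the upper one, the hub from the lower one.\<close>
  have "{z. Im z > 1} \<inter> ?D = {}" "{z. Im z < 0} \<inter> ?D = {}" using strip by fastforce+
  then have out: "{z. Im z > 1} \<subseteq> outside ?D" "{z. Im z < 0} \<subseteq> outside ?D"
    using subset_outside connected_halfplanes unbounded_halfplanes by blast+
  have "p v \<in> frontier (outside ?D)" if v: "v \<in> verts G" for v
  proof -
    have "p v \<in> ?D" using v unfolding drawing_points_def by blast
    then have "p v \<notin> outside ?D" using outside_no_overlap[of ?D] by blast
    moreover have "\<exists>z\<in>outside ?D. dist z (p v) < e" if "e > 0" for e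
    proof -
      define z where "z = (if v = u then Complex 0 (- e / 2) else p v + Complex 0 (e / 2))"
      have "z \<in> outside ?D" using out that unfolding z_def p_def by auto
      moreover have "z - p v = (if v = u then Complex 0 (- e / 2) else Complex 0 (e / 2))"
        unfolding z_def p_def by (simp add: complex_eq_iff)
      then have "dist z (p v) < e" using that unfolding dist_norm by (simp add: cmod_def)
      ultimately show ?thesis by blast
    qed
    then have "p v \<in> closure (outside ?D)" unfolding closure_approachable by blast
    ultimately show ?thesis unfolding frontier_def using interior_subset by blast
  qed
  then show ?thesis unfolding outerplanar_def using draw by blast
qed

text \<open>Each list in \<open>Ps\<close> is one path of the spine. The condition
  \<open>distinct (u # concat Ps)\<close> states at once that the paths are simple, disjoint and
  avoid the hub.\<close>

definition fan_graph :: "'a \<Rightarrow> 'a list list \<Rightarrow> 'a sgraph" where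
  "fan_graph u Ps = \<lparr>verts = insert u (set (concat Ps)),
     edges = (\<lambda>v. {u, v}) ` set (concat Ps) \<union> (\<Union>P\<in>set Ps. path_edges P)\<rparr>"

lemma verts_fan [simp]: "verts (fan_graph u Ps) = insert u (set (concat Ps))"
  and edges_fan: "edges (fan_graph u Ps) =
    (\<lambda>v. {u, v}) ` set (concat Ps) \<union> (\<Union>P\<in>set Ps. path_edges P)"
  by (simp_all add: fan_graph_def)

lemma path_edge_card: "distinct vs \<Longrightarrow> e \<in> path_edges vs \<Longrightarrow> card e = 2"
  by (auto simp: path_edges_nth nth_eq_iff_index_eq)

lemma distinct_concat_in: "distinct (concat Ps) \<Longrightarrow> P \<in> set Ps \<Longrightarrow> distinct P"
  by (induction Ps) auto

lemma simple_fan: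
  assumes "distinct (u # concat Ps)"
  shows "simple_graph (fan_graph u Ps)"
proof -
  have "e \<subseteq> insert u (set (concat Ps)) \<and> card e = 2" if e: "e \<in> edges (fan_graph u Ps)" for e
  proof -
    from e consider v where "v \<in> set (concat Ps)" "e = {u, v}" | P where "P \<in> set Ps" "e \<in>
      path_edges P"
      unfolding edges_fan by blast
    then show ?thesis
    proof cases
      case 1
      then show ?thesis using assms by (auto simp: card_2_iff)
    next
      case 2
      then have "distinct P" using assms distinct_concat_in by auto
      then show ?thesis using 2 path_edge_card path_edges_subset by fastforce
    qed
  qed
  then show ?thesis unfolding simple_graph_def by simp
qed

lemma path_edges_append1: "path_edges P \<subseteq> path_edges (P @ Q)"
proof
  fix e assume "e \<in> path_edges P"
  then obtain i where "e = {P ! i, P ! Suc i}" "Suc i < length P" unfolding path_edges_nth by blast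
  then show "e \<in> path_edges (P @ Q)" unfolding path_edges_nth
    by (intro CollectI exI[of _ i]) (auto simp: nth_append)
qed

lemma path_edges_append2: "path_edges Q \<subseteq> path_edges (P @ Q)"
proof
  fix e assume "e \<in> path_edges Q"
  then obtain i where "e = {Q ! i, Q ! Suc i}" "Suc i < length Q" unfolding path_edges_nth by blast
  then show "e \<in> path_edges (P @ Q)" unfolding path_edges_nth
    by (intro CollectI exI[of _ "length P + i"]) (auto simp: nth_append)
qed

lemma path_edges_concat: "P \<in> set Ps \<Longrightarrow> path_edges P \<subseteq> path_edges (concat Ps)"
proof (induction Ps)
  case (Cons Q Ps)
  then show ?case using path_edges_append1[of Q "concat Ps"] path_edges_append2[of "concat Ps" Q] by auto
qed simp

text \<open>Numbering by the position in \<open>concat Ps\<close> works, since an edge of a path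
  joins neighbouring positions. It yields the drawing of the fan and later excludes cycles in the
  spine.\<close>

lemma fan_spine:
  assumes "distinct (u # concat Ps)"
  shows "\<exists>f :: 'a \<Rightarrow> nat. inj_on f (set (concat Ps)) \<and>
    (\<forall>a b. {a, b} \<in> edges (fan_graph u Ps) \<longrightarrow> a \<noteq> u \<longrightarrow> b
      \<noteq> u \<longrightarrow> f b = Suc (f a) \<or> f a = Suc (f b))"
proof -
  let ?L = "concat Ps"
  define f where "f v = (THE i. i < length ?L \<and> ?L ! i = v)" for v
  have f: "f (?L ! i) = i" if "i < length ?L" for i
    unfolding f_def using that assms by (intro the_equality) (auto simp: nth_eq_iff_index_eq)
  have "inj_on f (set ?L)" by (rule inj_onI) (metis f in_set_conv_nth)
  moreover have "f b = Suc (f a) \<or> f a = Suc (f b)"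
    if "{a, b} \<in> edges (fan_graph u Ps)" "a \<noteq> u" "b \<noteq> u" for a b
  proof -
    have "{a, b} \<in> path_edges ?L"
      using that path_edges_concat unfolding edges_fan by (auto simp: doubleton_eq_iff)
    then obtain i where "{a, b} = {?L ! i, ?L ! Suc i}" "Suc i < length ?L"
      unfolding path_edges_nth by blast
    then show ?thesis using f[of i] f[of "Suc i"] by (auto simp: doubleton_eq_iff)
  qed
  ultimately show ?thesis by blast
qed

lemma outerplanar_fan:
  assumes "distinct (u # concat Ps)"
  shows "outerplanar (fan_graph u Ps)"
proof -
  obtain f :: "'a \<Rightarrow> nat" where f: "inj_on f (set (concat Ps))"
    "\<And>a b. {a, b} \<in> edges (fan_graph u Ps) \<Longrightarrow> a \<noteq> u \<Longrightarrow> b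
      \<noteq> u \<Longrightarrow> f b = Suc (f a) \<or> f a = Suc (f b)"
    using fan_spine[OF assms] by blast
  have i: "inj_on f (verts (fan_graph u Ps) - {u})" by (rule inj_on_subset[OF f(1)]) auto
  show ?thesis
    by (rule outerplanar_hub_spine[OF simple_fan[OF assms] _ i f(2)]) auto
qed

section \<open>Perron vectors and Rayleigh quotients\<close>

text \<open>Vectors indexed by \<open>V\<close> are total functions vanishing off \<open>V\<close>,
  so compactness comes from Tychonoff's theorem: the sphere is a closed subset of a product of
  intervals and points.\<close>

lemma compact_coordinates:
  fixes V :: "'a set"
  assumes "finite V"
  shows "compact {x :: 'a \<Rightarrow> real. (\<forall>v. v \<notin> V \<longrightarrow> x v = 0) \<and>
    (\<Sum>v\<in>V. (x v)\<^sup>2) = 1}"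
proof -
  let ?K = "PiE UNIV (\<lambda>v. if v \<in> V then {-1..1::real} else {0})"
  have "compactin (product_topology (\<lambda>_::'a. euclidean :: real topology) UNIV) ?K"
    by (subst compactin_PiE) auto
  then have K: "compact ?K" by (simp add: euclidean_product_topology)
  have "continuous_on UNIV (\<lambda>x :: 'a \<Rightarrow> real. \<Sum>v\<in>V. (x v)\<^sup>2)"
    by (intro continuous_intros continuous_on_product_coordinates)
  then have C: "closed {x :: 'a \<Rightarrow> real. (\<Sum>v\<in>V. (x v)\<^sup>2) = 1}"
    by (intro closed_Collect_eq continuous_on_const)
  have "{x :: 'a \<Rightarrow> real. (\<forall>v. v \<notin> V \<longrightarrow> x v = 0) \<and>
    (\<Sum>v\<in>V. (x v)\<^sup>2) = 1} = 
    ?K \<inter> {x. (\<Sum>v\<in>V. (x v)\<^sup>2) = 1}"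
  proof (intro Set.set_eqI iffI)
    fix x :: "'a \<Rightarrow> real" assume x: "x \<in> {x. (\<forall>v. v \<notin> V \<longrightarrow> x v
      = 0) \<and> (\<Sum>v\<in>V. (x v)\<^sup>2) = 1}"
    have "\<bar>x v\<bar> \<le> 1" if "v \<in> V" for v
    proof -
      have "(x v)\<^sup>2 \<le> (\<Sum>v\<in>V. (x v)\<^sup>2)" using member_le_sum[of v V "\<lambda>v. (x
        v)\<^sup>2"] that assms by simp
      then show ?thesis using x by (simp add: abs_square_le_1)
    qed
    then show "x \<in> ?K \<inter> {x. (\<Sum>v\<in>V. (x v)\<^sup>2) = 1}" using x by (auto simp:
      abs_le_iff PiE_iff)
  next
    fix x assume x: "x \<in> ?K \<inter> {x. (\<Sum>v\<in>V. (x v)\<^sup>2) = 1}"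
    have "x v = 0" if "v \<notin> V" for v using x that by (auto simp: PiE_iff dest!: spec[of _ v])
    then show "x \<in> {x. (\<forall>v. v \<notin> V \<longrightarrow> x v = 0) \<and> (\<Sum>v\<in>V. (x
      v)\<^sup>2) = 1}" using x by blast
  qed
  then show ?thesis using compact_Int_closed[OF K C] by simp
qed

lemma quadratic_nonneg_imp_zero:
  fixes b c :: real
  assumes "\<And>e. 0 \<le> e * b + e\<^sup>2 * c"
  shows "b = 0"
proof (rule ccontr)
  assume b: "b \<noteq> 0"
  define d where "d = \<bar>c\<bar> + 1"
  \<comment> \<open>Near \<open>0\<close> the linear term dominates; this value makes the expression
    at most \<open>- (b / d)\<^sup>2\<close>.\<close>
  define e where "e = - b / d"
  have d: "d > 0" "\<bar>c\<bar> = d - 1" unfolding d_def by auto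
  have "e * b + e\<^sup>2 * c \<le> e * b + e\<^sup>2 * \<bar>c\<bar>" by (simp add: mult_left_mono)
  also have "\<dots> = - (b / d)\<^sup>2"
    unfolding e_def d(2) using d(1) by (simp add: field_simps power2_eq_square)
  also have "\<dots> < 0" using b d by simp
  finally show False using assms[of e] by simp
qed

section \<open>Neighbourhood sums and the quadratic form of the adjacency matrix\<close>

definition nbrs :: "'a sgraph \<Rightarrow> 'a \<Rightarrow> 'a set" where
  "nbrs G v = {w \<in> verts G. {v, w} \<in> edges G}"

definition quad_form :: "'a sgraph \<Rightarrow> ('a \<Rightarrow> real) \<Rightarrow> real" where
  "quad_form G y = (\<Sum>v\<in>verts G. y v * (\<Sum>w\<in>nbrs G v. y w))"

lemma finite_verts: "simple_graph G \<Longrightarrow> finite (verts G)"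
  unfolding simple_graph_def by blast

lemma finite_nbrs: "simple_graph G \<Longrightarrow> finite (nbrs G v)"
  unfolding nbrs_def by (simp add: finite_verts)

lemma nbrs_sym: "v \<in> verts G \<Longrightarrow> w \<in> nbrs G v \<Longrightarrow> v \<in> nbrs G w"
  unfolding nbrs_def by (simp add: insert_commute)

lemma nbrs_verts: "w \<in> nbrs G v \<Longrightarrow> w \<in> verts G"
  unfolding nbrs_def by simp

lemma nbrs_irrefl: "simple_graph G \<Longrightarrow> v \<notin> nbrs G v"
  unfolding nbrs_def simple_graph_def by fastforce

text \<open>Double counting of the adjacent pairs between \<open>A\<close> and
  \<open>B\<close>.\<close>

lemma sum_nbrs_swap:
  fixes h :: "'a \<Rightarrow> 'a \<Rightarrow> 'b::comm_monoid_add"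
  assumes "simple_graph G" "A \<subseteq> verts G" "B \<subseteq> verts G"
  shows "(\<Sum>v\<in>A. \<Sum>w\<in>nbrs G v \<inter> B. h v w) = (\<Sum>w\<in>B. \<Sum>v\<in>nbrs G w
    \<inter> A. h v w)"
proof -
  have "finite A" "finite B" using assms finite_verts finite_subset by metis+
  moreover have "nbrs G v \<inter> B = {w \<in> B. {v, w} \<in> edges G}" "nbrs G w \<inter> A = {v \<in>
    A. {v, w} \<in> edges G}" for v w
    using assms unfolding nbrs_def by (auto simp: insert_commute)
  ultimately show ?thesis using sum.swap_restrict[of A B h "\<lambda>v w. {v, w} \<in> edges G"] by simp
qed

lemma sum_nbrs_sym:
  fixes x y :: "'a \<Rightarrow> real"
  assumes "simple_graph G"
  shows "(\<Sum>v\<in>verts G. x v * (\<Sum>w\<in>nbrs G v. y w)) = (\<Sum>v\<in>verts G. y v *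
    (\<Sum>w\<in>nbrs G v. x w))"
proof -
  have "nbrs G v \<inter> verts G = nbrs G v" for v unfolding nbrs_def by auto
  then show ?thesis
    using sum_nbrs_swap[OF assms, of "verts G" "verts G" "\<lambda>v w. x v * y w"]
    by (simp add: sum_distrib_left mult.commute)
qed

text \<open>There is no term in \<open>e\<^sup>2\<close> because a vertex is not its own
  neighbour.\<close>

lemma quad_form_update:
  assumes G: "simple_graph G" and v: "v \<in> verts G"
  shows "quad_form G (\<lambda>w. x w + (if w = v then e else 0)) =
    quad_form G x + 2 * e * (\<Sum>w\<in>nbrs G v. x w)"
proof -
  let ?d = "\<lambda>w. if w = v then e else 0"
  have fin: "finite (verts G)" "finite (nbrs G w)" for w
    using finite_verts[OF G] finite_nbrs[OF G] by auto
  have 1: "(\<Sum>w\<in>verts G. ?d w * (\<Sum>z\<in>nbrs G w. y z)) = e * (\<Sum>z\<in>nbrs G v. y z)" for y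
  proof -
    have "(\<Sum>w\<in>verts G. ?d w * (\<Sum>z\<in>nbrs G w. y z)) = (\<Sum>w\<in>verts G. if w = v then e
      * (\<Sum>z\<in>nbrs G v. y z) else 0)"
      by (intro sum.cong) auto
    then show ?thesis using fin v by simp
  qed
  have 2: "(\<Sum>w\<in>nbrs G v. ?d w) = 0" using nbrs_irrefl[OF G, of v] fin by simp
  have "quad_form G (\<lambda>w. x w + ?d w) =
      quad_form G x + (\<Sum>w\<in>verts G. x w * (\<Sum>z\<in>nbrs G w. ?d z)) + (\<Sum>w\<in>verts G. ?d
        w * (\<Sum>z\<in>nbrs G w. x z))
      + (\<Sum>w\<in>verts G. ?d w * (\<Sum>z\<in>nbrs G w. ?d z))"
    unfolding quad_form_def by (simp only: sum.distrib distrib_left distrib_right)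
  also have "(\<Sum>w\<in>verts G. x w * (\<Sum>z\<in>nbrs G w. ?d z)) = (\<Sum>w\<in>verts G. ?d w *
    (\<Sum>z\<in>nbrs G w. x z))"
    by (rule sum_nbrs_sym[OF G])
  finally show ?thesis unfolding 1 2 by simp
qed

text \<open>A maximiser of the quadratic form on the unit sphere stays one after taking absolute
  values. Perturbing it in one coordinate and comparing the terms linear in \<open>e\<close> gives
  the eigenvalue equation at that vertex. The graph may be disconnected, so the entries are only
  nonnegative.\<close>

lemma Rayleigh_maximum:
  assumes G: "simple_graph G" and ne: "verts G \<noteq> {}"
  shows "\<exists>m x. (\<forall>v\<in>verts G. 0 \<le> x v) \<and> (\<exists>v\<in>verts G. 0 < x v) \<and>
    (\<forall>v\<in>verts G. (\<Sum>w\<in>nbrs G v. x w) = m * x v) \<and>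
    (\<forall>y. quad_form G y \<le> m * (\<Sum>v\<in>verts G. (y v)\<^sup>2))"
proof -
  let ?V = "verts G"
  note fin = finite_verts[OF G]
  define S where "S = {x :: 'a \<Rightarrow> real. (\<forall>v. v \<notin> ?V \<longrightarrow> x v = 0)
    \<and> (\<Sum>v\<in>?V. (x v)\<^sup>2) = 1}"
  have S: "compact S" unfolding S_def by (rule compact_coordinates[OF fin])
  obtain v0 where v0: "v0 \<in> ?V" using ne by blast
  have "(\<lambda>v. if v = v0 then 1 else 0) \<in> S" unfolding S_def using v0 fin
    by (auto simp: if_distrib[of "\<lambda>x. x\<^sup>2"] cong: if_cong)
  then have "S \<noteq> {}" by blast
  moreover have "continuous_on S (quad_form G)"
    unfolding quad_form_def
    by (intro continuous_intros continuous_on_subset[OF continuous_on_product_coordinates]) auto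
  ultimately have "\<exists>x0\<in>S. \<forall>y\<in>S. quad_form G y \<le> quad_form G x0"
    by (intro continuous_attains_sup[OF S])
  then obtain x0 where x0: "x0 \<in> S" "\<And>y. y \<in> S \<Longrightarrow> quad_form G y \<le> quad_form
    G x0"
    by blast
  define m where "m = quad_form G x0"
  have bound: "quad_form G y \<le> m * (\<Sum>v\<in>?V. (y v)\<^sup>2)" for y
  proof (cases "(\<Sum>v\<in>?V. (y v)\<^sup>2) = 0")
    case True
    then have "\<forall>v\<in>?V. y v = 0" using fin by (simp add: sum_nonneg_eq_0_iff)
    then have "quad_form G y = 0" unfolding quad_form_def by simp
    then show ?thesis using True by simp
  next
    case False
    define s where "s = sqrt (\<Sum>v\<in>?V. (y v)\<^sup>2)"
    have pos: "(\<Sum>v\<in>?V. (y v)\<^sup>2) > 0" using False by (simp add: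
      order.not_eq_order_implies_strict sum_nonneg)
    then have s: "s > 0" "s\<^sup>2 = (\<Sum>v\<in>?V. (y v)\<^sup>2)" unfolding s_def by auto
    define z where "z v = (if v \<in> ?V then y v / s else 0)" for v
    have "(\<Sum>v\<in>?V. (z v)\<^sup>2) = (\<Sum>v\<in>?V. (y v)\<^sup>2) / s\<^sup>2"
      unfolding z_def by (simp add: power_divide sum_divide_distrib)
    then have "z \<in> S" using s pos unfolding S_def z_def by auto
    then have "quad_form G z \<le> m" using x0(2) m_def by simp
    moreover have "quad_form G z = quad_form G y / s\<^sup>2"
    proof -
      have "(\<Sum>w\<in>nbrs G v. z w) = (\<Sum>w\<in>nbrs G v. y w) / s" for v
        unfolding z_def sum_divide_distrib by (intro sum.cong) (auto dest: nbrs_verts)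
      then have "quad_form G z = (\<Sum>v\<in>?V. y v / s * ((\<Sum>w\<in>nbrs G v. y w) / s))"
        unfolding quad_form_def by (intro sum.cong) (auto simp: z_def)
      then show ?thesis unfolding quad_form_def sum_divide_distrib
        by (simp add: power2_eq_square flip: sum_divide_distrib)
    qed
    ultimately have "quad_form G y \<le> m * s\<^sup>2" using s(1) by (simp add: pos_divide_le_eq)
    then show ?thesis using s(2) by simp
  qed
  define x where "x v = \<bar>x0 v\<bar>" for v
  have xS: "(\<Sum>v\<in>?V. (x v)\<^sup>2) = 1" using x0(1) unfolding S_def x_def by simp
  have "m \<le> quad_form G x"
  proof -
    have "x0 v * (\<Sum>w\<in>nbrs G v. x0 w) \<le> x v * (\<Sum>w\<in>nbrs G v. x w)" for v
    proof -
      have "x0 v * (\<Sum>w\<in>nbrs G v. x0 w) \<le> \<bar>x0 v\<bar> * \<bar>\<Sum>w\<in>nbrs G v. x0 w\<bar>"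
        by (metis abs_ge_self abs_mult)
      also have "\<dots> \<le> x v * (\<Sum>w\<in>nbrs G v. x w)" unfolding x_def by (intro mult_left_mono
        sum_abs) auto
      finally show ?thesis .
    qed
    then show ?thesis unfolding m_def quad_form_def by (intro sum_mono)
  qed
  then have xm: "quad_form G x = m" using bound[of x] xS by simp
  have eig: "(\<Sum>w\<in>nbrs G v. x w) = m * x v" if v: "v \<in> ?V" for v
  proof -
    have "0 \<le> e * (2 * (m * x v - (\<Sum>w\<in>nbrs G v. x w))) + e\<^sup>2 * m" for e
    proof -
      let ?y = "\<lambda>w. x w + (if w = v then e else 0)"
      have "(\<Sum>w\<in>?V. (?y w)\<^sup>2) = (\<Sum>w\<in>?V. (x w)\<^sup>2 + (if w = v then 2 * e * x v
        + e\<^sup>2 else 0))"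
        by (intro sum.cong) (auto simp: power2_eq_square algebra_simps)
      also have "\<dots> = 1 + (2 * e * x v + e\<^sup>2)" using fin v xS by (simp add: sum.distrib)
      finally have "quad_form G ?y \<le> m * (1 + (2 * e * x v + e\<^sup>2))" using bound[of ?y] by simp
      then show ?thesis unfolding quad_form_update[OF G v] xm by (simp add: algebra_simps)
    qed
    from quadratic_nonneg_imp_zero[OF this] show ?thesis by simp
  qed
  have "\<exists>v\<in>?V. 0 < x v"
  proof (rule ccontr)
    assume "\<not> ?thesis"
    then have "\<forall>v\<in>?V. x v = 0" unfolding x_def by auto
    then show False using xS by simp
  qed
  moreover have "\<forall>v\<in>?V. 0 \<le> x v" unfolding x_def by simp
  ultimately show ?thesis using eig bound by blast
qed

lemma adjacency_matrix_mult:
  assumes G: "simple_graph G" and i: "i < card (verts G)"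
  shows "vec_index (adjacency_matrix G *\<^sub>v Matrix.vec (card (verts G)) (\<lambda>j. g (from_nat_into
    (verts G) j))) i =
    (\<Sum>w\<in>nbrs G (from_nat_into (verts G) i). g w)"
proof -
  let ?V = "verts G" and ?f = "from_nat_into (verts G)"
  have bij: "bij_betw ?f {..<card ?V} ?V" using bij_betw_from_nat_into_finite[OF finite_verts[OF G]] .
  have "vec_index (adjacency_matrix G *\<^sub>v Matrix.vec (card ?V) (\<lambda>j. g (?f j))) i =
    (\<Sum>j\<in>{..<card ?V}. if {?f i, ?f j} \<in> edges G then g (?f j) else 0)"
    using i unfolding adjacency_matrix_def
    by (simp add: scalar_prod_def atLeast0LessThan if_distrib[of "\<lambda>x. x * _"] cong: if_cong)
  also have "\<dots> = (\<Sum>w\<in>?V. if {?f i, w} \<in> edges G then g w else 0)"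
    by (rule sum.reindex_bij_betw[OF bij])
  also have "\<dots> = (\<Sum>w\<in>nbrs G (?f i). g w)"
    unfolding nbrs_def using finite_verts[OF G] by (simp add: sum.inter_filter)
  finally show ?thesis .
qed

text \<open>The maximum of the Rayleigh quotient is an eigenvalue, and the absolute values of a
  complex eigenvector for \<open>k\<close> form a test vector that gives
  \<open>norm k \<le> m\<close>. From here on the spectral radius is handled through these two
  properties, without matrices.\<close>

theorem Perron:
  assumes G: "simple_graph G" and ne: "verts G \<noteq> {}"
  shows "\<exists>x. (\<forall>v\<in>verts G. 0 \<le> x v) \<and> (\<exists>v\<in>verts G. 0 < x v) \<and>
      (\<forall>v\<in>verts G. (\<Sum>w\<in>nbrs G v. x w) = graph_spectral_radius G * x v)" (is ?P)
    and "quad_form G y \<le> graph_spectral_radius G * (\<Sum>v\<in>verts G. (y v)\<^sup>2)" (is ?R)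
proof -
  let ?V = "verts G" and ?A = "adjacency_matrix G" and ?f = "from_nat_into (verts G)"
  let ?n = "card ?V"
  obtain m x where x: "\<And>v. v \<in> ?V \<Longrightarrow> 0 \<le> x v" "\<exists>v\<in>?V. 0 < x v"
    "\<And>v. v \<in> ?V \<Longrightarrow> (\<Sum>w\<in>nbrs G v. x w) = m * x v"
    and bound: "\<And>y. quad_form G y \<le> m * (\<Sum>v\<in>?V. (y v)\<^sup>2)"
    using Rayleigh_maximum[OF G ne] by blast
  note fin = finite_verts[OF G]
  have n: "?n > 0" using fin ne by (simp add: card_gt_0_iff)
  have A: "?A \<in> carrier_mat ?n ?n" unfolding adjacency_matrix_def by simp
  have bij: "bij_betw ?f {..<?n} ?V" using bij_betw_from_nat_into_finite[OF fin] .
  have fV: "?f i \<in> ?V" if "i < ?n" for i using bij that unfolding bij_betw_def by auto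
  have onto: "\<exists>i<?n. ?f i = u" if "u \<in> ?V" for u
  proof -
    have "u \<in> ?f ` {..<?n}" using bij that unfolding bij_betw_def by simp
    then show ?thesis by auto
  qed
  obtain v1 where v1: "v1 \<in> ?V" "0 < x v1" using x(2) by blast
  have m0: "m \<ge> 0"
  proof -
    have "0 \<le> m * x v1" unfolding x(3)[OF v1(1), symmetric] by (intro sum_nonneg x(1)) (auto dest:
      nbrs_verts)
    then show ?thesis using v1 by (simp add: zero_le_mult_iff)
  qed
  have "complex_of_real m \<in> spectrum ?A"
  proof -
    let ?v = "Matrix.vec ?n (\<lambda>j. complex_of_real (x (?f j)))"
    obtain i where i: "i < ?n" "?f i = v1" using onto[OF v1(1)] by blast
    have "?v $ i \<noteq> 0" using i v1 by simp
    then have "?v \<noteq> 0\<^sub>v ?n" using i by (metis index_zero_vec(1))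
    moreover have "?A *\<^sub>v ?v = complex_of_real m \<cdot>\<^sub>v ?v"
    proof (rule eq_vecI)
      fix i assume "i < dim_vec (complex_of_real m \<cdot>\<^sub>v ?v)"
      then have i: "i < ?n" by simp
      show "(?A *\<^sub>v ?v) $ i = (complex_of_real m \<cdot>\<^sub>v ?v) $ i"
        unfolding adjacency_matrix_mult[OF G i, of "\<lambda>v. complex_of_real (x v)"] using i x(3)[OF
          fV[OF i]]
        by (simp flip: of_real_sum)
    qed (use A in simp)
    ultimately have "eigenvector ?A ?v (complex_of_real m)" unfolding eigenvector_def using A by auto
    then show ?thesis unfolding spectrum_def eigenvalue_def by blast
  qed
  then have "norm (complex_of_real m) \<le> Spectral_Radius.spectral_radius ?A"
    using spectral_radius_mem_max(2)[OF A n] by blast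
  then have le: "m \<le> Spectral_Radius.spectral_radius ?A" using m0 by simp
  have ge: "norm k \<le> m" if k: "k \<in> spectrum ?A" for k
  proof -
    obtain v where v: "eigenvector ?A v k" using k unfolding spectrum_def eigenvalue_def by blast
    then have dv: "dim_vec v = ?n" "v \<noteq> 0\<^sub>v ?n" "?A *\<^sub>v v = k \<cdot>\<^sub>v v" using A
      unfolding eigenvector_def by auto
    define g where "g w = vec_index v (the_inv_into {..<?n} ?f w)" for w
    have gf: "g (?f j) = vec_index v j" if "j < ?n" for j
      unfolding g_def using the_inv_into_f_f[of ?f "{..<?n}" j] bij that unfolding bij_betw_def by simp
    have vg: "v = Matrix.vec ?n (\<lambda>j. g (?f j))" by (rule eq_vecI) (use dv gf in auto)
    have eig: "(\<Sum>w\<in>nbrs G u. g w) = k * g u" if u: "u \<in> ?V" for u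
    proof -
      obtain i where i: "i < ?n" "?f i = u" using onto[OF u] by blast
      have "(\<Sum>w\<in>nbrs G u. g w) = vec_index (?A *\<^sub>v v) i"
        using adjacency_matrix_mult[OF G i(1), of g] i vg by simp
      also have "\<dots> = k * g u" unfolding dv(3) using i dv(1) gf[OF i(1)] by simp
      finally show ?thesis .
    qed
    have "norm k * (\<Sum>u\<in>?V. (norm (g u))\<^sup>2) = (\<Sum>u\<in>?V. norm (g u) * norm (k * g u))"
      by (simp add: sum_distrib_left norm_mult power2_eq_square mult_ac)
    also have "\<dots> = (\<Sum>u\<in>?V. norm (g u) * norm (\<Sum>w\<in>nbrs G u. g w))" using eig by simp
    also have "\<dots> \<le> quad_form G (\<lambda>u. norm (g u))"
      unfolding quad_form_def by (intro sum_mono mult_left_mono norm_sum) auto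
    also have "\<dots> \<le> m * (\<Sum>u\<in>?V. (norm (g u))\<^sup>2)" by (rule bound)
    finally have *: "norm k * (\<Sum>u\<in>?V. (norm (g u))\<^sup>2) \<le> m * (\<Sum>u\<in>?V. (norm (g
      u))\<^sup>2)" .
    have "(\<Sum>u\<in>?V. (norm (g u))\<^sup>2) > 0"
    proof (rule ccontr)
      assume "\<not> ?thesis"
      then have "(\<Sum>u\<in>?V. (norm (g u))\<^sup>2) = 0" by (meson antisym_conv not_less sum_nonneg
        zero_le_power2)
      then have "\<forall>u\<in>?V. g u = 0" using fin by (simp add: sum_nonneg_eq_0_iff)
      then have "vec_index v i = 0" if "i < ?n" for i using gf[OF that] fV[OF that] by simp
      then have "v = 0\<^sub>v ?n" by (intro eq_vecI) (use dv(1) in simp_all)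
      then show False using dv by blast
    qed
    then show ?thesis using * by simp
  qed
  have "Spectral_Radius.spectral_radius ?A \<in> norm ` spectrum ?A"
    using spectral_radius_mem_max(1)[OF A n] .
  then have "graph_spectral_radius G = m" using ge le unfolding graph_spectral_radius_def by fastforce
  then show ?P ?R using x bound by auto
qed

section \<open>A vertex of almost full degree\<close>

lemma sum_nbrs_card:
  fixes x :: "'a \<Rightarrow> real"
  assumes "simple_graph G" "S \<subseteq> verts G"
  shows "(\<Sum>w\<in>S. \<Sum>z\<in>nbrs G w. x z) = (\<Sum>z\<in>verts G. card (nbrs G z \<inter> S) * x z)"
proof -
  have "nbrs G w \<inter> verts G = nbrs G w" for w by (auto dest: nbrs_verts)
  then show ?thesis
    using sum_nbrs_swap[OF assms, of "verts G" "\<lambda>w z. x z"] by simp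
qed

lemma sum_card_swap:
  assumes "simple_graph G" "A \<subseteq> verts G" "B \<subseteq> verts G"
  shows "(\<Sum>v\<in>A. card (nbrs G v \<inter> B)) = (\<Sum>v\<in>B. card (nbrs G v \<inter> A))"
  using sum_nbrs_swap[OF assms, of "\<lambda>v w. 1::nat"] by simp

text \<open>Let \<open>u\<close> maximise the Perron vector \<open>x\<close>, normalised to \<open>x u = 1\<close>, and let \<open>W\<close> be the
  set of vertices not adjacent to \<open>u\<close>. Counting walks of length two from \<open>u\<close> gives \<open>\<rho>\<^sup>2 \<le>
  deg u + 2 \<rho> + O(card W / \<rho>)\<close>, so \<open>W\<close> has at most about \<open>2 \<rho>\<close> elements; a second such count
  shows that all other entries of \<open>x\<close> are \<open>O(1 / \<rho>)\<close>. Giving the value \<open>1 / \<rho>\<close> to the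
  vertices of \<open>W\<close> produces a test vector with a larger Rayleigh quotient in every graph that
  joins \<open>u\<close> to \<open>W\<close> and keeps the edges around \<open>u\<close>.\<close>

lemma hub_dominates:
  fixes G :: "'a sgraph" and \<rho> :: real
  assumes G: "simple_graph G"
    and l: "\<rho> = graph_spectral_radius G" "\<rho> \<ge> 100" "\<rho>\<^sup>2 \<ge> real (card (verts
      G)) - 1"
    and codeg: "\<And>a b. a \<in> verts G \<Longrightarrow> b \<in> verts G \<Longrightarrow> a \<noteq> b
      \<Longrightarrow> card (nbrs G a \<inter> nbrs G b) \<le> 2"
    and second: "\<And>u w. u \<in> verts G \<Longrightarrow> w \<in> verts G \<Longrightarrow> w \<noteq>
      u \<Longrightarrow> w \<notin> nbrs G u \<Longrightarrow>
      card (nbrs G w \<inter> {z \<in> verts G. z \<noteq> u \<and> z \<notin> nbrs G u \<and> nbrs G z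
        \<inter> nbrs G u \<noteq> {}}) \<le> 2"
    and ne: "verts G \<noteq> {}"
  shows "\<exists>u\<in>verts G. verts G = insert u (nbrs G u) \<or>
    (\<forall>G'. simple_graph G' \<longrightarrow> verts G' = verts G \<longrightarrow>
      (\<forall>v\<in>verts G - {u}. {u, v} \<in> edges G') \<longrightarrow>
      (\<forall>e\<in>edges G. e \<subseteq> insert u (nbrs G u) \<longrightarrow> e \<in> edges G')
        \<longrightarrow> \<rho> < graph_spectral_radius G')"
proof -
  let ?V = "verts G" and ?N = "nbrs G"
  note fin = finite_verts[OF G] and finN = finite_nbrs[OF G]
  obtain x0 where x0: "\<And>v. v \<in> ?V \<Longrightarrow> 0 \<le> x0 v" "\<exists>v\<in>?V. 0 < x0 v"
    "\<And>v. v \<in> ?V \<Longrightarrow> (\<Sum>w\<in>?N v. x0 w) = \<rho> * x0 v"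
    using Perron(1)[OF G ne] unfolding l(1)[symmetric] by blast
  have "Max (x0 ` ?V) \<in> x0 ` ?V" using fin ne by (intro Max_in) auto
  then obtain u where "u \<in> ?V" "x0 u = Max (x0 ` ?V)" by (metis imageE)
  then have u: "u \<in> ?V" "\<And>v. v \<in> ?V \<Longrightarrow> x0 v \<le> x0 u" using fin by auto
  have x0u: "x0 u > 0" using x0(2) u(2) by (meson less_le_trans)
  define x where "x v = x0 v / x0 u" for v
  have x_nonneg: "0 \<le> x v" if "v \<in> ?V" for v unfolding x_def using x0(1)[OF that] x0u by simp
  have x_le1: "x v \<le> 1" if "v \<in> ?V" for v unfolding x_def using u(2)[OF that] x0u by simp
  have xu: "x u = 1" unfolding x_def using x0u by simp
  have eig: "(\<Sum>w\<in>?N v. x w) = \<rho> * x v" if "v \<in> ?V" for v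
    unfolding x_def using x0(3)[OF that] by (simp flip: sum_divide_distrib)
  define W where "W = ?V - insert u (?N u)"
  \<comment> \<open>\<open>L\<close> consists of the vertices at distance two from \<open>u\<close>:
    those in \<open>W\<close> that end a walk of length two from \<open>u\<close>.\<close>
  define L where "L = {z \<in> W. ?N z \<inter> ?N u \<noteq> {}}"
  define k where "k = real (card W)"
  define d where "d = real (card (?N u))"
  have NV: "?N v \<subseteq> ?V" for v unfolding nbrs_def by auto
  have NVi: "w \<in> ?V" if "w \<in> ?N v" for v w using that by (rule nbrs_verts)
  have uN: "u \<notin> ?N u" using nbrs_irrefl[OF G] .
  have V: "?V = insert u (?N u \<union> W)" "u \<notin> ?N u \<union> W" "?N u \<inter> W = {}"
    using u(1) NV uN unfolding W_def by auto
  have WV: "W \<subseteq> ?V" and LW: "L \<subseteq> W" unfolding W_def L_def by auto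
  have finW: "finite W" "finite L"
    using finite_subset[OF WV fin] finite_subset[OF LW] by auto
  have sumV: "(\<Sum>z\<in>?V. h z) = h u + (\<Sum>z\<in>?N u. h z) + (\<Sum>z\<in>W. h z)" for h :: "'a
    \<Rightarrow> real"
  proof -
    have "sum h ?V = sum h (insert u (?N u \<union> W))" using V(1) by simp
    also have "\<dots> = h u + (sum h (?N u) + sum h W)"
      using V finN[of u] finW by (simp add: sum.union_disjoint)
    finally show ?thesis by simp
  qed
  have codegR: "real (card (?N a \<inter> ?N b)) \<le> 2" if "a \<in> ?V" "b \<in> ?V" "a \<noteq> b" for a b
    using codeg[OF that] by linarith
  \<comment> \<open>One more application of the eigenvalue equation turns the sum over
    \<open>S\<close> into a weighted count of the edges that enter \<open>S\<close>.\<close>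
  have two: "\<rho> * (\<Sum>w\<in>S. x w) = (\<Sum>z\<in>?V. card (?N z \<inter> S) * x z)" if "S
    \<subseteq> ?V" for S
  proof -
    have "\<rho> * (\<Sum>w\<in>S. x w) = (\<Sum>w\<in>S. \<Sum>z\<in>?N w. x z)"
      unfolding sum_distrib_left by (intro sum.cong) (use eig that in auto)
    then show ?thesis using sum_nbrs_card[OF G that] by simp
  qed
  have card_V: "real (card ?V) = 1 + d + k"
    using sumV[of "\<lambda>_. 1"] unfolding d_def k_def by simp
  have wN: "w \<in> ?V" "w \<noteq> u" "w \<notin> ?N u" "u \<notin> ?N w" if "w \<in> W" for w
    using that nbrs_sym[of w G u] unfolding W_def by auto
  have e_WN: "(\<Sum>z\<in>?N u. real (card (?N z \<inter> W))) \<le> 2 * k"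
  proof -
    have "(\<Sum>z\<in>?N u. real (card (?N z \<inter> W))) = (\<Sum>w\<in>W. real (card (?N w \<inter> ?N u)))"
      using arg_cong[OF sum_card_swap[OF G NV[of u] WV], of real] by simp
    also have "\<dots> \<le> (\<Sum>w\<in>W. 2)" using codegR wN u(1) by (intro sum_mono) auto
    finally show ?thesis unfolding k_def by simp
  qed
  have W2: "real (card (?N w \<inter> L)) \<le> 2" if "w \<in> W" for w
  proof -
    have "L = {z \<in> ?V. z \<noteq> u \<and> z \<notin> ?N u \<and> ?N z \<inter> ?N u \<noteq> {}}"
      unfolding L_def W_def by auto
    then show ?thesis using second[OF u(1) wN(1,2,3)[OF that]] by simp
  qed
  \<comment> \<open>Edges into \<open>L\<close> come from \<open>?N u\<close>, at most
    \<open>2 * k\<close> of them, or from \<open>W\<close>, whose vertices have at most two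
    neighbours in \<open>L\<close> each; \<open>u\<close> has none there.\<close>
  have sumL: "\<rho> * (\<Sum>w\<in>L. x w) \<le> 4 * k"
  proof -
    have "?N u \<inter> L = {}" using LW V(3) by blast
    then have "card (?N u \<inter> L) = 0" by simp
    then have "\<rho> * (\<Sum>w\<in>L. x w) = (\<Sum>z\<in>?N u. card (?N z \<inter> L) * x z) +
      (\<Sum>z\<in>W. card (?N z \<inter> L) * x z)"
      using two[of L] LW WV sumV[of "\<lambda>z. card (?N z \<inter> L) * x z"] by simp
    also have "\<dots> \<le> (\<Sum>z\<in>?N u. real (card (?N z \<inter> W))) + (\<Sum>z\<in>W. 2)"
    proof (intro add_mono sum_mono)
      fix z assume z: "z \<in> ?N u"
      have "card (?N z \<inter> L) \<le> card (?N z \<inter> W)" using LW finN by (intro card_mono) auto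
      then have "card (?N z \<inter> L) * x z \<le> real (card (?N z \<inter> W)) * 1"
        using x_le1[OF NVi[OF z]] x_nonneg[OF NVi[OF z]] by (intro mult_mono) auto
      then show "card (?N z \<inter> L) * x z \<le> card (?N z \<inter> W)" by simp
    next
      fix z assume z: "z \<in> W"
      have "card (?N z \<inter> L) * x z \<le> 2 * 1"
        using W2[OF z] x_le1[of z] x_nonneg[of z] z WV by (intro mult_mono) auto
      then show "card (?N z \<inter> L) * x z \<le> 2" by simp
    qed
    also have "\<dots> \<le> 4 * k" using e_WN unfolding k_def by simp
    finally show ?thesis .
  qed
  \<comment> \<open>As \<open>x u = 1\<close>, the neighbours of \<open>u\<close> have total weight
    \<open>\<rho>\<close>. In the count of walks below, \<open>u\<close> therefore contributes
    \<open>d\<close>, its neighbours at most \<open>2 * \<rho>\<close>, and \<open>W\<close> only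
    what comes from \<open>L\<close>.\<close>
  have lam: "(\<Sum>w\<in>?N u. x w) = \<rho>" using eig[OF u(1)] xu by simp
  have "\<rho>\<^sup>2 = d + (\<Sum>z\<in>?N u. card (?N z \<inter> ?N u) * x z) + (\<Sum>z\<in>W. card (?N
    z \<inter> ?N u) * x z)"
    using two[OF NV[of u]] sumV[of "\<lambda>z. card (?N z \<inter> ?N u) * x z"] lam xu
    unfolding d_def by (simp add: power2_eq_square)
  also have "(\<Sum>z\<in>?N u. card (?N z \<inter> ?N u) * x z) \<le> (\<Sum>z\<in>?N u. 2 * x z)"
  proof (intro sum_mono mult_right_mono)
    fix z assume z: "z \<in> ?N u"
    show "real (card (?N z \<inter> ?N u)) \<le> 2" using codegR[OF NVi[OF z] u(1)] z uN by auto
    show "0 \<le> x z" using x_nonneg[OF NVi[OF z]] .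
  qed
  also have "(\<Sum>z\<in>?N u. 2 * x z) = 2 * \<rho>" using lam by (simp flip: sum_distrib_left)
  also have "(\<Sum>z\<in>W. card (?N z \<inter> ?N u) * x z) = (\<Sum>z\<in>L. card (?N z \<inter> ?N u) *
    x z)"
    using finW LW by (intro sum.mono_neutral_right) (auto simp: L_def)
  also have "\<dots> \<le> (\<Sum>z\<in>L. 2 * x z)"
    using codegR u(1) x_nonneg LW WV wN by (intro sum_mono mult_right_mono) auto
  finally have "\<rho>\<^sup>2 \<le> d + 2 * \<rho> + 2 * (\<Sum>z\<in>L. x z)" by (simp flip: sum_distrib_left)
  \<comment> \<open>The order \<open>1 + d + k\<close> and the lower bound on
    \<open>\<rho>\<^sup>2\<close> give \<open>d + k \<le> \<rho>\<^sup>2\<close>, so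
    \<open>d\<close> cancels.\<close>
  then have k1: "k \<le> 2 * \<rho> + 2 * (\<Sum>z\<in>L. x z)" using l(3) card_V by simp
  have k0: "k \<ge> 0" unfolding k_def by simp
  have "(\<Sum>z\<in>L. x z) \<le> 4 * k / \<rho>" using sumL l(2) by (simp add: pos_le_divide_eq mult.commute)
  \<comment> \<open>This yields \<open>k \<le> 2 * \<rho> + 0.08 * k\<close>, that is,
    \<open>0.92 * k \<le> 2 * \<rho>\<close>.\<close>
  also have "\<dots> \<le> 4 * k / 100" using k0 l(2) by (intro divide_left_mono) auto
  finally have k2: "k \<le> 2.2 * \<rho>" using k1 l(2) by linarith
  show ?thesis
  proof (cases "W = {}")
    case True
    then show ?thesis using V u(1) by auto
  next
    case False
    \<comment> \<open>The bound on \<open>k\<close> is now fed into the eigenvalue equation at a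
      vertex \<open>v\<close> with the largest entry off \<open>u\<close>; the aim is
      \<open>\<rho> * M \<le> 1.15\<close>.\<close>
    define M where "M = Max (x ` (?V - {u}))"
    obtain w0 where "w0 \<in> W" using False by blast
    then have "w0 \<in> ?V - {u}" using wN by simp
    then have finVu: "finite (x ` (?V - {u}))" "?V - {u} \<noteq> {}" using fin by auto
    have M: "x v \<le> M" if "v \<in> ?V" "v \<noteq> u" for v unfolding M_def using that finVu by auto
    have "M \<in> x ` (?V - {u})" unfolding M_def using finVu by (intro Max_in) auto
    then obtain v where v: "v \<in> ?V" "v \<noteq> u" "x v = M" by auto
    have M0: "M \<ge> 0" using v x_nonneg by auto
    let ?s = "\<Sum>b\<in>?N v \<inter> W. x b"
    have "\<rho> * ?s = (\<Sum>z\<in>?V. card (?N z \<inter> (?N v \<inter> W)) * x z)"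
      using WV by (intro two) auto
    also have "\<dots> = (\<Sum>z\<in>?N u. card (?N z \<inter> (?N v \<inter> W)) * x z) + (\<Sum>z\<in>W.
      card (?N z \<inter> (?N v \<inter> W)) * x z)"
    proof -
      have "?N u \<inter> (?N v \<inter> W) = {}" using V(3) by auto
      then show ?thesis unfolding sumV by simp
    qed
    \<comment> \<open>The vertex \<open>z = v\<close> gets an extra term, because the codegree bound
      needs two different vertices; for a single vertex the crude bound \<open>k\<close> is
      affordable.\<close>
    also have "\<dots> \<le> (\<Sum>z\<in>?N u. card (?N z \<inter> W) * M) + (\<Sum>z\<in>W. 2 * M + (if z
      = v then k * M else 0))"
    proof (intro add_mono sum_mono)
      fix z assume z: "z \<in> ?N u"
      have "card (?N z \<inter> (?N v \<inter> W)) \<le> card (?N z \<inter> W)" using finN by (intro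
        card_mono) auto
      then show "card (?N z \<inter> (?N v \<inter> W)) * x z \<le> card (?N z \<inter> W) * M"
        using M[of z] x_nonneg[of z] z NV uN by (intro mult_mono) auto
    next
      fix z assume z: "z \<in> W"
      have xz: "0 \<le> x z" "x z \<le> M" using M[of z] x_nonneg[of z] wN[OF z] by auto
      show "card (?N z \<inter> (?N v \<inter> W)) * x z \<le> 2 * M + (if z = v then k * M else 0)"
      proof (cases "z = v")
        case True
        have "card (?N z \<inter> (?N v \<inter> W)) \<le> card W" using finW by (intro card_mono) auto
        then have "card (?N z \<inter> (?N v \<inter> W)) * x z \<le> k * M" unfolding k_def using xz by
          (intro mult_mono) auto
        then show ?thesis using True M0 by simp
      next
        case False
        have "card (?N z \<inter> (?N v \<inter> W)) \<le> card (?N z \<inter> ?N v)" using finN by (intro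
          card_mono) auto
        then have "real (card (?N z \<inter> (?N v \<inter> W))) \<le> 2" using codegR[of z v] wN[OF z] v
          False by linarith
        then show ?thesis using xz False by (simp add: mult_mono)
      qed
    qed
    also have "\<dots> \<le> 2 * k * M + (2 * k * M + k * M)"
    proof (intro add_mono)
      show "(\<Sum>z\<in>?N u. card (?N z \<inter> W) * M) \<le> 2 * k * M"
        using mult_right_mono[OF e_WN M0] by (simp flip: sum_distrib_right)
      show "(\<Sum>z\<in>W. 2 * M + (if z = v then k * M else 0)) \<le> 2 * k * M + k * M"
        using finW M0 k0 by (simp add: sum.distrib k_def)
    qed
    finally have "\<rho> * ?s \<le> 5 * k * M" by (simp add: mult_ac)
    also have "\<dots> \<le> 5 * (2.2 * \<rho>) * M" using k2 M0 by (intro mult_right_mono) auto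
    finally have "\<rho> * ?s \<le> \<rho> * (11 * M)" by (simp add: mult_ac)
    then have s: "?s \<le> 11 * M" using l(2) by simp
    have "\<rho> * M = (\<Sum>w\<in>?N v. x w)" using eig[OF v(1)] v(3) by simp
    also have "\<dots> \<le> 1 + (\<Sum>w\<in>?N v \<inter> ?N u. x w) + ?s"
    proof -
      have "?N v \<subseteq> {u} \<union> (?N v \<inter> ?N u) \<union> (?N v \<inter> W)" using NV V(1) by auto
      then have "(\<Sum>w\<in>?N v. x w) \<le> (\<Sum>w\<in>{u} \<union> (?N v \<inter> ?N u) \<union> (?N
        v \<inter> W). x w)"
        using finN finW x_nonneg NV u(1) WV by (intro sum_mono2) auto
      also have "\<dots> = (\<Sum>w\<in>{u} \<union> (?N v \<inter> ?N u). x w) + ?s"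
        using finN finW V by (intro sum.union_disjoint) auto
      also have "(\<Sum>w\<in>{u} \<union> (?N v \<inter> ?N u). x w) = (\<Sum>w\<in>{u}. x w) +
        (\<Sum>w\<in>?N v \<inter> ?N u. x w)"
        using finN uN by (intro sum.union_disjoint) auto
      finally show ?thesis using xu by simp
    qed
    also have "(\<Sum>w\<in>?N v \<inter> ?N u. x w) \<le> (\<Sum>w\<in>?N v \<inter> ?N u. M)"
      using M NV uN by (intro sum_mono) auto
    also have "\<dots> \<le> 2 * M" using mult_right_mono[OF codegR[OF v(1) u(1) v(2)] M0] by simp
    \<comment> \<open>The \<open>13\<close> is \<open>2\<close> from the common neighbours with
      \<open>u\<close> plus \<open>11 = 5 * 2.2\<close> from \<open>W\<close>. It is at most
      \<open>0.13 * \<rho>\<close>, and \<open>1 / 0.87 < 1.15\<close>.\<close>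
    finally have "(\<rho> - 13) * M \<le> 1" using s by (simp add: algebra_simps)
    moreover have "(0.87 * \<rho>) * M \<le> (\<rho> - 13) * M" using l(2) M0 by (intro mult_right_mono) auto
    ultimately have lM: "\<rho> * M \<le> 1.15" by simp
    have "(\<rho> * M) * (\<rho> * M) \<le> 1.15 * 1.15" using lM M0 l(2) by (intro mult_mono) auto
    then have "\<rho> * (\<rho> * (2 * M * M)) \<le> 2.7" by (simp add: mult_ac)
    moreover have "100 * (\<rho> * (2 * M * M)) \<le> \<rho> * (\<rho> * (2 * M * M))" using l(2) M0 by
      (intro mult_right_mono) auto
    ultimately have small: "\<rho> * (2 * M * M) < 1" by linarith
    have "\<rho> < graph_spectral_radius G'"
      if G': "simple_graph G'" "verts G' = ?V" "\<forall>v\<in>?V - {u}. {u, v} \<in> edges G'"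
        "\<forall>e\<in>edges G. e \<subseteq> insert u (?N u) \<longrightarrow> e \<in> edges G'" for G'
    proof -
      \<comment> \<open>The entry \<open>1 / \<rho>\<close> solves the eigenvalue equation at a
        pendant vertex attached to \<open>u\<close>.\<close>
      define z where "z v = (if v \<in> W then 1 / \<rho> else x v)" for v
      have z0: "z v \<ge> 0" if "v \<in> ?V" for v unfolding z_def using x_nonneg[OF that] l(2) by simp
      note finN' = finite_nbrs[OF G'(1)]
      have zu: "z u = 1" unfolding z_def W_def using xu by simp
      have zN: "z v = x v" if "v \<in> ?N u" for v unfolding z_def using that V(3) by auto
      have sub: "A \<subseteq> nbrs G' v \<Longrightarrow> (\<Sum>w\<in>A. z w) \<le> (\<Sum>w\<in>nbrs G'
        v. z w)" for A v
        using finN' G'(2) z0 by (intro sum_mono2) (auto dest: nbrs_verts)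
      have qu: "\<rho> + k / \<rho> \<le> (\<Sum>w\<in>nbrs G' u. z w)"
      proof -
        have "?N u \<union> W \<subseteq> nbrs G' u" unfolding nbrs_def[of G'] using G'(2,3) V by auto
        from sub[OF this] have "(\<Sum>w\<in>?N u \<union> W. z w) \<le> (\<Sum>w\<in>nbrs G' u. z w)" .
        moreover have "(\<Sum>w\<in>?N u \<union> W. z w) = (\<Sum>w\<in>?N u. z w) + (\<Sum>w\<in>W. z w)"
          using finN finW V by (intro sum.union_disjoint) auto
        moreover have "(\<Sum>w\<in>?N u. z w) = \<rho>" using lam zN by simp
        moreover have "(\<Sum>w\<in>W. z w) = k / \<rho>" unfolding z_def k_def by simp
        ultimately show ?thesis by simp
      qed
      have qN: "\<rho> * x v - (\<Sum>w\<in>?N v \<inter> W. x w) \<le> (\<Sum>w\<in>nbrs G' v. z w)" if v: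
        "v \<in> ?N u" for v
      proof -
        have vV: "v \<in> ?V" using NV v by auto
        have "insert u (?N v \<inter> ?N u) \<subseteq> nbrs G' v"
        proof
          fix w assume w: "w \<in> insert u (?N v \<inter> ?N u)"
          then have "w \<in> ?N v" using nbrs_sym[OF u(1) v] by auto
          then have "{v, w} \<in> edges G" "w \<in> ?V" unfolding nbrs_def by auto
          then show "w \<in> nbrs G' v" using G'(2,4) v w unfolding nbrs_def[of G'] by auto
        qed
        from sub[OF this] have "(\<Sum>w\<in>insert u (?N v \<inter> ?N u). z w) \<le> (\<Sum>w\<in>nbrs G'
          v. z w)" .
        moreover have "(\<Sum>w\<in>insert u (?N v \<inter> ?N u). z w) = (\<Sum>w\<in>insert u (?N v
          \<inter> ?N u). x w)"
          using zu xu zN by (intro sum.cong) auto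
        moreover have "?N v = insert u (?N v \<inter> ?N u) \<union> (?N v \<inter> W)" using NV V(1)
          nbrs_sym[OF u(1) v] by auto
        then have "(\<Sum>w\<in>?N v. x w) = (\<Sum>w\<in>insert u (?N v \<inter> ?N u) \<union> (?N v
          \<inter> W). x w)" by simp
        moreover have "\<dots> = (\<Sum>w\<in>insert u (?N v \<inter> ?N u). x w) + (\<Sum>w\<in>?N v
          \<inter> W. x w)"
          using finN finW V by (intro sum.union_disjoint) auto
        ultimately show ?thesis using eig[OF vV] by simp
      qed
      have qW: "1 \<le> (\<Sum>w\<in>nbrs G' v. z w)" if v: "v \<in> W" for v
      proof -
        have "{u} \<subseteq> nbrs G' v" using G'(2,3) wN[OF v] u(1) unfolding nbrs_def by (auto simp:
          insert_commute)
        from sub[OF this] show ?thesis using zu by simp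
      qed
      have cross: "(\<Sum>v\<in>?N u. x v * (\<Sum>w\<in>?N v \<inter> W. x w)) \<le> k * (2 * M * M)"
      proof -
        have "(\<Sum>v\<in>?N u. x v * (\<Sum>w\<in>?N v \<inter> W. x w)) = (\<Sum>w\<in>W. \<Sum>v\<in>?N
          w \<inter> ?N u. x v * x w)"
          unfolding sum_distrib_left by (rule sum_nbrs_swap[OF G NV WV])
        also have "\<dots> \<le> (\<Sum>w\<in>W. \<Sum>v\<in>?N w \<inter> ?N u. M * M)"
          using M x_nonneg M0 NV uN wN by (intro sum_mono mult_mono) auto
        also have "\<dots> \<le> (\<Sum>w\<in>W. 2 * (M * M))"
        proof (rule sum_mono)
          fix w assume "w \<in> W"
          then have "real (card (?N w \<inter> ?N u)) \<le> 2" using codegR wN u(1) by auto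
          from mult_right_mono[OF this, of "M * M"] M0 show "(\<Sum>v\<in>?N w \<inter> ?N u. M * M) \<le>
            2 * (M * M)" by simp
        qed
        finally show ?thesis unfolding k_def by simp
      qed
      have "quad_form G' z = z u * (\<Sum>w\<in>nbrs G' u. z w) + (\<Sum>v\<in>?N u. z v *
        (\<Sum>w\<in>nbrs G' v. z w))
          + (\<Sum>v\<in>W. z v * (\<Sum>w\<in>nbrs G' v. z w))"
        unfolding quad_form_def G'(2) by (rule sumV)
      moreover have "z u * (\<Sum>w\<in>nbrs G' u. z w) \<ge> \<rho> + k / \<rho>" using qu zu by simp
      moreover have "(\<Sum>v\<in>?N u. z v * (\<Sum>w\<in>nbrs G' v. z w)) \<ge>
          (\<Sum>v\<in>?N u. x v * (\<rho> * x v - (\<Sum>w\<in>?N v \<inter> W. x w)))"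
      proof (rule sum_mono)
        fix v assume v: "v \<in> ?N u"
        show "x v * (\<rho> * x v - (\<Sum>w\<in>?N v \<inter> W. x w)) \<le> z v * (\<Sum>w\<in>nbrs G' v.
          z w)"
          unfolding zN[OF v] using qN[OF v] x_nonneg[OF NVi[OF v]] by (rule mult_left_mono)
      qed
      moreover have "(\<Sum>v\<in>W. z v * (\<Sum>w\<in>nbrs G' v. z w)) \<ge> (\<Sum>v\<in>W. 1 / \<rho> * 1)"
        using qW l(2) by (intro sum_mono) (auto simp: z_def intro!: mult_left_mono divide_right_mono)
      moreover have "(\<Sum>v\<in>?N u. x v * (\<rho> * x v - (\<Sum>w\<in>?N v \<inter> W. x w))) =
          \<rho> * (\<Sum>v\<in>?N u. (x v)\<^sup>2) - (\<Sum>v\<in>?N u. x v * (\<Sum>w\<in>?N v \<inter>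
            W. x w))"
        by (simp add: sum_subtractf right_diff_distrib sum_distrib_left power2_eq_square mult_ac)
      \<comment> \<open>Joining \<open>W\<close> to \<open>u\<close> gains \<open>k / \<rho>\<close>
        at \<open>u\<close> and again in \<open>W\<close>. The new entries cost
        \<open>k / \<rho>\<close> through the norm, and the lost edges between \<open>?N u\<close>
        and \<open>W\<close> cost at most \<open>k * (2 * M * M)\<close>, which is less than
        \<open>k / \<rho>\<close>; a positive surplus remains.\<close>
      ultimately have q: "quad_form G' z \<ge> \<rho> + 2 * (k / \<rho>) + \<rho> * (\<Sum>v\<in>?N u. (x
        v)\<^sup>2) - k * (2 * M * M)"
        using cross unfolding k_def by simp
      have sq: "(\<Sum>v\<in>?V. (z v)\<^sup>2) = 1 + (\<Sum>v\<in>?N u. (x v)\<^sup>2) + k / \<rho>\<^sup>2"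
      proof -
        have "(\<Sum>v\<in>W. (z v)\<^sup>2) = k / \<rho>\<^sup>2" unfolding z_def k_def by (simp add:
          power_divide)
        then show ?thesis using sumV[of "\<lambda>v. (z v)\<^sup>2"] zu zN by simp
      qed
      have "k > 0" using False finW unfolding k_def by (simp add: card_gt_0_iff)
      then have "k * (2 * M * M) < k / \<rho>" using small l(2) by (simp add: field_simps)
      then have "\<rho> * (\<Sum>v\<in>?V. (z v)\<^sup>2) < quad_form G' z"
        using q l(2) unfolding sq by (simp add: distrib_left power2_eq_square)
      also have "\<dots> \<le> graph_spectral_radius G' * (\<Sum>v\<in>?V. (z v)\<^sup>2)"
        using Perron(2)[OF G'(1), of z] G'(2) ne by simp
      finally have "\<rho> * (\<Sum>v\<in>?V. (z v)\<^sup>2) < graph_spectral_radius G' * (\<Sum>v\<in>?V.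
        (z v)\<^sup>2)" .
      then show ?thesis by (simp add: mult_less_cancel_right sum_nonneg not_less)
    qed
    then show ?thesis by (intro bexI[OF _ u(1)] disjI2 allI impI) simp
  qed
qed

section \<open>Spectral comparison of fans\<close>

text \<open>With \<open>B\<close> the adjacency matrix of \<open>G - u\<close>, the hypothesis on
  \<open>y\<close> reads \<open>(\<rho> I - B) y = 1\<close>, and the conclusion is the eigenvalue
  equation at the hub. Pairing \<open>y\<close> with the Perron vector and using the symmetry of
  \<open>B\<close> proves it without inverting a matrix.\<close>

lemma resolvent_sum_eq:
  assumes G: "simple_graph G" and u: "u \<in> verts G" "\<And>v. v \<in> verts G - {u} \<Longrightarrow>
    {u, v} \<in> edges G"
    and y: "\<And>v. v \<in> verts G - {u} \<Longrightarrow> graph_spectral_radius G * y v = 1 +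
      (\<Sum>w\<in>nbrs G v - {u}. y w)"
  shows "(\<Sum>v\<in>verts G - {u}. y v) = graph_spectral_radius G"
proof -
  let ?V = "verts G - {u}" and ?\<rho> = "graph_spectral_radius G"
  have ne: "verts G \<noteq> {}" using u(1) by blast
  obtain x where x: "\<And>v. v \<in> verts G \<Longrightarrow> 0 \<le> x v" "\<exists>v\<in>verts G. 0 < x v"
    "\<And>v. v \<in> verts G \<Longrightarrow> (\<Sum>w\<in>nbrs G v. x w) = ?\<rho> * x v"
    using Perron(1)[OF G ne] by blast
  note fin = finite_verts[OF G] and finN = finite_nbrs[OF G]
  have Nu: "nbrs G u = ?V" using u(2) nbrs_irrefl[OF G, of u] unfolding nbrs_def by auto
  have sumV: "(\<Sum>v\<in>?V. x v) = ?\<rho> * x u" using x(3)[OF u(1)] unfolding Nu .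
  have xu: "x u \<noteq> 0"
  proof
    assume 0: "x u = 0"
    then have "(\<Sum>v\<in>?V. x v) = 0" using sumV by simp
    then have "\<forall>v\<in>?V. x v = 0" using fin x(1) by (subst (asm) sum_nonneg_eq_0_iff) auto
    then show False using 0 x(2) by force
  qed
  have N: "nbrs G v - {u} = nbrs G v \<inter> ?V" for v unfolding nbrs_def by auto
  have xv: "?\<rho> * x v - (\<Sum>w\<in>nbrs G v \<inter> ?V. x w) = x u" if v: "v \<in> ?V" for v
  proof -
    have "u \<in> nbrs G v" using u(1) u(2)[OF v] unfolding nbrs_def by (simp add: insert_commute)
    then have "(\<Sum>w\<in>nbrs G v. x w) = x u + (\<Sum>w\<in>nbrs G v - {u}. x w)"
      using finN by (simp add: sum.remove)
    then show ?thesis using x(3)[of v] v N[of v] by simp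
  qed
  have "(\<Sum>v\<in>?V. y v) * x u = (\<Sum>v\<in>?V. y v * (?\<rho> * x v - (\<Sum>w\<in>nbrs G v
    \<inter> ?V. x w)))"
    using xv by (simp add: sum_distrib_right)
  also have "\<dots> = (\<Sum>v\<in>?V. ?\<rho> * (y v * x v)) - (\<Sum>v\<in>?V. \<Sum>w\<in>nbrs G v
    \<inter> ?V. y v * x w)"
    by (simp add: right_diff_distrib sum_subtractf sum_distrib_left mult_ac)
  also have "(\<Sum>v\<in>?V. \<Sum>w\<in>nbrs G v \<inter> ?V. y v * x w) = (\<Sum>w\<in>?V.
    \<Sum>v\<in>nbrs G w \<inter> ?V. y v * x w)"
    by (rule sum_nbrs_swap[OF G]) auto
  also have "(\<Sum>v\<in>?V. ?\<rho> * (y v * x v)) - \<dots> = (\<Sum>w\<in>?V. (?\<rho> * y w -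
    (\<Sum>v\<in>nbrs G w \<inter> ?V. y v)) * x w)"
    by (simp only: left_diff_distrib sum_subtractf sum_distrib_right mult.assoc)
  also have "\<dots> = (\<Sum>w\<in>?V. x w)"
  proof (intro sum.cong refl)
    fix w assume w: "w \<in> ?V"
    show "(?\<rho> * y w - (\<Sum>v\<in>nbrs G w \<inter> ?V. y v)) * x w = x w" using y[OF w] N[of w] by simp
  qed
  finally have "(\<Sum>v\<in>?V. y v) * x u = ?\<rho> * x u" using sumV by simp
  then show ?thesis using xu by simp
qed

text \<open>The test vector with \<open>1\<close> at the hub and \<open>y\<close> elsewhere
  satisfies the eigenvalue equation for \<open>\<rho>\<close> except at the hub. Its Rayleigh
  quotient therefore exceeds \<open>\<rho>\<close> by the surplus at the hub, the sum of
  \<open>y\<close> minus \<open>\<rho>\<close>, divided by the squared norm.\<close>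

lemma resolvent_sum_le:
  assumes G: "simple_graph G" and u: "u \<in> verts G" "\<And>v. v \<in> verts G - {u} \<Longrightarrow>
    {u, v} \<in> edges G"
    and y: "\<And>v. v \<in> verts G - {u} \<Longrightarrow> \<rho> * y v = 1 + (\<Sum>w\<in>nbrs G v -
      {u}. y w)"
  shows "(\<Sum>v\<in>verts G - {u}. y v) \<ge> \<rho> \<Longrightarrow> graph_spectral_radius G \<ge> \<rho>"
    and "(\<Sum>v\<in>verts G - {u}. y v) > \<rho> \<Longrightarrow> graph_spectral_radius G > \<rho>"
proof -
  let ?V = "verts G - {u}"
  note fin = finite_verts[OF G] and finN = finite_nbrs[OF G]
  define z where "z v = (if v = u then 1 else y v)" for v
  have Nu: "nbrs G u = ?V" using u(2) nbrs_irrefl[OF G, of u] unfolding nbrs_def by auto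
  have zv: "(\<Sum>w\<in>nbrs G v. z w) = \<rho> * y v" if v: "v \<in> ?V" for v
  proof -
    have "u \<in> nbrs G v" using u(1) u(2)[OF v] unfolding nbrs_def by (simp add: insert_commute)
    then have "(\<Sum>w\<in>nbrs G v. z w) = z u + (\<Sum>w\<in>nbrs G v - {u}. z w)"
      using finN by (simp add: sum.remove)
    also have "(\<Sum>w\<in>nbrs G v - {u}. z w) = (\<Sum>w\<in>nbrs G v - {u}. y w)" unfolding z_def by
      (intro sum.cong) auto
    finally show ?thesis using y[OF v] unfolding z_def by simp
  qed
  have "quad_form G z = z u * (\<Sum>w\<in>nbrs G u. z w) + (\<Sum>v\<in>?V. z v * (\<Sum>w\<in>nbrs G v. z w))"
    unfolding quad_form_def using fin u(1) by (simp add: sum.remove)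
  also have "(\<Sum>v\<in>?V. z v * (\<Sum>w\<in>nbrs G v. z w)) = (\<Sum>v\<in>?V. \<rho> * (y v)\<^sup>2)"
  proof (intro sum.cong refl)
    fix v assume v: "v \<in> ?V"
    show "z v * (\<Sum>w\<in>nbrs G v. z w) = \<rho> * (y v)\<^sup>2"
      unfolding zv[OF v] using v by (simp add: z_def power2_eq_square)
  qed
  also have "\<dots> = \<rho> * (\<Sum>v\<in>?V. (y v)\<^sup>2)" by (simp only: sum_distrib_left)
  also have "(\<Sum>w\<in>nbrs G u. z w) = (\<Sum>v\<in>?V. y v)" unfolding Nu by (intro sum.cong) (auto
    simp: z_def)
  finally have q: "quad_form G z = (\<Sum>v\<in>?V. y v) + \<rho> * (\<Sum>v\<in>?V. (y v)\<^sup>2)"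
    unfolding z_def by simp
  have s: "(\<Sum>v\<in>verts G. (z v)\<^sup>2) = 1 + (\<Sum>v\<in>?V. (y v)\<^sup>2)"
    using fin u(1) by (simp add: sum.remove z_def)
  have nn: "(\<Sum>v\<in>?V. (y v)\<^sup>2) \<ge> 0" by (simp add: sum_nonneg)
  have "quad_form G z \<le> graph_spectral_radius G * (1 + (\<Sum>v\<in>?V. (y v)\<^sup>2))"
    using Perron(2)[OF G, of z] u(1) unfolding s by auto
  then have *: "(\<Sum>v\<in>?V. y v) - \<rho> \<le> (graph_spectral_radius G - \<rho>) * (1 +
    (\<Sum>v\<in>?V. (y v)\<^sup>2))"
    unfolding q by (simp add: algebra_simps)
  have pos: "1 + (\<Sum>v\<in>?V. (y v)\<^sup>2) > 0" using nn by simp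
  show "(\<Sum>v\<in>?V. y v) \<ge> \<rho> \<Longrightarrow> graph_spectral_radius G \<ge> \<rho>"
    using * mult_neg_pos[OF _ pos, of "graph_spectral_radius G - \<rho>"] by force
  show "(\<Sum>v\<in>?V. y v) > \<rho> \<Longrightarrow> graph_spectral_radius G > \<rho>"
    using * mult_nonpos_nonneg[of "graph_spectral_radius G - \<rho>", OF _ less_imp_le[OF pos]] by force
qed

text \<open>With \<open>\<rho> = r + 1 / r\<close>, this is the \<open>j\<close>-th entry (counted from \<open>0\<close>) of \<open>(\<rho> I - A)\<^sup>-\<^sup>1
  1\<close>, where \<open>A\<close> is the adjacency matrix of the path on \<open>m\<close> vertices.\<close>

definition path_resolvent :: "real \<Rightarrow> nat \<Rightarrow> nat \<Rightarrow> real" where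
  "path_resolvent r m j = (1 - (r ^ Suc j + r ^ (m - j)) / (1 + r ^ Suc m)) / (r + 1 / r - 2)"

text \<open>What the ends of the path cost: the resolvent entries add up to
  \<open>m / (\<rho> - 2)\<close> minus a positive multiple of this number, with a factor that
  depends on \<open>r\<close> only.\<close>

definition path_defect :: "real \<Rightarrow> nat \<Rightarrow> real" where
  "path_defect r m = (1 - r ^ m) / (1 + r ^ Suc m)"

lemma denominator_pos:
  fixes r :: real
  assumes "0 < r" "r < 1"
  shows "r + 1 / r - 2 > 0"
proof -
  have "r + 1 / r - 2 = (1 - r)\<^sup>2 / r" using assms by (simp add: field_simps power2_eq_square)
  then show ?thesis using assms by simp
qed

text \<open>The constant \<open>1 / (\<rho> - 2)\<close> solves the recurrence, and
  \<open>q i = r ^ i + r ^ (m + 1 - i)\<close> solves the homogeneous one. Dividing \<open>q\<close>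
  by its value at the fictitious positions \<open>0\<close> and \<open>m + 1\<close> makes the
  difference vanish there, which accounts for the missing neighbours. Entry \<open>j\<close> belongs
  to position \<open>j + 1\<close>.\<close>

lemma path_resolvent_rec:
  assumes r: "0 < r" "r < 1" and j: "j < m"
  shows "(r + 1 / r) * path_resolvent r m j = 1 + (if j = 0 then 0 else path_resolvent r m (j - 1))
    + (if Suc j < m then path_resolvent r m (Suc j) else 0)"
proof -
  define D where "D = r + 1 / r - 2"
  define E where "E = 1 + r ^ Suc m"
  define q where "q i = r ^ i + r ^ (Suc m - i)" for i
  have D: "D > 0" unfolding D_def by (rule denominator_pos[OF r])
  have E: "E > 0" unfolding E_def using r by (simp add: add_pos_pos)
  have pr: "path_resolvent r m i = (1 - q (Suc i) / E) / D" for i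
    unfolding path_resolvent_def q_def D_def E_def by simp
  have q0: "q 0 = E" "q (Suc m) = E" unfolding q_def E_def by simp_all
  have prev: "(if j = 0 then 0 else path_resolvent r m (j - 1)) = (1 - q j / E) / D"
    using q0(1) E by (simp add: pr)
  have nxt: "(if Suc j < m then path_resolvent r m (Suc j) else 0) = (1 - q (Suc (Suc j)) / E) / D"
  proof (cases "Suc j < m")
    case False
    then have "Suc j = m" using j by simp
    then show ?thesis using q0(2) E by simp
  qed (simp add: pr)
  have qrec: "(r + 1 / r) * q (Suc j) = q j + q (Suc (Suc j))"
  proof -
    obtain i where i: "m = Suc (j + i)" using j less_imp_Suc_add by blast
    have e: "Suc m - Suc j = Suc i" "Suc m - j = Suc (Suc i)" "Suc m - Suc (Suc j) = i" unfolding i by auto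
    show ?thesis unfolding q_def e using r by (simp add: field_simps)
  qed
  have "(r + 1 / r) * ((1 - q (Suc j) / E) / D) = ((D + 2) - (r + 1 / r) * q (Suc j) / E) / D"
    unfolding D_def by (simp add: algebra_simps)
  also have "\<dots> = 1 + (1 - q j / E) / D + (1 - q (Suc (Suc j)) / E) / D"
    unfolding qrec using D E by (simp add: field_simps)
  finally show ?thesis unfolding prev nxt unfolding pr by simp
qed

lemma path_resolvent_sum:
  assumes r: "0 < r" "r < 1"
  shows "(\<Sum>j<m. path_resolvent r m j) = (m - 2 * r / (1 - r) * path_defect r m) / (r + 1 / r - 2)"
proof -
  have 1: "(\<Sum>j<m. r ^ Suc j) = r * (1 - r ^ m) / (1 - r)"
    using r sum_gp_strict[of r m] by (simp flip: sum_distrib_left)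
  have "(\<Sum>j<m. r ^ (m - j)) = (\<Sum>j<m. r ^ Suc j)"
    by (subst sum.nat_diff_reindex[symmetric]) (auto intro!: sum.cong simp: Suc_diff_Suc)
  then have 2: "(\<Sum>j<m. r ^ Suc j + r ^ (m - j)) = 2 * r / (1 - r) * (1 - r ^ m)"
    using 1 by (simp add: sum.distrib)
  have "(\<Sum>j<m. path_resolvent r m j) = (m - (\<Sum>j<m. r ^ Suc j + r ^ (m - j)) / (1 + r ^ Suc m)) /
    (r + 1 / r - 2)"
    unfolding path_resolvent_def sum_divide_distrib[symmetric] sum_subtractf by simp
  then show ?thesis unfolding 2 path_defect_def by simp
qed

lemma exists_path_function:
  fixes F :: "nat \<Rightarrow> nat \<Rightarrow> real"
  assumes "distinct (concat Ps)"
  shows "\<exists>y. \<forall>P\<in>set Ps. \<forall>j<length P. y (P ! j) = F (length P) j"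
  using assms
proof (induction Ps)
  case (Cons P Ps)
  then obtain y where y: "\<forall>P\<in>set Ps. \<forall>j<length P. y (P ! j) = F (length P) j" by auto
  define z where "z v = (if v \<in> set P then F (length P) (THE j. j < length P \<and> P ! j = v) else y
    v)" for v
  have "z (Q ! j) = F (length Q) j" if Q: "Q \<in> set (P # Ps)" "j < length Q" for Q j
  proof (cases "Q ! j \<in> set P")
    case True
    have "Q = P"
    proof (rule ccontr)
      assume "Q \<noteq> P"
      then have "Q \<in> set Ps" using Q by simp
      moreover have "Q ! j \<in> set Q" using Q by simp
      ultimately show False using True Cons.prems by auto
    qed
    have "(THE i. i < length P \<and> P ! i = P ! j) = j"
      using Q \<open>Q = P\<close> Cons.prems by (intro the_equality) (auto simp: nth_eq_iff_index_eq)
    then show ?thesis using True \<open>Q = P\<close> unfolding z_def by simp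
  next
    case False
    then have "Q \<in> set Ps" using Q by auto
    then show ?thesis using False y Q unfolding z_def by simp
  qed
  then show ?case by blast
qed simp

lemma fan_edge_iff:
  assumes d: "distinct (u # concat Ps)" and P: "P \<in> set Ps" "j < length P"
  shows "{P ! j, w} \<in> edges (fan_graph u Ps) \<and> w \<noteq> u \<longleftrightarrow>
    (\<exists>i<length P. w = P ! i \<and> (i = Suc j \<or> j = Suc i))" (is "?L \<longleftrightarrow> ?R")
proof
  have Pj: "P ! j \<in> set P" "P ! j \<noteq> u" using d P by auto
  show ?R if ?L
  proof -
    have "{P ! j, w} \<noteq> {u, v}" for v using that Pj by (auto simp: doubleton_eq_iff)
    then have "{P ! j, w} \<notin> (\<lambda>v. {u, v}) ` set (concat Ps)" by blast
    moreover have "{P ! j, w} \<in> (\<lambda>v. {u, v}) ` set (concat Ps) \<union> (\<Union>P\<in>set Ps.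
      path_edges P)"
      using that unfolding edges_fan by (rule conjunct1)
    ultimately obtain Q where Q: "Q \<in> set Ps" "{P ! j, w} \<in> path_edges Q" by blast
    have "P ! j \<in> set Q" using path_edges_subset[OF Q(2)] by simp
    have "Q = P"
    proof (rule ccontr)
      assume "Q \<noteq> P"
      have "set Q \<inter> set P = {}"
        using d Q(1) P(1) \<open>Q \<noteq> P\<close> by (simp add: distinct_concat_iff)
      then show False using Pj \<open>P ! j \<in> set Q\<close> by blast
    qed
    then obtain i where i: "{P ! j, w} = {P ! i, P ! Suc i}" "Suc i < length P" using Q(2) unfolding
      path_edges_nth by blast
    have dP: "distinct P" using d P(1) distinct_concat_in by auto
    from i(1) consider "P ! j = P ! i" "w = P ! Suc i" | "P ! j = P ! Suc i" "w = P ! i"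
      by (auto simp: doubleton_eq_iff)
    then show ?thesis
    proof cases
      case 1
      then have "j = i" using nth_eq_iff_index_eq[OF dP P(2)] i(2) by auto
      then show ?thesis using 1 i(2) by blast
    next
      case 2
      then have "j = Suc i" using nth_eq_iff_index_eq[OF dP P(2)] i(2) by auto
      then show ?thesis using 2 i(2) by (intro exI[of _ i]) auto
    qed
  qed
  show ?L if ?R
  proof -
    from that obtain i where i: "i < length P" "w = P ! i" "i = Suc j \<or> j = Suc i" by (elim exE conjE)
    have "{P ! j, w} \<in> path_edges P"
      using i(3)
    proof
      assume "i = Suc j"
      then show ?thesis unfolding path_edges_nth using i by (intro CollectI exI[of _ j]) simp
    next
      assume "j = Suc i"
      then have "{P ! j, w} = {P ! i, P ! Suc i}" using i(2) by blast
      then show ?thesis unfolding path_edges_nth using \<open>j = Suc i\<close> P(2)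
        by (intro CollectI exI[of _ i]) simp
    qed
    moreover have "w \<noteq> u" using d P(1) i by auto
    moreover have "{P ! j, w} \<in> (\<Union>P\<in>set Ps. path_edges P)" using P(1) calculation(1) by
      (rule UN_I)
    ultimately show ?thesis unfolding edges_fan by simp
  qed
qed

text \<open>Deleting the hub leaves the disjoint paths of the spine, so the solution is assembled
  from \<open>path_resolvent\<close> path by path; orders and defects add up.\<close>

lemma fan_resolvent:
  assumes d: "distinct (u # concat Ps)" and r: "0 < r" "r < 1"
  shows "\<exists>y. (\<forall>v\<in>verts (fan_graph u Ps) - {u}. (r + 1 / r) * y v = 1 +
    (\<Sum>w\<in>nbrs (fan_graph u Ps) v - {u}. y w)) \<and>
    (\<Sum>v\<in>verts (fan_graph u Ps) - {u}. y v) =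
      (length (concat Ps) - 2 * r / (1 - r) * (\<Sum>m\<leftarrow>map length Ps. path_defect r m)) / (r + 1
        / r - 2)"
proof -
  let ?G = "fan_graph u Ps"
  have "distinct (concat Ps)" using d by simp
  from exists_path_function[OF this, of "path_resolvent r"] obtain y
    where y0: "\<forall>P\<in>set Ps. \<forall>j<length P. y (P ! j) = path_resolvent r (length P) j" ..
  have y: "y (P ! j) = path_resolvent r (length P) j" if "P \<in> set Ps" "j < length P" for P j
    using y0 that by simp
  have V: "verts ?G - {u} = set (concat Ps)" using d by auto
  have "(r + 1 / r) * y v = 1 + (\<Sum>w\<in>nbrs ?G v - {u}. y w)" if v: "v \<in> verts ?G - {u}" for v
  proof -
    obtain P j where P: "P \<in> set Ps" "j < length P" "v = P ! j" using v unfolding V by (auto simp: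
      in_set_conv_nth)
    have dP: "distinct P" using d P(1) distinct_concat_in by auto
    have "nbrs ?G v - {u} = {w. {v, w} \<in> edges ?G \<and> w \<noteq> u}"
      unfolding nbrs_def using simple_fan[OF d] unfolding simple_graph_def by auto
    also have "\<dots> = (!) P ` {i. i < length P \<and> (i = Suc j \<or> j = Suc i)}"
      unfolding P(3) fan_edge_iff[OF d P(1,2)] by auto
    finally have N: "nbrs ?G v - {u} = (!) P ` {i. i < length P \<and> (i = Suc j \<or> j = Suc i)}" .
    have "(\<Sum>w\<in>nbrs ?G v - {u}. y w) = (\<Sum>i\<in>{i. i < length P \<and> (i = Suc j \<or> j =
      Suc i)}. y (P ! i))"
      unfolding N by (intro sum.reindex_cong[of "(!) P"] inj_on_nth[OF dP]) auto
    also have "{i. i < length P \<and> (i = Suc j \<or> j = Suc i)} =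
      (if j = 0 then {} else {j - 1}) \<union> (if Suc j < length P then {Suc j} else {})"
      using P(2) by auto
    also have "(\<Sum>i\<in>\<dots>. y (P ! i)) = (if j = 0 then 0 else y (P ! (j - 1))) + (if Suc j <
      length P then y (P ! Suc j) else 0)"
      by (subst sum.union_disjoint) auto
    also have "\<dots> = (if j = 0 then 0 else path_resolvent r (length P) (j - 1)) +
        (if Suc j < length P then path_resolvent r (length P) (Suc j) else 0)"
      using y[OF P(1)] P(2) by simp
    finally show ?thesis using path_resolvent_rec[OF r P(2)] y[OF P(1,2)] P(3) by simp
  qed
  moreover have "(\<Sum>v\<in>verts ?G - {u}. y v) =
      (length (concat Ps) - 2 * r / (1 - r) * (\<Sum>m\<leftarrow>map length Ps. path_defect r m)) / (r + 1
        / r - 2)"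
  proof -
    have "(\<Sum>v\<in>set (concat Ps). y v) = (\<Sum>P\<leftarrow>Ps. \<Sum>v\<in>set P. y v)"
      using d by (induction Ps) (auto simp: sum.union_disjoint)
    also have "(\<Sum>P\<leftarrow>Ps. \<Sum>v\<in>set P. y v) =
      (\<Sum>P\<leftarrow>Ps. (length P - 2 * r / (1 - r) * path_defect r (length P)) / (r + 1 / r - 2))"
    proof (intro arg_cong[of _ _ sum_list] map_cong refl)
      fix P assume P: "P \<in> set Ps"
      have dP: "distinct P" using d P distinct_concat_in by auto
      have "(\<Sum>v\<in>set P. y v) = (\<Sum>j<length P. y (P ! j))"
        using sum.reindex_bij_betw[OF bij_betw_nth[OF dP refl refl], of y] by simp
      then show "(\<Sum>v\<in>set P. y v) = (length P - 2 * r / (1 - r) * path_defect r (length P)) / (r +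
        1 / r - 2)"
        using y[OF P] path_resolvent_sum[OF r] by simp
    qed
    also have "\<dots> = (length (concat Ps) - 2 * r / (1 - r) * (\<Sum>m\<leftarrow>map length Ps.
      path_defect r m)) / (r + 1 / r - 2)"
      by (induction Ps) (auto simp: algebra_simps add_divide_distrib diff_divide_distrib)
    finally show ?thesis unfolding V .
  qed
  ultimately show ?thesis by blast
qed

section \<open>Comparison of fans through the parameter \<open>r\<close>\<close>

lemma hub_parameter:
  fixes \<rho> :: real
  assumes "\<rho> > 2"
  shows "\<exists>r>0. r < 1 \<and> r + 1 / r = \<rho>"
proof -
  define s where "s = sqrt (\<rho>\<^sup>2 - 4)"
  have "\<rho>\<^sup>2 - 4 > 0" using assms power_strict_mono[of 2 \<rho> 2] by simp
  then have s: "s > 0" "s\<^sup>2 = \<rho>\<^sup>2 - 4" unfolding s_def by auto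
  have "s < \<rho>" using s assms by (intro power2_less_imp_less[of s \<rho>]) auto
  \<comment> \<open>The smaller root of \<open>r\<^sup>2 - \<rho> * r + 1 = 0\<close>; the two roots
    have product \<open>1\<close>.\<close>
  define r where "r = (\<rho> - s) / 2"
  have r: "r > 0" unfolding r_def using \<open>s < \<rho>\<close> by simp
  have "r * ((\<rho> + s) / 2) = 1" unfolding r_def using s(2) by (simp add: field_simps power2_eq_square)
  then have inv: "1 / r = (\<rho> + s) / 2" using r by (simp add: field_simps)
  then have "1 / r > 1" using assms s by simp
  then have "r < 1" using r by (simp add: field_simps)
  moreover have "r + 1 / r = \<rho>" unfolding inv by (simp add: r_def field_simps)
  ultimately show ?thesis using r by blast
qed

lemma fan_hub:
  assumes "distinct (u # concat Ps)"
  shows "u \<in> verts (fan_graph u Ps)" "v \<in> verts (fan_graph u Ps) - {u} \<Longrightarrow> {u, v}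
    \<in> edges (fan_graph u Ps)"
  using assms unfolding edges_fan by auto

text \<open>The parameter \<open>r\<close> is that of the first fan, whose entries off the hub then
  sum to \<open>\<rho>\<close> exactly. For the second fan, of the same order, only the defects
  change this sum; smaller ones raise it, and the radius with it. The assumption ranges over all
  \<open>r\<close> because the relevant one is not known explicitly.\<close>

theorem fan_spectral_compare:
  assumes P: "distinct (u # concat Ps)" and Q: "distinct (w # concat Qs)"
    and len: "length (concat Ps) = length (concat Qs)"
    and big: "graph_spectral_radius (fan_graph u Ps) > 2"
  shows "(\<And>r. 0 < r \<Longrightarrow> r < 1 \<Longrightarrow> (\<Sum>m\<leftarrow>map length Qs.
    path_defect r m) \<le> (\<Sum>m\<leftarrow>map length Ps. path_defect r m)) \<Longrightarrow>
      graph_spectral_radius (fan_graph u Ps) \<le> graph_spectral_radius (fan_graph w Qs)"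
    and "(\<And>r. 0 < r \<Longrightarrow> r < 1 \<Longrightarrow> (\<Sum>m\<leftarrow>map length Qs.
      path_defect r m) < (\<Sum>m\<leftarrow>map length Ps. path_defect r m)) \<Longrightarrow>
      graph_spectral_radius (fan_graph u Ps) < graph_spectral_radius (fan_graph w Qs)"
proof -
  let ?\<rho> = "graph_spectral_radius (fan_graph u Ps)"
  obtain r where r: "0 < r" "r < 1" "r + 1 / r = ?\<rho>" using hub_parameter[OF big] by blast
  let ?D = "r + 1 / r - 2" and ?c = "2 * r / (1 - r)"
  have D: "?D > 0" by (rule denominator_pos[OF r(1,2)])
  have c: "?c > 0" using r by simp
  let ?S = "\<lambda>Ps. (length (concat Ps) - ?c * (\<Sum>m\<leftarrow>map length Ps. path_defect r m)) / ?D"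
  obtain y where y: "\<And>v. v \<in> verts (fan_graph u Ps) - {u} \<Longrightarrow> ?\<rho> * y v = 1 +
    (\<Sum>w\<in>nbrs (fan_graph u Ps) v - {u}. y w)"
    "(\<Sum>v\<in>verts (fan_graph u Ps) - {u}. y v) = ?S Ps"
    using fan_resolvent[OF P r(1,2)] unfolding r(3) by blast
  have S: "?S Ps = ?\<rho>" using resolvent_sum_eq[OF simple_fan[OF P] fan_hub[OF P] y(1)] y(2) by simp
  obtain z where z: "\<And>v. v \<in> verts (fan_graph w Qs) - {w} \<Longrightarrow> ?\<rho> * z v = 1 +
    (\<Sum>x\<in>nbrs (fan_graph w Qs) v - {w}. z x)"
    "(\<Sum>v\<in>verts (fan_graph w Qs) - {w}. z v) = ?S Qs"
    using fan_resolvent[OF Q r(1,2)] unfolding r(3) by blast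
  note le = resolvent_sum_le[OF simple_fan[OF Q] fan_hub[OF Q] z(1)]
  show "?\<rho> \<le> graph_spectral_radius (fan_graph w Qs)"
    if "\<And>r. 0 < r \<Longrightarrow> r < 1 \<Longrightarrow> (\<Sum>m\<leftarrow>map length Qs.
      path_defect r m) \<le> (\<Sum>m\<leftarrow>map length Ps. path_defect r m)"
  proof (rule le(1))
    have "?c * (\<Sum>m\<leftarrow>map length Qs. path_defect r m) \<le> ?c * (\<Sum>m\<leftarrow>map
      length Ps. path_defect r m)"
      using that[OF r(1,2)] c by (intro mult_left_mono) auto
    then have "?S Ps \<le> ?S Qs" unfolding len using D by (intro divide_right_mono) auto
    then show "?\<rho> \<le> (\<Sum>v\<in>verts (fan_graph w Qs) - {w}. z v)" unfolding z(2) S .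
  qed
  show "?\<rho> < graph_spectral_radius (fan_graph w Qs)"
    if "\<And>r. 0 < r \<Longrightarrow> r < 1 \<Longrightarrow> (\<Sum>m\<leftarrow>map length Qs.
      path_defect r m) < (\<Sum>m\<leftarrow>map length Ps. path_defect r m)"
  proof (rule le(2))
    have "?c * (\<Sum>m\<leftarrow>map length Qs. path_defect r m) < ?c * (\<Sum>m\<leftarrow>map length
      Ps. path_defect r m)"
      using that[OF r(1,2)] c by (intro mult_strict_left_mono) auto
    then have "?S Ps < ?S Qs" unfolding len using D by (intro divide_strict_right_mono) auto
    then show "?\<rho> < (\<Sum>v\<in>verts (fan_graph w Qs) - {w}. z v)" unfolding z(2) S .
  qed
qed

text \<open>The test vector is the Perron vector of the spanning star: the square root of the number
  of leaves at the hub, \<open>1\<close> elsewhere.\<close>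

lemma fan_spectral_lower:
  assumes d: "distinct (u # concat Ps)" and ne: "length (concat Ps) > 0"
  shows "sqrt (length (concat Ps)) \<le> graph_spectral_radius (fan_graph u Ps)"
proof -
  let ?G = "fan_graph u Ps"
  define V where "V = set (concat Ps)"
  let ?N = "real (length (concat Ps))"
  define s where "s = sqrt ?N"
  have s: "s > 0" "s * s = ?N" unfolding s_def using ne by auto
  have card: "real (card V) = ?N" unfolding V_def using d by (subst distinct_card) auto
  define z where "z v = (if v = u then s else 1)" for v
  note G = simple_fan[OF d]
  have VG: "verts ?G = insert u V" "u \<notin> V" "finite V" using d unfolding V_def by auto
  have "{u, w} \<in> edges ?G" if "w \<in> V" for w using that unfolding edges_fan V_def by blast
  then have Nu: "nbrs ?G u = V" using nbrs_irrefl[OF G, of u] unfolding nbrs_def VG(1) by auto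
  have zV: "(\<Sum>v\<in>V. z v) = ?N" "(\<Sum>v\<in>V. (z v)\<^sup>2) = ?N"
  proof -
    have "z v = 1" if "v \<in> V" for v using that VG unfolding z_def by auto
    then show "(\<Sum>v\<in>V. z v) = ?N" "(\<Sum>v\<in>V. (z v)\<^sup>2) = ?N" using card by simp_all
  qed
  have "s * ?N + ?N * s \<le> quad_form ?G z"
  proof -
    have "quad_form ?G z = z u * (\<Sum>w\<in>nbrs ?G u. z w) + (\<Sum>v\<in>V. z v * (\<Sum>w\<in>nbrs ?G
      v. z w))"
      unfolding quad_form_def VG(1) using VG by simp
    also have "z u * (\<Sum>w\<in>nbrs ?G u. z w) = s * ?N" unfolding Nu zV by (simp add: z_def)
    finally have "quad_form ?G z = s * ?N + (\<Sum>v\<in>V. z v * (\<Sum>w\<in>nbrs ?G v. z w))" .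
    moreover have "(\<Sum>v\<in>V. s) \<le> (\<Sum>v\<in>V. z v * (\<Sum>w\<in>nbrs ?G v. z w))"
    proof (rule sum_mono)
      fix v assume v: "v \<in> V"
      have "u \<in> nbrs ?G v" using nbrs_sym[of u ?G v] v Nu VG by auto
      then have "z u \<le> (\<Sum>w\<in>nbrs ?G v. z w)"
        using finite_nbrs[OF G] s by (intro member_le_sum) (auto simp: z_def)
      then show "s \<le> z v * (\<Sum>w\<in>nbrs ?G v. z w)" using v VG by (auto simp: z_def)
    qed
    ultimately show ?thesis using card by (simp add: mult.commute)
  qed
  also have "\<dots> \<le> graph_spectral_radius ?G * (\<Sum>v\<in>verts ?G. (z v)\<^sup>2)"
    by (rule Perron(2)[OF G]) (simp add: VG)
  also have "(\<Sum>v\<in>verts ?G. (z v)\<^sup>2) = 2 * ?N"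
    unfolding VG(1) using VG zV s by (simp add: z_def power2_eq_square)
  finally have "s * (2 * ?N) \<le> graph_spectral_radius ?G * (2 * ?N)" by simp
  then show ?thesis using ne unfolding s_def by simp
qed

section \<open>The optimal path lengths\<close>

text \<open>Put \<open>A = r ^ (a + 1)\<close> and \<open>B = r ^ (b + 1)\<close>. Since
  \<open>A * B\<close> depends only on \<open>a + b\<close>, the formula isolates the dependence on
  \<open>A + B\<close> when \<open>a + b\<close> is fixed.\<close>

lemma path_defect_pair:
  fixes r :: real
  assumes r: "0 < r"
  shows "path_defect r a + path_defect r b =
    2 - (1 + r) / r * (1 - (1 - r ^ (a + b + 2)) / (1 + r ^ (a + b + 2) + (r ^ Suc a + r ^ Suc b)))"
proof -
  have g: "path_defect r m = 1 - (1 + r) / r * (r ^ Suc m / (1 + r ^ Suc m))" for m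
  proof -
    have D: "1 + r ^ Suc m > 0" using r by (simp add: add_pos_pos)
    have "(1 + r) / r * (r ^ Suc m / (1 + r ^ Suc m)) = (1 + r) * r ^ m / (1 + r ^ Suc m)"
      using r by simp
    also have "1 - \<dots> = ((1 + r ^ Suc m) - (1 + r) * r ^ m) / (1 + r ^ Suc m)"
      using D by (simp only: diff_divide_distrib) simp
    also have "\<dots> = path_defect r m" unfolding path_defect_def by (simp add: algebra_simps)
    finally show ?thesis by simp
  qed
  have frac: "A / (1 + A) + B / (1 + B) = 1 - (1 - A * B) / (1 + A * B + (A + B))" if "A > 0" "B > 0" for A
    B :: real
  proof -
    have *: "1 + A * B + (A + B) = (1 + A) * (1 + B)" by (simp add: algebra_simps)
    show ?thesis unfolding * using that by (simp add: divide_simps, (simp add: algebra_simps)?)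
  qed
  have "path_defect r a + path_defect r b =
      2 - (1 + r) / r * (r ^ Suc a / (1 + r ^ Suc a) + r ^ Suc b / (1 + r ^ Suc b))"
    unfolding g by (simp only: distrib_left)
  also have "r ^ Suc a / (1 + r ^ Suc a) + r ^ Suc b / (1 + r ^ Suc b) =
      1 - (1 - r ^ Suc a * r ^ Suc b) / (1 + r ^ Suc a * r ^ Suc b + (r ^ Suc a + r ^ Suc b))"
    by (rule frac) (use r in simp_all)
  also have "r ^ Suc a * r ^ Suc b = r ^ (a + b + 2)" by (simp add: power_add power2_eq_square)
  finally show ?thesis .
qed

text \<open>Moving \<open>k\<close> vertices to the longer path raises
  \<open>r ^ (a + 1) + r ^ (b + 1)\<close>, by convexity, at constant product, and by
  \<open>path_defect_pair\<close> the defects fall. The case \<open>k = a\<close>, where the shorter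
  path disappears, is included.\<close>

lemma path_defect_move:
  fixes r :: real
  assumes r: "0 < r" "r < 1" and ab: "0 < k" "k \<le> a" "a \<le> b"
  shows "path_defect r (a - k) + path_defect r (b + k) < path_defect r a + path_defect r b"
proof -
  define P where "P = r ^ (a + b + 2)"
  have P: "0 < P" "P < 1" unfolding P_def using r power_Suc_less_one[of r "a + b + 1"] by simp_all
  obtain c where c: "a = c + k" using ab(2) by (metis add.commute le_add_diff_inverse)
  have q: "0 < r ^ k" "r ^ k < 1" using r ab by (simp_all add: power_less_one_iff)
  have "r ^ Suc c + r ^ Suc (b + k) - (r ^ Suc a + r ^ Suc b) = (1 - r ^ k) * (r ^ Suc c - r ^ Suc b)"
    unfolding c by (simp add: power_add algebra_simps)
  moreover have "r ^ Suc c > r ^ Suc b" using r ab c by (intro power_strict_decreasing) auto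
  ultimately have S: "r ^ Suc a + r ^ Suc b < r ^ Suc c + r ^ Suc (b + k)"
    using q by (smt (verit) mult_pos_pos)
  have pos: "0 < r ^ Suc a + r ^ Suc b" using r by (simp add: add_pos_pos)
  have "(1 - P) / (1 + P + (r ^ Suc c + r ^ Suc (b + k))) < (1 - P) / (1 + P + (r ^ Suc a + r ^ Suc b))"
    using S P pos by (intro divide_strict_left_mono mult_pos_pos) auto
  then have "(1 + r) / r * (1 - (1 - P) / (1 + P + (r ^ Suc a + r ^ Suc b))) <
      (1 + r) / r * (1 - (1 - P) / (1 + P + (r ^ Suc c + r ^ Suc (b + k))))"
    using r by (intro mult_strict_left_mono) auto
  moreover have e: "c + (b + k) + 2 = a + b + 2" "a - k = c" using c by auto
  moreover have "path_defect r c + path_defect r (b + k) =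
    2 - (1 + r) / r * (1 - (1 - P) / (1 + P + (r ^ Suc c + r ^ Suc (b + k))))"
    unfolding P_def using path_defect_pair[OF r(1), of c "b + k"] unfolding e(1) .
  moreover have "path_defect r a + path_defect r b =
    2 - (1 + r) / r * (1 - (1 - P) / (1 + P + (r ^ Suc a + r ^ Suc b)))"
    unfolding P_def using path_defect_pair[OF r(1), of a b] .
  ultimately show ?thesis by (simp only:)
qed

section \<open>Exchange argument for multisets of path lengths\<close>

definition weight :: "(nat \<Rightarrow> real) \<Rightarrow> nat multiset \<Rightarrow> real" where
  "weight g M = (\<Sum>m\<in>#M. g m)"

text \<open>In the application \<open>K = l - 1\<close> and \<open>T = t - 1\<close>. With the hub,
  \<open>K\<close> consecutive vertices of a path form a cycle of length \<open>l\<close>, so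
  \<open>m div K\<close> counts the disjoint blocks in a path of \<open>m\<close> vertices.
  Excluding \<open>0\<close> makes the optimum unique.\<close>

definition admissible :: "nat \<Rightarrow> nat \<Rightarrow> nat \<Rightarrow> nat multiset \<Rightarrow>
  bool" where
  "admissible K T N M \<longleftrightarrow> 0 \<notin># M \<and> sum_mset M = N \<and> (\<Sum>m\<in>#M. m
    div K) \<le> T"

text \<open>\<open>C\<close> is the largest number with \<open>C div K \<le> T\<close>. One path of
  this length uses up the whole quota \<open>T\<close>; the others have at most \<open>K - 1\<close>
  vertices, and all but at most one have exactly \<open>K - 1\<close>.\<close>

definition optimal_lengths :: "nat \<Rightarrow> nat \<Rightarrow> nat \<Rightarrow> nat multiset" where
  "optimal_lengths K T N = (let C = Suc T * K - 1 in
     add_mset C (replicate_mset ((N - C) div (K - 1)) (K - 1) +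
       (if (K - 1) dvd (N - C) then {#} else {#(N - C) mod (K - 1)#})))"

definition transfer :: "nat \<Rightarrow> nat \<Rightarrow> nat \<Rightarrow> nat multiset \<Rightarrow>
  nat multiset" where
  "transfer k a b R = add_mset (b + k) (if a = k then R else add_mset (a - k) R)"

lemma sum_transfer:
  fixes f :: "nat \<Rightarrow> 'b::comm_monoid_add"
  assumes "f 0 = 0"
  shows "(\<Sum>m\<in>#transfer k a b R. f m) = f (b + k) + (f (a - k) + (\<Sum>m\<in>#R. f m))"
  using assms unfolding transfer_def by auto

lemma square_sum_le: "(\<Sum>m\<in>#M. m * m) \<le> sum_mset M * sum_mset M" for M :: "nat multiset"
  by (induction M) (auto simp: algebra_simps)

lemma transfer_admissible:
  assumes M: "admissible K T N (add_mset b (add_mset a R))" and k: "0 < k" "k \<le> a"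
    and cap: "(b + k) div K + (a - k) div K + (\<Sum>m\<in>#R. m div K) \<le> T"
  shows "admissible K T N (transfer k a b R)"
proof -
  have "sum_mset (transfer k a b R) = N"
    using M k sum_transfer[of "\<lambda>m. m" k a b R] unfolding admissible_def by simp
  moreover have "(\<Sum>m\<in>#transfer k a b R. m div K) \<le> T"
    using cap sum_transfer[of "\<lambda>m. m div K" k a b R] by simp
  moreover have "0 \<notin># transfer k a b R" using M k unfolding admissible_def transfer_def by auto
  ultimately show ?thesis unfolding admissible_def by blast
qed

text \<open>The growth of the sum of squares provides an integer measure that makes repeated
  transfers stop, which the decrease of a real-valued weight alone does not.\<close>

lemma transfer_better:
  assumes g: "g 0 = 0" "\<And>k a b. 0 < k \<Longrightarrow> k \<le> a \<Longrightarrow> a \<le> b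
    \<Longrightarrow> g (a - k) + g (b + k) < g a + g b"
    and k: "0 < k" "k \<le> a" "a \<le> b"
  shows "weight g (transfer k a b R) < weight g (add_mset b (add_mset a R))"
    and "(\<Sum>m\<in>#add_mset b (add_mset a R). m * m) < (\<Sum>m\<in>#transfer k a b R. m * m)"
proof -
  show "weight g (transfer k a b R) < weight g (add_mset b (add_mset a R))"
    unfolding weight_def sum_transfer[of g, OF g(1)] using g(2)[OF k] by simp
  obtain c where c: "a = c + k" using k(2) by (metis add.commute le_add_diff_inverse)
  have "c * k + k * k \<le> b * k" using k c by (metis add_mult_distrib mult_le_mono1)
  moreover have "c * k < b * k" using k c by simp
  moreover have "(b + k) * (b + k) + c * c = b * b + c * c + 2 * (b * k) + k * k"
    "b * b + a * a = b * b + c * c + 2 * (c * k) + k * k" unfolding c by (simp_all add: algebra_simps)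
  ultimately have "b * b + a * a < (b + k) * (b + k) + c * c" by linarith
  then show "(\<Sum>m\<in>#add_mset b (add_mset a R). m * m) < (\<Sum>m\<in>#transfer k a b R. m * m)"
    using sum_transfer[of "\<lambda>m. m * m" k a b R] c by simp
qed

text \<open>Let \<open>b\<close> be the largest length. If \<open>b < C\<close>, one vertex is moved
  to it from another path, or \<open>K\<close> vertices at once when a single one would break the
  quota. If \<open>b = C\<close>, the quota is spent, so the others are at most
  \<open>K - 1\<close>, and two of them below \<open>K - 1\<close> admit a transfer of one vertex.
  What remains is the optimal multiset.\<close>

lemma admissible_improve:
  assumes g: "g 0 = 0" "\<And>k a b. 0 < k \<Longrightarrow> k \<le> a \<Longrightarrow> a \<le> b
    \<Longrightarrow> g (a - k) + g (b + k) < g a + g b"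
    and K: "2 \<le> K" and N: "Suc T * K - 1 \<le> N"
    and M: "admissible K T N M" and ne: "M \<noteq> optimal_lengths K T N"
  shows "\<exists>M'. admissible K T N M' \<and> weight g M' < weight g M \<and> (\<Sum>m\<in>#M. m * m) <
    (\<Sum>m\<in>#M'. m * m)"
proof -
  define C where "C = Suc T * K - 1"
  have C: "Suc C = Suc T * K" "C > 0" unfolding C_def using K by (auto simp: algebra_simps)
  have sM: "sum_mset M = N" "0 \<notin># M" "(\<Sum>m\<in>#M. m div K) \<le> T" using M unfolding
    admissible_def by auto
  have step: ?thesis if "M = add_mset b (add_mset a R)" "0 < k" "k \<le> a" "a \<le> b"
    "(b + k) div K + (a - k) div K + (\<Sum>m\<in>#R. m div K) \<le> T" for a b k R
    using transfer_admissible[of K T N b a R k] transfer_better[of g k a b R] g that M by blast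
  have "M \<noteq> {#}" using sM N C unfolding C_def by auto
  define b where "b = Max (set_mset M)"
  have b: "b \<in># M" "\<And>m. m \<in># M \<Longrightarrow> m \<le> b" unfolding b_def using \<open>M
    \<noteq> {#}\<close> by auto
  obtain R where R: "M = add_mset b R" using b(1) by (metis mset_add)
  have cap: "b div K + (\<Sum>m\<in>#R. m div K) \<le> T" using sM(3) R by simp
  have bC: "b \<le> C"
  proof -
    have "b div K \<le> T" using cap by simp
    then have "b < Suc T * K" using K by (simp add: div_less_iff_less_mult flip: less_Suc_eq_le)
    then show ?thesis using C by simp
  qed
  show ?thesis
  proof (cases "b = C")
    case False
    then have "b < C" using bC by simp
    then have "R \<noteq> {#}" using sM(1) R N unfolding C_def by auto
    show ?thesis
    \<comment> \<open>Lengthening \<open>b\<close> by one raises its quotient only if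
      \<open>K\<close> divides \<open>b + 1\<close>, which hurts only when the quota is exhausted.
      Then \<open>b\<close> cannot hold the whole quota, and \<open>K\<close> vertices taken from
      another path with nonzero quotient shift one unit of it to \<open>b\<close>.\<close>
    proof (cases "K dvd Suc b \<and> (\<Sum>m\<in>#M. m div K) = T")
      case True
      then obtain c where c: "Suc b = c * K" by (metis dvd_def mult.commute)
      have "c * K < Suc T * K" using c C \<open>b < C\<close> by simp
      then have "c \<le> T" by (metis less_Suc_eq_le mult_less_cancel2)
      have "b div K < c"
        using c K by (metis div_less_iff_less_mult lessI less_le_trans zero_less_numeral)
      moreover have "(\<Sum>m\<in>#M. m div K) = b div K + (\<Sum>m\<in>#R. m div K)" using R by simp
      ultimately have "(\<Sum>m\<in>#R. m div K) > 0" using True \<open>c \<le> T\<close> by linarith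
      then obtain a where a: "a \<in># R" "a div K \<noteq> 0"
        by (metis (no_types, lifting) less_irrefl sum_mset.neutral imageE multiset.set_map)
      then have aK: "K \<le> a" by (meson div_less not_less)
      obtain R' where R': "R = add_mset a R'" using a(1) by (metis mset_add)
      have "(b + K) div K = Suc (b div K)" using K by simp
      moreover have "Suc ((a - K) div K) = a div K" using aK K by (simp add: le_div_geq)
      ultimately have "(b + K) div K + (a - K) div K + (\<Sum>m\<in>#R'. m div K) \<le> T"
        using cap R' by simp
      then show ?thesis using step[of b a R' K] R R' K aK b(2)[of a] by simp
    next
      case False
      obtain a where a: "a \<in># R" using \<open>R \<noteq> {#}\<close> by blast
      then obtain R' where R': "R = add_mset a R'" by (metis mset_add)
      have a0: "0 < a" using a sM(2) R by (cases a) auto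
      have "(b + 1) div K + (a - 1) div K + (\<Sum>m\<in>#R'. m div K) \<le> T"
      proof (cases "K dvd Suc b")
        case True
        then have "(\<Sum>m\<in>#M. m div K) < T" using False sM(3) by simp
        moreover have "(b + 1) div K \<le> Suc (b div K)" by (simp add: div_Suc)
        moreover have "(a - 1) div K \<le> a div K" by (simp add: div_le_mono)
        ultimately show ?thesis using R R' by simp
      next
        case False
        then have "(b + 1) div K = b div K" by (simp add: div_Suc dvd_eq_mod_eq_0)
        moreover have "(a - 1) div K \<le> a div K" by (simp add: div_le_mono)
        ultimately show ?thesis using cap R' by simp
      qed
      then show ?thesis using step[of b a R' 1] R R' a0 b(2)[of a] by simp
    qed
  next
    case True
    have "b div K = T"
    proof -
      have "K * T \<le> b" "b < K * Suc T" using True C(1) K by (simp_all add: algebra_simps)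
      then show ?thesis by (rule div_nat_eqI)
    qed
    then have R0: "(\<Sum>m\<in>#R. m div K) = 0" using cap by simp
    have small: "m \<le> K - 1" if "m \<in># R" for m
    proof -
      have "m div K = 0" using R0 that by (simp add: sum_mset_0_iff)
      then show ?thesis using K by (simp add: div_eq_0_iff)
    qed
    \<comment> \<open>If at most one path is shorter than \<open>K - 1\<close>, its length is the
      remainder of \<open>N - C\<close> modulo \<open>K - 1\<close>.\<close>
    define S where "S = filter_mset (\<lambda>m. m < K - 1) R"
    have RS: "R = S + replicate_mset (count R (K - 1)) (K - 1)"
    proof -
      have "R = S + filter_mset (\<lambda>m. \<not> m < K - 1) R" unfolding S_def by (rule multiset_partition)
      also have "filter_mset (\<lambda>m. \<not> m < K - 1) R = filter_mset (\<lambda>m. m = K - 1) R"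
        using small by (intro filter_mset_cong refl) force
      also have "\<dots> = replicate_mset (count R (K - 1)) (K - 1)" by (rule filter_eq_replicate_mset)
      finally show ?thesis .
    qed
    have S_in: "m < K - 1" "m \<noteq> 0" if "m \<in># S" for m
      using that sM(2) R unfolding S_def by (auto intro: gr0I)
    show ?thesis
    proof (cases "size S \<le> 1")
      case True
      let ?q = "count R (K - 1)"
      have NC: "N - C = sum_mset S + ?q * (K - 1)"
      proof -
        have "N = b + sum_mset R" using sM(1) R by simp
        also have "sum_mset R = sum_mset S + ?q * (K - 1)"
          using arg_cong[OF RS, of sum_mset] by simp
        finally show ?thesis using \<open>b = C\<close> by simp
      qed
      have "M = optimal_lengths K T N"
      proof (cases "S = {#}")
        case True
        then have "N - C = ?q * (K - 1)" using NC by simp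
        then have "(N - C) div (K - 1) = ?q" "(K - 1) dvd (N - C)" using K by auto
        then show ?thesis unfolding optimal_lengths_def Let_def C_def[symmetric]
          using R RS True \<open>b = C\<close> by simp
      next
        case False
        then obtain s where s: "S = {#s#}" using True by (cases S) auto
        then have s': "s < K - 1" "s \<noteq> 0" using S_in by auto
        have "N - C = s + ?q * (K - 1)" using NC s by simp
        then have "(N - C) div (K - 1) = ?q" "(N - C) mod (K - 1) = s" using s' by auto
        moreover have "\<not> (K - 1) dvd (N - C)" using \<open>(N - C) mod (K - 1) = s\<close> s' by (simp
          add: dvd_eq_mod_eq_0)
        ultimately show ?thesis unfolding optimal_lengths_def Let_def C_def[symmetric]
          using R RS s \<open>b = C\<close> by simp
      qed
      then show ?thesis using ne by blast
    next
      case False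
      then obtain x y S' where S': "S = add_mset x (add_mset y S')"
      proof -
        obtain x S1 where "S = add_mset x S1" using False by (cases S) auto
        moreover have "S1 \<noteq> {#}" using False calculation by auto
        then obtain y S' where "S1 = add_mset y S'" by (cases S1) auto
        ultimately show ?thesis using that by blast
      qed
      define a c where "a = min x y" and "c = max x y"
      have Sac: "S = add_mset c (add_mset a S')" unfolding S' a_def c_def by (cases "x \<le> y") (auto
        simp: min_def max_def add_mset_commute)
      have ac: "a \<le> c" "c < K - 1" "a \<noteq> 0" using S_in[of a] S_in[of c] Sac unfolding a_def c_def
        by auto
      define R' where "R' = add_mset b (S' + replicate_mset (count R (K - 1)) (K - 1))"
      have MR': "M = add_mset c (add_mset a R')"
        unfolding R R'_def using RS Sac by (metis add_mset_commute union_mset_add_mset_left)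
      have "(c + 1) div K = 0" "(a - 1) div K = 0" using ac K by auto
      moreover have "(\<Sum>m\<in>#R'. m div K) \<le> T" using sM(3) MR' by simp
      ultimately show ?thesis using step[of c a R' 1] MR' ac by simp
    qed
  qed
qed

theorem optimal_lengths_minimal:
  assumes g: "g 0 = 0" "\<And>k a b. 0 < k \<Longrightarrow> k \<le> a \<Longrightarrow> a \<le> b
    \<Longrightarrow> g (a - k) + g (b + k) < g a + g b"
    and K: "2 \<le> K" and N: "Suc T * K - 1 \<le> N"
    and M: "admissible K T N M" and ne: "M \<noteq> optimal_lengths K T N"
  shows "weight g (optimal_lengths K T N) < weight g M"
  using M ne
proof (induction "N * N - (\<Sum>m\<in>#M. m * m)" arbitrary: M rule: less_induct)
  case less
  obtain M' where M': "admissible K T N M'" "weight g M' < weight g M" "(\<Sum>m\<in>#M. m * m) <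
    (\<Sum>m\<in>#M'. m * m)"
    using admissible_improve[of g K T N M] g K N less.prems by blast
  have "(\<Sum>m\<in>#M'. m * m) \<le> N * N" using square_sum_le[of M'] M'(1) unfolding admissible_def by simp
  then have "N * N - (\<Sum>m\<in>#M'. m * m) < N * N - (\<Sum>m\<in>#M. m * m)" using M'(3) by simp
  then have "M' = optimal_lengths K T N \<or> weight g (optimal_lengths K T N) < weight g M'"
    using less.hyps[of M'] M'(1) by blast
  then show ?case using M'(2) by auto
qed

section \<open>Linear forests\<close>

lemma path_edges_nthI: "Suc i < length vs \<Longrightarrow> {vs ! i, vs ! Suc i} \<in> path_edges vs"
  unfolding path_edges_nth by (intro CollectI exI[of _ i]) simp

lemma path_edges_Cons: "vs \<noteq> [] \<Longrightarrow> path_edges (x # vs) = insert {x, hd vs}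
  (path_edges vs)"
  by (cases vs) auto

lemma path_edges_snoc: "vs \<noteq> [] \<Longrightarrow> path_edges (vs @ [x]) = insert {last vs, x}
  (path_edges vs)"
proof (induction vs rule: path_edges.induct)
  case (1 x y zs)
  then show ?case by auto
qed auto

lemma path_edges_rev: "path_edges (rev vs) = path_edges vs"
proof (induction vs)
  case (Cons x vs)
  then show ?case
    by (cases "vs = []") (auto simp: path_edges_snoc path_edges_Cons last_rev insert_commute)
qed simp

lemma path_edges_take: "path_edges (take k vs) \<subseteq> path_edges vs"
  using path_edges_append1[of "take k vs" "drop k vs"] by simp

lemma path_edges_drop: "path_edges (drop k vs) \<subseteq> path_edges vs"
  using path_edges_append2[of "drop k vs" "take k vs"] by simp

lemma simple_graph_edge: "simple_graph G \<Longrightarrow> e \<in> edges G \<Longrightarrow> e \<subseteq>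
  verts G \<and> card e = 2"
  unfolding simple_graph_def by simp

text \<open>A longest path is a whole component: an edge leaving it at an end would extend it, one
  leaving it at an inner vertex would give that vertex degree three, and a chord would close a cycle
  with the segment between its ends.\<close>

lemma longest_path_component:
  assumes H: "simple_graph H"
    and deg: "\<And>v. v \<in> verts H \<Longrightarrow> card (nbrs H v) \<le> 2"
    and acyclic: "\<And>ws. distinct ws \<Longrightarrow> length ws \<ge> 3 \<Longrightarrow> path_edges ws
      \<subseteq> edges H \<Longrightarrow> {hd ws, last ws} \<notin> edges H"
    and P: "P \<noteq> []" "distinct P" "set P \<subseteq> verts H" "path_edges P \<subseteq> edges H"
    and longest: "\<And>Q. distinct Q \<Longrightarrow> set Q \<subseteq> verts H \<Longrightarrow>
      path_edges Q \<subseteq> edges H \<Longrightarrow> length Q \<le> length P"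
    and vw: "v \<in> set P" "{v, w} \<in> edges H"
  shows "{v, w} \<in> path_edges P"
proof -
  obtain i where i: "i < length P" "v = P ! i" using vw(1) unfolding in_set_conv_nth by auto
  have "{v, w} \<subseteq> verts H \<and> card {v, w} = 2" using simple_graph_edge[OF H vw(2)] .
  then have wv: "w \<in> verts H" "w \<noteq> v" by auto
  have chord: "{P ! j, P ! k} \<notin> edges H" if "k < length P" "Suc j < k" for j k
  proof -
    let ?Q = "drop j (take (Suc k) P)"
    have len: "length ?Q = Suc k - j" using that by simp
    have "path_edges ?Q \<subseteq> path_edges P"
      by (rule subset_trans[OF path_edges_drop path_edges_take])
    then have "path_edges ?Q \<subseteq> edges H" using P(4) by (rule subset_trans)
    moreover have "distinct ?Q" using P(2) by simp
    moreover have "length ?Q \<ge> 3" using len that by simp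
    ultimately have "{hd ?Q, last ?Q} \<notin> edges H" by (intro acyclic)
    moreover have "?Q \<noteq> []" using len that by auto
    then have "hd ?Q = P ! j" "last ?Q = P ! k"
      using that by (simp_all add: hd_drop_conv_nth last_drop take_Suc_conv_app_nth)
    ultimately show ?thesis by simp
  qed
  show ?thesis
  proof (cases "w \<in> set P")
    case True
    then obtain k where k: "k < length P" "w = P ! k" unfolding in_set_conv_nth by auto
    have "i \<noteq> k" using wv i k by auto
    moreover have "\<not> Suc i < k" using chord[OF k(1), of i] vw(2) i k by auto
    moreover have "\<not> Suc k < i" using chord[OF i(1), of k] vw(2) i k by (auto simp: insert_commute)
    ultimately consider "k = Suc i" | "i = Suc k" by linarith
    then show ?thesis
    proof cases
      case 1
      then show ?thesis using path_edges_nthI[of i P] i k by simp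
    next
      case 2
      then show ?thesis using path_edges_nthI[of k P] i k by (simp add: insert_commute)
    qed
  next
    case False
    consider "i = 0" | "Suc i = length P" | "0 < i" "Suc i < length P" using i(1) by linarith
    then have False
    proof cases
      case 1
      then have "hd P = v" using i P(1) by (simp add: hd_conv_nth)
      then have "path_edges (w # P) \<subseteq> edges H" using path_edges_Cons[OF P(1), of w] vw(2) P(4)
        by (simp add: insert_commute)
      then have "length (w # P) \<le> length P" using False P wv by (intro longest) auto
      then show False by simp
    next
      case 2
      then have "i = length P - 1" by simp
      then have "last P = v" using i P(1) by (simp add: last_conv_nth)
      then have "path_edges (P @ [w]) \<subseteq> edges H" using path_edges_snoc[OF P(1), of w] vw(2) P(4)
        by simp
      then have "length (P @ [w]) \<le> length P" using False P wv by (intro longest) auto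
      then show False by simp
    next
      case 3
      then obtain j where j: "i = Suc j" by (cases i) auto
      have e: "{P ! j, v} \<in> edges H" "{v, P ! Suc i} \<in> edges H"
        using path_edges_nthI[of j P] path_edges_nthI[of i P] P(4) i j 3 by auto
      have m: "P ! j \<in> set P" "P ! Suc i \<in> set P" using 3 j by auto
      have "{P ! j, P ! Suc i, w} \<subseteq> nbrs H v"
        using e m vw(2) wv(1) P(3) unfolding nbrs_def by (auto simp: insert_commute)
      then have "card {P ! j, P ! Suc i, w} \<le> card (nbrs H v)" by (rule card_mono[OF finite_nbrs[OF H]])
      also have "\<dots> \<le> 2" using deg vw(1) P(3) by auto
      finally have "card {P ! j, P ! Suc i, w} \<le> 2" .
      moreover have "P ! j \<noteq> P ! Suc i"
        using nth_eq_iff_index_eq[OF P(2), of j "Suc i"] 3 j by simp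
      moreover have "P ! j \<noteq> w" "P ! Suc i \<noteq> w" using m False by auto
      ultimately show False by simp
    qed
    then show ?thesis ..
  qed
qed

text \<open>Induction on the number of vertices: a longest path is a component, and its removal
  preserves the hypotheses.\<close>

theorem linear_forest_decomposition:
  assumes H: "simple_graph H"
    and deg: "\<And>v. v \<in> verts H \<Longrightarrow> card (nbrs H v) \<le> 2"
    and acyclic: "\<And>ws. distinct ws \<Longrightarrow> length ws \<ge> 3 \<Longrightarrow> path_edges ws
      \<subseteq> edges H \<Longrightarrow> {hd ws, last ws} \<notin> edges H"
  shows "\<exists>Ps. distinct (concat Ps) \<and> set (concat Ps) = verts H \<and> [] \<notin> set Ps
    \<and> edges H = (\<Union>P\<in>set Ps. path_edges P)"
  using assms
proof (induction "card (verts H)" arbitrary: H rule: less_induct)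
  case less
  note H = less.prems(1)
  have fin: "finite (verts H)" using finite_verts[OF H] .
  show ?case
  proof (cases "verts H = {}")
    case True
    then have "edges H = {}" using H unfolding simple_graph_def by fastforce
    then show ?thesis using True by (intro exI[of _ "[]"]) simp
  next
    case False
    then obtain v0 where v0: "v0 \<in> verts H" by blast
    let ?path = "\<lambda>P. P \<noteq> [] \<and> distinct P \<and> set P \<subseteq> verts H \<and>
      path_edges P \<subseteq> edges H"
    have "?path [v0]" using v0 by simp
    moreover have "\<forall>P. ?path P \<longrightarrow> length P < Suc (card (verts H))"
      using card_mono[OF fin] by (auto simp: less_Suc_eq_le simp flip: distinct_card)
    ultimately have "\<exists>P. ?path P \<and> (\<forall>Q. ?path Q \<longrightarrow> length Q \<le> length P)"
      by (rule ex_has_greatest_nat[of ?path "[v0]" length])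
    then obtain P where longest_P: "?path P \<and> (\<forall>Q. ?path Q \<longrightarrow> length Q \<le>
      length P)" ..
    then have P: "P \<noteq> []" "distinct P" "set P \<subseteq> verts H" "path_edges P \<subseteq> edges
      H" by simp_all
    have longest: "length Q \<le> length P" if "?path Q" for Q using longest_P that by simp
    have comp: "{v, w} \<in> path_edges P" if "v \<in> set P" "{v, w} \<in> edges H" for v w
    proof (rule longest_path_component[OF H less.prems(2,3) P _ that])
      fix Q assume "distinct Q" "set Q \<subseteq> verts H" "path_edges Q \<subseteq> edges H"
      then show "length Q \<le> length P" using longest[of Q] by (cases "Q = []") auto
    qed
    define H' where "H' = \<lparr>verts = verts H - set P, edges = {e \<in> edges H. e \<inter> set P =
      {}}\<rparr>"
    have H': "verts H' = verts H - set P" "edges H' = {e \<in> edges H. e \<inter> set P = {}}" unfolding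
      H'_def by simp_all
    have s': "simple_graph H'" using H unfolding simple_graph_def H' by auto
    have "hd P \<in> set P" using P(1) by simp
    then have "verts H - set P \<subset> verts H" using P(3) by auto
    then have "card (verts H') < card (verts H)" unfolding H'(1) by (rule psubset_card_mono[OF fin])
    moreover have "card (nbrs H' v) \<le> 2" if "v \<in> verts H'" for v
    proof -
      have "nbrs H' v \<subseteq> nbrs H v" unfolding nbrs_def H' by auto
      then have "card (nbrs H' v) \<le> card (nbrs H v)" by (rule card_mono[OF finite_nbrs[OF H]])
      then show ?thesis using less.prems(2)[of v] that unfolding H'(1) by simp
    qed
    moreover have "{hd ws, last ws} \<notin> edges H'"
      if "distinct ws" "length ws \<ge> 3" "path_edges ws \<subseteq> edges H'" for ws
    proof -
      have "path_edges ws \<subseteq> edges H" using that(3) unfolding H'(2) by auto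
      then have "{hd ws, last ws} \<notin> edges H" using less.prems(3) that by simp
      then show ?thesis unfolding H'(2) by simp
    qed
    ultimately obtain Ps where Ps: "distinct (concat Ps)" "set (concat Ps) = verts H'" "[] \<notin> set Ps"
      "edges H' = (\<Union>P\<in>set Ps. path_edges P)"
      using less.hyps[OF _ s'] by auto
    have "edges H = path_edges P \<union> edges H'"
    proof
      show "path_edges P \<union> edges H' \<subseteq> edges H" using P(4) unfolding H'(2) by auto
      show "edges H \<subseteq> path_edges P \<union> edges H'"
      proof
        fix e assume e: "e \<in> edges H"
        show "e \<in> path_edges P \<union> edges H'"
        proof (cases "e \<inter> set P = {}")
          case True
          then show ?thesis using e unfolding H'(2) by simp
        next
          case False
          then obtain v where v: "v \<in> e" "v \<in> set P" by blast
          have "card e = 2" using simple_graph_edge[OF H e] ..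
          then obtain x y where "e = {x, y}" unfolding card_2_iff by blast
          then obtain w where "e = {v, w}" using v(1) by auto
          then show ?thesis using comp[OF v(2), of w] e by simp
        qed
      qed
    qed
    then have "distinct (concat (P # Ps)) \<and> set (concat (P # Ps)) = verts H \<and> [] \<notin> set (P
      # Ps) \<and>
        edges H = (\<Union>P\<in>set (P # Ps). path_edges P)"
      using Ps P unfolding H'(1) by auto
    then show ?thesis by (rule exI)
  qed
qed

section \<open>Local structure of outerplanar graphs\<close>

lemma card_gt_2_obtain:
  assumes "\<not> card S \<le> 2"
  obtains a b c where "a \<in> S" "b \<in> S" "c \<in> S" "distinct [a, b, c]"
proof -
  have "3 \<le> card S" using assms by simp
  then obtain T where T: "T \<subseteq> S" "card T = 3" by (rule obtain_subset_with_card_n)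
  then obtain a b c where "T = {a, b, c}" "a \<noteq> b" "b \<noteq> c" "a \<noteq> c" by (auto simp:
    card_3_iff)
  then show ?thesis using T(1) that[of a b c] by simp
qed

lemma nbrs_edge: "w \<in> nbrs G v \<Longrightarrow> {v, w} \<in> edges G" "w \<in> nbrs G v
  \<Longrightarrow> {w, v} \<in> edges G"
  unfolding nbrs_def by (simp_all add: insert_commute)

text \<open>Three common neighbours give a theta with three branches of length two.\<close>

lemma outerplanar_codegree:
  assumes G: "outerplanar G" "simple_graph G" and ab: "a \<noteq> b"
  shows "card (nbrs G a \<inter> nbrs G b) \<le> 2"
proof (rule ccontr)
  assume "\<not> ?thesis"
  then obtain x y z where xyz: "x \<in> nbrs G a \<inter> nbrs G b" "y \<in> nbrs G a \<inter> nbrs G b" "z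
    \<in> nbrs G a \<inter> nbrs G b"
    "distinct [x, y, z]" by (rule card_gt_2_obtain)
  have ne: "c \<noteq> a \<and> c \<noteq> b" if "c \<in> nbrs G a \<inter> nbrs G b" for c
    using that nbrs_irrefl[OF G(2), of a] nbrs_irrefl[OF G(2), of b] by auto
  note n = ne[OF xyz(1)] ne[OF xyz(2)] ne[OF xyz(3)]
  have E: "path_edges [a, c, b] \<subseteq> edges G" if "c \<in> nbrs G a \<inter> nbrs G b" for c
    using nbrs_edge(1)[of c G a] nbrs_edge(2)[of c G b] that by simp
  show False
    by (rule outerplanar_no_theta[OF G, of "[a, x, b]" "[a, y, b]" "[a, z, b]" a b])
      (use n ab xyz(4) E[OF xyz(1)] E[OF xyz(2)] E[OF xyz(3)] in auto)
qed

text \<open>Follow three neighbours \<open>a\<close>, \<open>b\<close>, \<open>c\<close> of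
  \<open>w\<close> at distance two from \<open>u\<close> to neighbours \<open>a'\<close>,
  \<open>b'\<close>, \<open>c'\<close> of \<open>u\<close>. If these are distinct, there is a theta
  from \<open>w\<close> to \<open>u\<close>; if exactly two coincide, one from \<open>w\<close> to
  the shared vertex, with a third branch through \<open>u\<close>; if all coincide, \<open>w\<close>
  and \<open>a'\<close> have three common neighbours.\<close>

lemma outerplanar_second_codegree:
  assumes G: "outerplanar G" "simple_graph G"
    and uw: "u \<in> verts G" "w \<in> verts G" "w \<noteq> u" "w \<notin> nbrs G u"
  shows "card (nbrs G w \<inter> {z \<in> verts G. z \<noteq> u \<and> z \<notin> nbrs G u \<and> nbrs G z
    \<inter> nbrs G u \<noteq> {}}) \<le> 2"
proof (rule ccontr)
  let ?S = "nbrs G w \<inter> {z \<in> verts G. z \<noteq> u \<and> z \<notin> nbrs G u \<and> nbrs G z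
    \<inter> nbrs G u \<noteq> {}}"
  assume "\<not> ?thesis"
  then obtain a b c where abc: "a \<in> ?S" "b \<in> ?S" "c \<in> ?S" "distinct [a, b, c]" by (rule
    card_gt_2_obtain)
  have S: "z \<noteq> w \<and> z \<noteq> u \<and> z \<notin> nbrs G u \<and> {w, z} \<in> edges G \<and>
    (\<exists>p\<in>nbrs G u. {z, p} \<in> edges G \<and> {p, u} \<in> edges G)"
    if z: "z \<in> ?S" for z
  proof -
    have "z \<noteq> w" using z nbrs_irrefl[OF G(2), of w] by auto
    moreover obtain p where "p \<in> nbrs G z" "p \<in> nbrs G u" using z by blast
    then have "\<exists>p\<in>nbrs G u. {z, p} \<in> edges G \<and> {p, u} \<in> edges G"
      using nbrs_edge(1)[of p G z] nbrs_edge(2)[of p G u] by blast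
    moreover have "{w, z} \<in> edges G" using z nbrs_edge(1)[of z G w] by simp
    ultimately show ?thesis using z by simp
  qed
  obtain a' where pa: "a' \<in> nbrs G u" "{a, a'} \<in> edges G" "{a', u} \<in> edges G" using S[OF
    abc(1)] by auto
  obtain b' where pb: "b' \<in> nbrs G u" "{b, b'} \<in> edges G" "{b', u} \<in> edges G" using S[OF
    abc(2)] by auto
  obtain c' where pc: "c' \<in> nbrs G u" "{c, c'} \<in> edges G" "{c', u} \<in> edges G" using S[OF
    abc(3)] by auto
  note p = pa(1) pb(1) pc(1) pa(2) pb(2) pc(2) pa(3) pb(3) pc(3)
  have ne: "z \<noteq> w" "z \<noteq> u" "z \<notin> nbrs G u" "{w, z} \<in> edges G" if "z \<in> {a, b,
    c}" for z
    using that S[OF abc(1)] S[OF abc(2)] S[OF abc(3)] by auto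
  have pne: "q \<noteq> u" "q \<noteq> w" "q \<noteq> a" "q \<noteq> b" "q \<noteq> c" if "q \<in> {a', b',
    c'}" for q
  proof -
    have "q \<in> nbrs G u" using that p by auto
    moreover have "a \<notin> nbrs G u" "b \<notin> nbrs G u" "c \<notin> nbrs G u" using ne(3) by simp_all
    ultimately show "q \<noteq> u" "q \<noteq> w" "q \<noteq> a" "q \<noteq> b" "q \<noteq> c"
      using uw(4) nbrs_irrefl[OF G(2), of u] by auto
  qed
  note n = ne[of a, simplified] ne[of b, simplified] ne[of c, simplified]
    pne[of a', simplified] pne[of b', simplified] pne[of c', simplified]
  have two: False
    if z: "distinct [x, y, z]" "x \<in> {a, b, c}" "y \<in> {a, b, c}" "z \<in> {a, b, c}"
      and q: "q \<in> {a', b', c'}" "r \<in> {a', b', c'}" "q \<noteq> r"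
      and E: "{x, q} \<in> edges G" "{y, q} \<in> edges G" "{z, r} \<in> edges G" for x y z q r
  proof -
    have "{r, u} \<in> edges G" "{u, q} \<in> edges G" using q p by (auto simp: insert_commute)
    moreover have "q \<noteq> x \<and> q \<noteq> y \<and> q \<noteq> z \<and> r \<noteq> x \<and> r
      \<noteq> y \<and> r \<noteq> z"
      using pne(3-5)[OF q(1)] pne(3-5)[OF q(2)] z by auto
    ultimately show False
      by (intro outerplanar_no_theta[OF G, of "[w, x, q]" "[w, y, q]" "[w, z, r, u, q]" w q])
        (use z(1) q(3) E ne[OF z(2)] ne[OF z(3)] ne[OF z(4)] pne(1,2)[OF q(1)] pne(1,2)[OF q(2)] uw(3) in auto)
  qed
  consider "a' = b'" "b' = c'" | "a' = b'" "b' \<noteq> c'" | "a' = c'" "b' \<noteq> c'" | "b' = c'" "a'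
    \<noteq> b'"
    | "distinct [a', b', c']" by auto
  then show False
  proof cases
    case 1
    have "{a, b, c} \<subseteq> nbrs G w \<inter> nbrs G a'"
      using abc(1-3) p(4-6) 1 unfolding nbrs_def by (auto simp: insert_commute)
    then have "card {a, b, c} \<le> card (nbrs G w \<inter> nbrs G a')"
      using finite_nbrs[OF G(2)] by (intro card_mono) auto
    also have "\<dots> \<le> 2" using outerplanar_codegree[OF G, of w a'] n by auto
    finally show False using abc(4) by simp
  next
    case 2 then show False using two[of a b c a' c'] abc(4) p by auto
  next
    case 3 then show False using two[of a c b a' b'] abc(4) p by auto
  next
    case 4 then show False using two[of b c a b' a'] abc(4) p by auto
  next
    case 5
    show False
      by (rule outerplanar_no_theta[OF G, of "[w, a, a', u]" "[w, b, b', u]" "[w, c, c', u]" w u])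
        (use 5 abc(4) p n uw(3) in auto)
  qed
qed

text \<open>A cycle in the neighbourhood forms a wheel with \<open>u\<close>. A triangle gives a
  complete graph on four vertices; in a longer cycle, two vertices at distance two are joined both
  ways around and through \<open>u\<close>, which is a theta. Degrees are bounded by
  \<open>outerplanar_codegree\<close>.\<close>

lemma outerplanar_neighbourhood:
  assumes G: "outerplanar G" "simple_graph G" and u: "u \<in> verts G"
  shows "\<exists>Ps. distinct (concat Ps) \<and> set (concat Ps) = nbrs G u \<and> [] \<notin> set Ps \<and>
    {e \<in> edges G. e \<subseteq> nbrs G u} = (\<Union>P\<in>set Ps. path_edges P)"
proof -
  define H where "H = \<lparr>verts = nbrs G u, edges = {e \<in> edges G. e \<subseteq> nbrs G u}\<rparr>"
  have H: "verts H = nbrs G u" "edges H = {e \<in> edges G. e \<subseteq> nbrs G u}" unfolding H_def by simp_all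
  have uN: "u \<notin> nbrs G u" by (rule nbrs_irrefl[OF G(2)])
  have "simple_graph H" using G(2) finite_nbrs[OF G(2)] unfolding simple_graph_def H by auto
  moreover have "card (nbrs H v) \<le> 2" if v: "v \<in> verts H" for v
  proof -
    have "nbrs H v \<subseteq> nbrs G v \<inter> nbrs G u" unfolding nbrs_def H by auto
    then have "card (nbrs H v) \<le> card (nbrs G v \<inter> nbrs G u)" using finite_nbrs[OF G(2)] by
      (intro card_mono) auto
    also have "\<dots> \<le> 2" using outerplanar_codegree[OF G, of v u] v uN unfolding H by auto
    finally show ?thesis .
  qed
  moreover have "{hd ws, last ws} \<notin> edges H"
    if ws: "distinct ws" "length ws \<ge> 3" "path_edges ws \<subseteq> edges H" for ws
  proof
    assume closed: "{hd ws, last ws} \<in> edges H"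
    have "set ws \<subseteq> nbrs G u"
    proof
      fix v assume "v \<in> set ws"
      then obtain e where "e \<in> path_edges ws" "v \<in> e" using path_vertex_edge[of v ws] ws(2) by auto
      then show "v \<in> nbrs G u" using ws(3) unfolding H by blast
    qed
    then have uws: "u \<notin> set ws" and uE: "{u, v} \<in> edges G" "{v, u} \<in> edges G" if "v \<in>
      set ws" for v
      using uN that nbrs_edge[of v G u] by auto
    have E: "path_edges ws \<subseteq> edges G" "{hd ws, last ws} \<in> edges G" using ws(3) closed
      unfolding H by auto
    obtain a ws1 where "ws = a # ws1" using ws(2) by (cases ws) auto
    moreover obtain b ws2 where "ws1 = b # ws2" using ws(2) calculation by (cases ws1) auto
    moreover obtain c zs where "ws2 = c # zs" using ws(2) calculation by (cases ws2) auto
    ultimately have w: "ws = a # b # c # zs" by simp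
    show False
    proof (cases "zs = []")
      case True
      show False
        by (rule outerplanar_no_K4[OF G, of u a b c])
          (use True w ws(1) uws[of a] uE[of a] uE[of b] uE[of c] E in \<open>auto simp: insert_commute\<close>)
    next
      case False
      let ?Q = "a # rev (c # zs)"
      have "path_edges ?Q \<subseteq> edges G"
      proof -
        have "path_edges ?Q = insert {a, hd (rev (c # zs))} (path_edges (rev (c # zs)))"
          by (rule path_edges_Cons) simp
        also have "\<dots> = insert {a, last zs} (path_edges (c # zs))"
          unfolding path_edges_rev using False by (simp add: hd_rev)
        also have "\<dots> \<subseteq> edges G" using E w False by auto
        finally show ?thesis .
      qed
      moreover have "length ?Q \<ge> 3" using False by (cases zs) auto
      ultimately show False
        by (intro outerplanar_no_theta[OF G, of "[a, b, c]" "[a, u, c]" ?Q a c])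
          (use w ws(1) uws[of a] uE[of a] uE[of c] E in auto)
    qed
  qed
  ultimately show ?thesis using linear_forest_decomposition[of H] unfolding H by simp
qed

section \<open>Bouquets in fans\<close>

text \<open>Off the centre the numbers \<open>j * (l - 1) + k\<close> with
  \<open>1 \<le> k \<le> l - 1\<close> are decoded, after subtracting one, by division with
  remainder by \<open>l - 1\<close>.\<close>

lemma bouquet_vertex_eq:
  assumes "bouquet_vertex l i a = bouquet_vertex l j b" "a < l" "b < l"
  shows "a = b \<and> (a = 0 \<or> i = j)"
proof (cases "a = 0 \<or> b = 0")
  case True
  then show ?thesis using assms by (auto simp: bouquet_vertex_def split: if_splits)
next
  case False
  then obtain a' b' where ab: "a = Suc a'" "b = Suc b'" by (metis not0_implies_Suc)
  then have lt: "a' < l - 1" "b' < l - 1" using assms by auto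
  have "i * (l - 1) + a' = j * (l - 1) + b'" using assms(1) ab by (simp add: bouquet_vertex_def)
  then have "(i * (l - 1) + a') div (l - 1) = (j * (l - 1) + b') div (l - 1)"
    "(i * (l - 1) + a') mod (l - 1) = (j * (l - 1) + b') mod (l - 1)" by simp_all
  then show ?thesis using lt ab by simp
qed

lemma bouquet_vertex_le:
  assumes "j < t" "k < l"
  shows "bouquet_vertex l j k \<le> t * (l - 1)"
proof (cases "k = 0")
  case False
  have "j * (l - 1) + k \<le> Suc j * (l - 1)" using assms by simp
  also have "\<dots> \<le> t * (l - 1)" using assms by (intro mult_le_mono1) simp
  finally show ?thesis using False by (simp add: bouquet_vertex_def)
qed (simp add: bouquet_vertex_def)

text \<open>\<open>L\<close> lists, path by path, as many blocks of \<open>K\<close> consecutive vertices as fit.\<close>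

lemma path_blocks:
  assumes "distinct (concat Ps)" "K > 0"
  shows "\<exists>L. distinct L \<and> set L \<subseteq> set (concat Ps) \<and> length L = K *
    (\<Sum>P\<leftarrow>Ps. length P div K) \<and>
    (\<forall>i. Suc i < length L \<longrightarrow> \<not> K dvd Suc i \<longrightarrow> {L ! i, L ! Suc i}
      \<in> (\<Union>P\<in>set Ps. path_edges P))"
  using assms(1)
proof (induction Ps)
  case (Cons P Ps)
  then obtain L where L: "distinct L" "set L \<subseteq> set (concat Ps)" "length L = K *
    (\<Sum>P\<leftarrow>Ps. length P div K)"
    "\<And>i. Suc i < length L \<Longrightarrow> \<not> K dvd Suc i \<Longrightarrow> {L ! i, L ! Suc i}
      \<in> (\<Union>P\<in>set Ps. path_edges P)" by auto
  define A where "A = take (K * (length P div K)) P"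
  have lA: "length A = K * (length P div K)" unfolding A_def by simp
  have "distinct (A @ L)"
    using Cons.prems L(1,2) set_take_subset[of "K * (length P div K)" P] unfolding A_def by auto
  moreover have "set (A @ L) \<subseteq> set (concat (P # Ps))"
    using L(2) set_take_subset[of "K * (length P div K)" P] unfolding A_def by auto
  moreover have "length (A @ L) = K * (\<Sum>P\<leftarrow>P # Ps. length P div K)"
    using lA L(3) by (simp add: distrib_left)
  moreover have "{(A @ L) ! i, (A @ L) ! Suc i} \<in> (\<Union>P\<in>set (P # Ps). path_edges P)"
    if i: "Suc i < length (A @ L)" "\<not> K dvd Suc i" for i
  proof -
    consider "Suc i < length A" | "Suc i = length A" | "length A \<le> i" by linarith
    then show ?thesis
    proof cases
      case 1
      then have "{A ! i, A ! Suc i} \<in> path_edges A" by (rule path_edges_nthI)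
      then have "{A ! i, A ! Suc i} \<in> path_edges P" using path_edges_take unfolding A_def by auto
      then show ?thesis using 1 by (simp add: nth_append)
    next
      case 2
      then have "K dvd Suc i" unfolding lA by simp
      then show ?thesis using i by simp
    next
      case 3
      then obtain j where j: "i = length A + j" using le_Suc_ex by blast
      then have "Suc j < length L" using i by simp
      moreover have "\<not> K dvd Suc j"
      proof
        assume "K dvd Suc j"
        then have "K dvd length A + Suc j" unfolding lA by (intro dvd_add) simp_all
        then show False using i j by simp
      qed
      ultimately have "{L ! j, L ! Suc j} \<in> (\<Union>P\<in>set Ps. path_edges P)" by (rule L(4))
      then show ?thesis using j by (auto simp: nth_append)
    qed
  qed
  ultimately show ?case by (intro exI[of _ "A @ L"]) simp
qed simp

text \<open>Vertex number \<open>v\<close> of the bouquet goes to entry \<open>v\<close> of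
  \<open>u # L\<close>. Cycle \<open>j\<close> without its centre then fills block \<open>j\<close>
  of \<open>L\<close>, so apart from the spokes only consecutive vertices within a block have to be
  adjacent.\<close>

lemma contains_bouquet:
  assumes d: "distinct (u # concat Ps)" and sub: "verts (fan_graph u Ps) \<subseteq> verts G" "edges
    (fan_graph u Ps) \<subseteq> edges G"
    and l: "l \<ge> 3" and t: "t \<le> (\<Sum>P\<leftarrow>Ps. length P div (l - 1))"
  shows "contains_subgraph G (bouquet t l)"
proof -
  define K where "K = l - 1"
  have K: "K \<ge> 2" "l = Suc K" using l unfolding K_def by auto
  obtain L where L: "distinct L" "set L \<subseteq> set (concat Ps)" "length L = K *
    (\<Sum>P\<leftarrow>Ps. length P div K)"
    "\<And>i. Suc i < length L \<Longrightarrow> \<not> K dvd Suc i \<Longrightarrow> {L ! i, L ! Suc i}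
      \<in> (\<Union>P\<in>set Ps. path_edges P)"
    using path_blocks[of Ps K] d K by auto
  have len: "t * K \<le> length L" unfolding L(3) using t unfolding K_def by (simp add: mult.commute)
  define f where "f v = (u # L) ! v" for v
  have dL: "distinct (u # L)" using d L by auto
  have bound: "v < length (u # L)" if v: "v \<in> verts (bouquet t l)" for v
  proof -
    obtain j k where "v = bouquet_vertex l j k" "j < t" "k < l" using v unfolding bouquet_def by auto
    then have "v \<le> t * K" using bouquet_vertex_le[of j t k l] unfolding K_def by simp
    then show ?thesis using len by simp
  qed
  have "inj_on f (verts (bouquet t l))"
  proof (rule inj_onI)
    fix x y assume "x \<in> verts (bouquet t l)" "y \<in> verts (bouquet t l)" "f x = f y"
    then show "x = y" unfolding f_def using nth_eq_iff_index_eq[OF dL bound bound] by simp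
  qed
  moreover
  have fV: "f v \<in> insert u (set L)" if "v \<in> verts (bouquet t l)" for v
    unfolding f_def using nth_mem[OF bound[OF that]] by simp
  have "insert u (set L) \<subseteq> verts (fan_graph u Ps)" unfolding verts_fan by (rule insert_mono[OF L(2)])
  then have "insert u (set L) \<subseteq> verts G" using sub(1) by (rule subset_trans)
  then have "f ` verts (bouquet t l) \<subseteq> verts G" using fV by (intro image_subsetI) auto
  moreover have "f ` e \<in> edges G" if e: "e \<in> edges (bouquet t l)" for e
  proof -
    obtain j k where jk: "j < t" "k < l" "e = {bouquet_vertex l j k, bouquet_vertex l j (Suc k mod l)}"
      using e unfolding bouquet_def by auto
    have jK: "j * K + K \<le> t * K" using jk(1) mult_le_mono1[of "Suc j" t K] by simp
    have hub: "{u, L ! i} \<in> edges G" if "i < length L" for i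
    proof -
      have "L ! i \<in> set (concat Ps)" by (rule subsetD[OF L(2) nth_mem[OF that]])
      then have "{u, L ! i} \<in> edges (fan_graph u Ps)" unfolding edges_fan by (rule UnI1[OF imageI])
      then show ?thesis by (rule subsetD[OF sub(2)])
    qed
    have f0: "f 0 = u" "f (Suc i) = L ! i" for i unfolding f_def by simp_all
    consider "k = 0" | "k = K" | "0 < k" "k < K" using jk(2) K by linarith
    then show ?thesis
    proof cases
      case 1
      have "e = {0, Suc (j * K)}" using jk(3) 1 K by (simp add: bouquet_vertex_def)
      then have "f ` e = {u, L ! (j * K)}" by (simp add: f0)
      then show ?thesis using hub[of "j * K"] jK len K by simp
    next
      case 2
      have "e = {Suc (j * K + K - 1), 0}" using jk(3) 2 K by (simp add: bouquet_vertex_def)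
      then have "f ` e = {u, L ! (j * K + K - 1)}" by (simp add: f0 insert_commute)
      then show ?thesis using hub[of "j * K + K - 1"] jK len K by simp
    next
      case 3
      then obtain k' where k': "k = Suc k'" by (cases k) auto
      have "e = {Suc (j * K + k'), Suc (Suc (j * K + k'))}"
        using jk(3) 3 K k' by (simp add: bouquet_vertex_def)
      then have "f ` e = {L ! (j * K + k'), L ! Suc (j * K + k')}" by (simp add: f0)
      moreover have "\<not> K dvd Suc (j * K + k')"
      proof
        assume "K dvd Suc (j * K + k')"
        then have "K dvd j * K + k" using k' by simp
        then have "K dvd k" by (simp add: dvd_add_right_iff)
        then show False using 3 by (simp add: nat_dvd_not_less)
      qed
      moreover have "Suc (j * K + k') < length L" using jK len 3 k' by simp
      ultimately have "f ` e \<in> (\<Union>P\<in>set Ps. path_edges P)" using L(4)[of "j * K + k'"] by simp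
      then show ?thesis using sub(2) unfolding edges_fan by auto
    qed
  qed
  ultimately show ?thesis unfolding contains_subgraph_def by (intro exI[of _ f]) simp
qed

text \<open>In the spine, a vertex of maximal position on a cycle would have both its neighbours
  on the cycle at the same place.\<close>

lemma fan_cycle_hub:
  assumes d: "distinct (u # concat Ps)" and l: "l \<ge> 3"
    and inj: "inj_on c {..<l}"
    and E: "\<And>k. k < l \<Longrightarrow> {c k, c (Suc k mod l)} \<in> edges (fan_graph u Ps)"
  shows "\<exists>k<l. c k = u"
proof (rule ccontr)
  assume "\<not> ?thesis"
  then have nu: "c k \<noteq> u" if "k < l" for k using that by simp
  obtain F :: "'a \<Rightarrow> nat" where F: "inj_on F (set (concat Ps))"
    "\<And>a b. {a, b} \<in> edges (fan_graph u Ps) \<Longrightarrow> a \<noteq> u \<Longrightarrow> b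
      \<noteq> u \<Longrightarrow> F b = Suc (F a) \<or> F a = Suc (F b)"
    using fan_spine[OF d] by auto
  have cV: "c k \<in> set (concat Ps)" if "k < l" for k
    using simple_graph_edge[OF simple_fan[OF d] E[OF that]] nu[OF that] by auto
  have "Max ((\<lambda>k. F (c k)) ` {..<l}) \<in> (\<lambda>k. F (c k)) ` {..<l}" using l by (intro
    Max_in) (auto simp: lessThan_empty_iff)
  then obtain m where m: "m < l" "F (c m) = Max ((\<lambda>k. F (c k)) ` {..<l})" by auto
  have max: "F (c k) \<le> F (c m)" if "k < l" for k unfolding m(2) using that by (intro Max_ge) auto
  define a where "a = Suc m mod l"
  define b where "b = (m + (l - 1)) mod l"
  have ab: "a < l" "b < l" unfolding a_def b_def using l by simp_all
  have sb: "Suc b mod l = m"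
    unfolding b_def using m(1) l by (simp add: mod_Suc_eq)
  have "F (c m) = Suc (F (c a))"
    using F(2)[OF E[OF m(1)]] nu m(1) ab max[OF ab(1)] unfolding a_def by fastforce
  moreover have "F (c m) = Suc (F (c b))"
    using F(2)[OF E[OF ab(2)]] nu m(1) ab max[OF ab(2)] unfolding sb by fastforce
  ultimately have "F (c a) = F (c b)" by simp
  then have "c a = c b" by (rule inj_onD[OF F(1) _ cV[OF ab(1)] cV[OF ab(2)]])
  then have "a = b" using inj ab unfolding inj_on_def by simp
  then show False
  proof (cases "Suc m < l")
    case True
    then have "a = Suc m" unfolding a_def by simp
    then have "Suc (Suc m) mod l = m" using sb \<open>a = b\<close> by simp
    then show False using True l by (cases "Suc (Suc m) = l") auto
  next
    case False
    then have "Suc m = l" using m(1) by simp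
    then have "b = 0" using \<open>a = b\<close> unfolding a_def by simp
    then show False using sb \<open>Suc m = l\<close> l by simp
  qed
qed

text \<open>Read from the hub on, the cycle visits its other \<open>l - 1\<close> vertices along
  spine edges, and these never leave a path.\<close>

lemma fan_cycle_block:
  assumes d: "distinct (u # concat Ps)" and l: "l \<ge> 3"
    and inj: "inj_on c {..<l}"
    and E: "\<And>k. k < l \<Longrightarrow> {c k, c (Suc k mod l)} \<in> edges (fan_graph u Ps)"
  shows "\<exists>P\<in>set Ps. c ` {..<l} - {u} \<subseteq> set P"
proof -
  obtain h where h: "h < l" "c h = u" using fan_cycle_hub[OF assms] by auto
  define s where "s i = c ((h + i) mod l)" for i
  have su: "s i \<noteq> u" if "0 < i" "i < l" for i
  proof
    assume "s i = u"
    then have "(h + i) mod l = h" using inj h l unfolding s_def inj_on_def by auto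
    moreover have "(h + i) mod l = (if h + i < l then h + i else h + i - l)"
      using that h by (simp add: mod_if)
    ultimately show False using that by (auto split: if_splits)
  qed
  have sE: "{s i, s (Suc i)} \<in> edges (fan_graph u Ps)" for i
    using E[of "(h + i) mod l"] l unfolding s_def by (simp add: mod_Suc_eq)
  have next_in: "\<exists>P\<in>set Ps. s i \<in> set P \<and> s (Suc i) \<in> set P" if i: "0 < i" "Suc i
    < l" for i
  proof -
    have "s i \<noteq> u" "s (Suc i) \<noteq> u" using su i by simp_all
    then have "{s i, s (Suc i)} \<notin> (\<lambda>v. {u, v}) ` set (concat Ps)" by (auto simp:
      doubleton_eq_iff)
    then obtain P where "P \<in> set Ps" "{s i, s (Suc i)} \<in> path_edges P"
      using sE[of i] unfolding edges_fan by auto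
    then show ?thesis using path_edges_subset[of "{s i, s (Suc i)}" P] by auto
  qed
  obtain P where P: "P \<in> set Ps" "s 1 \<in> set P" using next_in[of 1] l by auto
  have sP: "s (Suc i) \<in> set P" if "Suc i < l" for i
    using that
  proof (induction i)
    case (Suc i)
    then obtain Q where Q: "Q \<in> set Ps" "s (Suc i) \<in> set Q" "s (Suc (Suc i)) \<in> set Q"
      using next_in[of "Suc i"] by auto
    have "s (Suc i) \<in> set P" using Suc by simp
    moreover have "set P \<inter> set Q = {}" if "P \<noteq> Q"
      using d P(1) Q(1) that by (simp add: distinct_concat_iff)
    ultimately have "P = Q" using Q(2) by auto
    then show ?case using Q(3) by simp
  qed (use P in simp)
  have "c ` {..<l} - {u} \<subseteq> set P"
  proof
    fix v assume "v \<in> c ` {..<l} - {u}"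
    then obtain k where k: "k < l" "v = c k" "v \<noteq> u" by auto
    then have "k \<noteq> h" using h by auto
    define i where "i = (k + (l - h)) mod l"
    have "(h + i) mod l = (h + (k + (l - h))) mod l" unfolding i_def by (simp add: mod_add_right_eq)
    also have "\<dots> = k" using h k by simp
    finally have e: "(h + i) mod l = k" .
    have "i \<noteq> 0"
    proof
      assume "i = 0"
      then show False using e \<open>k \<noteq> h\<close> h(1) by simp
    qed
    moreover have "i < l" unfolding i_def using l by simp
    ultimately have "s i \<in> set P" using sP[of "i - 1"] by simp
    then show "v \<in> set P" unfolding s_def e using k by simp
  qed
  then show ?thesis using P(1) by auto
qed

lemma sum_set_le_sum_list: "(\<Sum>x\<in>set xs. f x) \<le> (\<Sum>x\<leftarrow>xs. f x)" for f :: "'a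
  \<Rightarrow> nat"
  by (induction xs) (auto simp: sum.insert_if)

text \<open>Each cycle takes, besides the hub, \<open>l - 1\<close> vertices from a single path, and
  different cycles take disjoint sets; so a path \<open>P\<close> serves at most
  \<open>length P div (l - 1)\<close> cycles.\<close>

theorem fan_bouquet_free:
  assumes d: "distinct (u # concat Ps)" and l: "l \<ge> 3" and t: "(\<Sum>P\<leftarrow>Ps. length P div (l
    - 1)) < t"
  shows "free_of (bouquet t l) (fan_graph u Ps)"
proof
  assume "contains_subgraph (fan_graph u Ps) (bouquet t l)"
  then obtain f where f: "inj_on f (verts (bouquet t l))" "\<And>e. e \<in> edges (bouquet t l)
    \<Longrightarrow> f ` e \<in> edges (fan_graph u Ps)"
    unfolding contains_subgraph_def by auto
  define c where "c j k = f (bouquet_vertex l j k)" for j k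
  have bV: "bouquet_vertex l j k \<in> verts (bouquet t l)" if "j < t" "k < l" for j k
    using that unfolding bouquet_def by auto
  have ceq: "a = b \<and> (a = 0 \<or> i = j)" if "c i a = c j b" "i < t" "j < t" "a < l" "b < l" for i j a b
  proof (rule bouquet_vertex_eq)
    show "bouquet_vertex l i a = bouquet_vertex l j b"
      using f(1) bV that unfolding c_def inj_on_def by simp
  qed (use that in auto)
  have inj: "inj_on (c j) {..<l}" if "j < t" for j
    using ceq[of j _ j] that by (intro inj_onI) auto
  have E: "{c j k, c j (Suc k mod l)} \<in> edges (fan_graph u Ps)" if "j < t" "k < l" for j k
  proof -
    have "{bouquet_vertex l j k, bouquet_vertex l j (Suc k mod l)} \<in> edges (bouquet t l)"
      using that unfolding bouquet_def by auto
    from f(2)[OF this] show ?thesis unfolding c_def by simp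
  qed
  define D where "D j = c j ` {..<l} - {u}" for j
  have hub: "u \<in> c j ` {..<l}" if "j < t" for j
    using fan_cycle_hub[OF d l inj[OF that] E[OF that]] by auto
  have cardD: "card (D j) = l - 1" if "j < t" for j
    unfolding D_def using hub[OF that] card_image[OF inj[OF that]] by simp
  have "\<exists>P\<in>set Ps. D j \<subseteq> set P" if "j < t" for j
    unfolding D_def by (rule fan_cycle_block[OF d l inj[OF that] E[OF that]])
  then have "\<forall>j\<in>{..<t}. \<exists>P. P \<in> set Ps \<and> D j \<subseteq> set P"
    by (simp add: Bex_def)
  then have "\<exists>p. \<forall>j\<in>{..<t}. p j \<in> set Ps \<and> D j \<subseteq> set (p j)" by (rule
    bchoice)
  then obtain p where p: "\<And>j. j < t \<Longrightarrow> p j \<in> set Ps" "\<And>j. j < t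
    \<Longrightarrow> D j \<subseteq> set (p j)" by auto
  \<comment> \<open>Two different cycles share only the image of the centre, and both contain the
    hub; hence the hub is that image.\<close>
  have disj: "D i \<inter> D j = {}" if ij: "i < t" "j < t" "i \<noteq> j" for i j
  proof (rule ccontr)
    assume "D i \<inter> D j \<noteq> {}"
    then obtain a b where ab: "a < l" "b < l" "c i a = c j b" "c i a \<noteq> u" unfolding D_def by auto
    then have "a = 0" using ceq[of i a j b] ij by auto
    then have f0: "f 0 \<noteq> u" using ab(4) unfolding c_def by (simp add: bouquet_vertex_def)
    obtain a' where a': "a' < l" "c i a' = u" using hub[OF ij(1)] by auto
    obtain b' where b': "b' < l" "c j b' = u" using hub[OF ij(2)] by auto
    have "a' = 0" using ceq[of i a' j b'] a' b' ij by auto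
    then show False using a' f0 unfolding c_def by (simp add: bouquet_vertex_def)
  qed
  have block: "card {j \<in> {..<t}. p j = P} \<le> length P div (l - 1)" if P: "P \<in> set Ps" for P
  proof -
    let ?J = "{j \<in> {..<t}. p j = P}"
    have "card (\<Union>j\<in>?J. D j) = (\<Sum>j\<in>?J. card (D j))"
      using disj by (intro card_UN_disjoint) (auto simp: D_def)
    also have "\<dots> = card ?J * (l - 1)" using cardD by simp
    finally have "card ?J * (l - 1) = card (\<Union>j\<in>?J. D j)" by simp
    also have "\<dots> \<le> card (set P)" using p(2) by (intro card_mono) auto
    also have "\<dots> \<le> length P" by (rule card_length)
    finally show ?thesis using l by (simp add: less_eq_div_iff_mult_less_eq)
  qed
  have "t = card (\<Union>P\<in>set Ps. {j \<in> {..<t}. p j = P})"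
  proof -
    have "(\<Union>P\<in>set Ps. {j \<in> {..<t}. p j = P}) = {..<t}" using p(1) by auto
    then show ?thesis by simp
  qed
  also have "\<dots> \<le> (\<Sum>P\<in>set Ps. card {j \<in> {..<t}. p j = P})" by (rule card_UN_le) simp
  also have "\<dots> \<le> (\<Sum>P\<in>set Ps. length P div (l - 1))" by (rule sum_mono) (rule block)
  also have "\<dots> \<le> (\<Sum>P\<leftarrow>Ps. length P div (l - 1))" by (rule sum_set_le_sum_list)
  finally show False using t by simp
qed

section \<open>Fans up to isomorphism\<close>

lemma path_edges_map: "path_edges (map f vs) = (`) f ` path_edges vs"
  by (induction vs rule: path_edges.induct) auto

lemma verts_fan_map: "verts (fan_graph (f u) (map (map f) Ps)) = f ` verts (fan_graph u Ps)"
  by (auto simp: image_iff)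

lemma edges_fan_map: "edges (fan_graph (f u) (map (map f) Ps)) = (`) f ` edges (fan_graph u Ps)"
proof -
  have "(\<lambda>v. {f u, v}) ` set (concat (map (map f) Ps)) = (`) f ` (\<lambda>v. {u, v}) ` set (concat Ps)"
  proof -
    have "set (concat (map (map f) Ps)) = f ` set (concat Ps)" by auto
    then show ?thesis by (simp add: image_image)
  qed
  moreover have "(\<Union>P\<in>set (map (map f) Ps). path_edges P) = (`) f ` (\<Union>P\<in>set Ps.
    path_edges P)"
    by (simp add: path_edges_map image_UN)
  ultimately show ?thesis unfolding edges_fan by (simp add: image_Un)
qed

text \<open>Matching \<open>u # concat Ps\<close> and \<open>w # concat Qs\<close> position by
  position maps paths to paths, since equal lengths cut the two enumerations at the same
  places.\<close>

lemma fan_isomorphic: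
  assumes P: "distinct (u # concat Ps)" and Q: "distinct (w # concat Qs)"
    and len: "map length Ps = map length Qs"
  shows "fan_graph u Ps \<cong>\<^sub>g fan_graph w Qs"
proof -
  let ?A = "u # concat Ps" and ?B = "w # concat Qs"
  have lAB: "length ?A = length ?B" using len by (simp add: length_concat)
  define f where "f v = the (map_of (zip ?A ?B) v)" for v
  have "f (?A ! i) = ?B ! i" if "i < length ?A" for i
    unfolding f_def using map_of_zip_nth[OF lAB P] that lAB by (metis option.sel)
  note f_nth = this
  have map: "map f ?A = ?B"
  proof (rule nth_equalityI)
    show "length (map f ?A) = length ?B" using lAB by simp
    fix i assume "i < length (map f ?A)"
    then have i: "i < length ?A" by simp
    show "map f ?A ! i = ?B ! i" unfolding nth_map[OF i] by (rule f_nth[OF i])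
  qed
  then have fu: "f u = w" and fc: "concat (map (map f) Ps) = concat Qs" by (auto simp: map_concat)
  have "map (map f) Ps = Qs"
  proof -
    have l: "length (map (map f) Ps) = length Qs" using arg_cong[OF len, of length] by simp
    have "\<forall>(x, y)\<in>set (zip (map (map f) Ps) Qs). length x = length y"
    proof (clarsimp simp: in_set_zip)
      fix i assume "i < length Ps" "i < length Qs"
      then show "length (Ps ! i) = length (Qs ! i)" using arg_cong[OF len, of "\<lambda>xs. xs ! i"] by simp
    qed
    then show ?thesis using concat_eq_concat_iff[OF _ l] fc by simp
  qed
  then have eq: "fan_graph w Qs = fan_graph (f u) (map (map f) Ps)" using fu by simp
  have "distinct (map f ?A)" unfolding map by (rule Q)
  then have "inj_on f (set ?A)" by (simp only: distinct_map)
  then have "inj_on f (verts (fan_graph u Ps))" by simp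
  then have "bij_betw f (verts (fan_graph u Ps)) (verts (fan_graph w Qs))"
    unfolding eq verts_fan_map by (rule inj_on_imp_bij_betw)
  moreover have "edges (fan_graph w Qs) = (\<lambda>e. f ` e) ` edges (fan_graph u Ps)"
    unfolding eq edges_fan_map ..
  ultimately show ?thesis unfolding isomorphic_def by (intro exI[of _ f]) simp
qed

lemma fan_mset_cong:
  assumes "mset Ps = mset Qs"
  shows "fan_graph u Ps = fan_graph u Qs" "distinct (concat Ps) \<longleftrightarrow> distinct (concat Qs)"
    "set (concat Ps) = set (concat Qs)"
proof -
  have "set Ps = set Qs" using assms by (rule mset_eq_setD)
  then show "fan_graph u Ps = fan_graph u Qs" "set (concat Ps) = set (concat Qs)"
    unfolding fan_graph_def by simp_all
  have "mset (concat Ps) = mset (concat Qs)"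
    unfolding mset_concat using arg_cong[OF assms, of "\<lambda>M. \<Sum>\<^sub># (image_mset mset M)"]
    by (simp flip: sum_mset_sum_list)
  then show "distinct (concat Ps) \<longleftrightarrow> distinct (concat Qs)" by (rule mset_eq_imp_distinct_iff)
qed

lemma reorder_by_image:
  assumes "mset (map h xs) = mset ns"
  shows "\<exists>ys. mset ys = mset xs \<and> map h ys = ns"
  using assms
proof (induction ns arbitrary: xs)
  case (Cons n ns)
  have "n \<in># mset (map h xs)" unfolding Cons.prems by simp
  then obtain x where x: "x \<in> set xs" "h x = n" by auto
  have xs: "mset xs = add_mset x (mset (remove1 x xs))" using x(1) by simp
  have "mset (map h xs) = add_mset n (mset (map h (remove1 x xs)))"
    unfolding mset_map by (subst xs) (simp add: x(2))
  then have "mset (map h (remove1 x xs)) = mset ns" using Cons.prems by simp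
  from Cons.IH[OF this] obtain ys where ys: "mset ys = mset (remove1 x xs)" "map h ys = ns" by auto
  have "mset (x # ys) = mset xs" unfolding xs mset.simps ys(1) ..
  moreover have "map h (x # ys) = n # ns" using x(2) ys(2) by simp
  ultimately show ?case by (intro exI[of _ "x # ys"]) simp
qed simp

corollary fan_isomorphic_mset:
  assumes P: "distinct (u # concat Ps)" and Q: "distinct (w # concat Qs)"
    and len: "mset (map length Ps) = mset (map length Qs)"
  shows "fan_graph u Ps \<cong>\<^sub>g fan_graph w Qs"
proof -
  obtain Ps' where Ps': "mset Ps' = mset Ps" "map length Ps' = map length Qs"
    using reorder_by_image[OF len] by auto
  note c = fan_mset_cong[OF Ps'(1)]
  have "distinct (u # concat Ps')" using P c(2,3) by simp
  from fan_isomorphic[OF this Q Ps'(2)] show ?thesis unfolding c(1) .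
qed

section \<open>The graphs \<open>K1 \<or>\<^sub>g H_op n n1 n2\<close> as fans\<close>

definition spoke_paths :: "nat list \<Rightarrow> (unit + nat \<times> nat) list list" where
  "spoke_paths ns = map (\<lambda>i. map (\<lambda>v. Inr (i, v)) [0..<ns ! i]) [0..<length ns]"

lemma set_concat_spoke_paths:
  "set (concat (spoke_paths ns)) = {Inr (i, v) | i v. i < length ns \<and> v < ns ! i}"
  unfolding spoke_paths_def by auto

lemma map_length_spoke_paths: "map length (spoke_paths ns) = ns"
  unfolding spoke_paths_def by (intro nth_equalityI) simp_all

lemma distinct_spoke_paths: "distinct (Inl () # concat (spoke_paths ns))"
proof -
  have "distinct (concat (map (\<lambda>i. map (\<lambda>v. Inr (i, v) :: unit + nat \<times> nat) [0..<g
    i]) xs))"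
    if "distinct xs" for g and xs :: "nat list"
    using that by (induction xs) (auto simp: distinct_map inj_on_def)
  moreover have "Inl () \<notin> set (concat (spoke_paths ns))" unfolding set_concat_spoke_paths by simp
  ultimately show ?thesis unfolding spoke_paths_def by simp
qed

text \<open>This is an equality, not only an isomorphism: \<open>spoke_paths\<close> lists the very
  vertices that the join and the disjoint union create, so results on fans apply by
  rewriting.\<close>

lemma join_path_graphs:
  "K1 \<or>\<^sub>g disjoint_union (map path_graph ns) = fan_graph (Inl ()) (spoke_paths ns)"
proof -
  let ?J = "K1 \<or>\<^sub>g disjoint_union (map path_graph ns)"
  have vD: "verts (disjoint_union (map path_graph ns)) = {(i, v) | i v. i < length ns \<and> v < ns ! i}"
    unfolding disjoint_union_def path_graph_def by auto
  have eP: "edges (path_graph m) = (\<lambda>v. {v, Suc v}) ` {v. Suc v < m}" for m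
    unfolding path_graph_def by auto
  have "{Pair i ` e | i e. i < k \<and> e \<in> X i} = (\<Union>i\<in>{..<k}. (`) (Pair i) ` X i)" for k
    and X :: "nat \<Rightarrow> nat set set"
    by auto
  then have "edges (disjoint_union (map path_graph ns)) =
      (\<Union>i\<in>{..<length ns}. (`) (Pair i) ` edges (map path_graph ns ! i))"
    unfolding disjoint_union_def by simp
  also have "\<dots> = (\<Union>i\<in>{..<length ns}. (`) (Pair i) ` edges (path_graph (ns ! i)))"
    by (intro SUP_cong refl) simp
  finally have "edges (disjoint_union (map path_graph ns)) =
      (\<Union>i\<in>{..<length ns}. (`) (Pair i) ` edges (path_graph (ns ! i)))" .
  then have eD: "edges (disjoint_union (map path_graph ns)) =
      (\<Union>i\<in>{..<length ns}. (\<lambda>v. {(i, v), (i, Suc v)}) ` {v. Suc v < ns ! i})"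
    unfolding eP by (simp add: image_image)
  have "verts ?J = verts (fan_graph (Inl ()) (spoke_paths ns))"
    unfolding verts_fan set_concat_spoke_paths join_graph_def K1_def vD by auto
  moreover have "edges ?J = edges (fan_graph (Inl ()) (spoke_paths ns))"
  proof -
    have "edges ?J = {{Inl (), Inr z} | z. z \<in> verts (disjoint_union (map path_graph ns))} \<union>
        (\<lambda>e. Inr ` e) ` edges (disjoint_union (map path_graph ns))"
      unfolding join_graph_def K1_def by auto
    also have "(\<lambda>e. Inr ` e) ` edges (disjoint_union (map path_graph ns)) =
        (\<Union>P\<in>set (spoke_paths ns). path_edges P)"
    proof -
      have "path_edges [0..<m] = (\<lambda>v. {v, Suc v}) ` {v. Suc v < m}" for m
      proof -
        have "path_edges [0..<m] = (\<lambda>i. {[0..<m] ! i, [0..<m] ! Suc i}) ` {i. Suc i < m}"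
          unfolding path_edges_nth length_upt diff_zero Setcompr_eq_image[symmetric] mem_Collect_eq ..
        also have "\<dots> = (\<lambda>v. {v, Suc v}) ` {v. Suc v < m}" by (intro image_cong refl) simp
        finally show ?thesis .
      qed
      then have "path_edges (map (\<lambda>v. Inr (i, v) :: unit + nat \<times> nat) [0..<m]) =
        (\<lambda>v. {Inr (i, v), Inr (i, Suc v)}) ` {v. Suc v < m}" for i m :: nat
        unfolding path_edges_map by (simp add: image_image)
      then show ?thesis
        unfolding spoke_paths_def eD by (simp add: image_UN image_image atLeast0LessThan)
    qed
    also have "{{Inl (), Inr z} | z. z \<in> verts (disjoint_union (map path_graph ns))} =
        (\<lambda>v. {Inl (), v}) ` set (concat (spoke_paths ns))"
      unfolding vD set_concat_spoke_paths by auto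
    finally show ?thesis unfolding edges_fan .
  qed
  ultimately show ?thesis by simp
qed

definition H_op_lengths :: "nat \<Rightarrow> nat \<Rightarrow> nat \<Rightarrow> nat list" where
  "H_op_lengths n n1 n2 = n1 # replicate ((n - 1 - n1) div n2) n2 @
     (if n2 dvd n - 1 - n1 then [] else [(n - 1 - n1) mod n2])"

lemma H_op_paths: "H_op n n1 n2 = disjoint_union (map path_graph (H_op_lengths n n1 n2))"
  unfolding H_op_def H_op_lengths_def Let_def by (simp add: minus_div_mult_eq_mod)

lemma mset_H_op_lengths:
  "mset (H_op_lengths n (Suc T * K - 1) (K - 1)) = optimal_lengths K T (n - 1)"
  unfolding H_op_lengths_def optimal_lengths_def Let_def by simp

section \<open>The extremal graph\<close>

lemma optimal_lengths_admissible:
  assumes K: "2 \<le> K" and N: "Suc T * K - 1 \<le> N"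
  shows "admissible K T N (optimal_lengths K T N)"
proof -
  define C where "C = Suc T * K - 1"
  have "K * T \<le> C" "C < K * Suc T" unfolding C_def using K by (simp_all add: algebra_simps)
  then have C: "C div K = T" by (rule div_nat_eqI)
  have C0: "C > 0" unfolding C_def using K by (simp add: algebra_simps)
  have r: "(N - C) mod (K - 1) < K - 1" using K by simp
  then have rK: "(N - C) mod (K - 1) div K = 0" by simp
  have "N = C + ((N - C) div (K - 1) * (K - 1) + (N - C) mod (K - 1))"
    using N div_mult_mod_eq[of "N - C" "K - 1"] unfolding C_def[symmetric] by linarith
  moreover have "sum_mset (optimal_lengths K T N) = C + ((N - C) div (K - 1) * (K - 1) + (N - C) mod (K - 1))"
    unfolding optimal_lengths_def Let_def C_def[symmetric] by (auto simp: dvd_eq_mod_eq_0)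
  moreover have "(\<Sum>m\<in>#optimal_lengths K T N. m div K) = T"
    unfolding optimal_lengths_def Let_def C_def[symmetric] using C rK K by simp
  moreover have "0 \<notin># optimal_lengths K T N"
    unfolding optimal_lengths_def Let_def C_def[symmetric] using C0 K by (auto simp: dvd_eq_mod_eq_0)
  ultimately show ?thesis unfolding admissible_def by simp
qed

lemma weight_mset: "weight g (mset ns) = (\<Sum>m\<leftarrow>ns. g m)"
  unfolding weight_def by (simp add: sum_mset_sum_list flip: mset_map)

lemma sum_mset_lengths: "sum_mset (mset (map length Ps)) = length (concat Ps)"
  unfolding length_concat sum_mset_sum_list ..

lemma length_concat_admissible:
  assumes "admissible K T N (mset (map length Ps))"
  shows "length (concat Ps) = N"
  using assms unfolding admissible_def sum_mset_lengths by simp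

lemma fan_admissible_le:
  assumes K: "2 \<le> K" and N: "Suc T * K - 1 \<le> N" "4 < N"
    and P: "distinct (u # concat Ps)" "admissible K T N (mset (map length Ps))"
    and Q: "distinct (w # concat Qs)" "mset (map length Qs) = optimal_lengths K T N"
  shows "graph_spectral_radius (fan_graph u Ps) \<le> graph_spectral_radius (fan_graph w Qs)"
    and "mset (map length Ps) \<noteq> optimal_lengths K T N \<Longrightarrow>
      graph_spectral_radius (fan_graph u Ps) < graph_spectral_radius (fan_graph w Qs)"
proof -
  have lP: "length (concat Ps) = N" by (rule length_concat_admissible[OF P(2)])
  have lQ: "length (concat Qs) = N"
    using length_concat_admissible[of K T N Qs] optimal_lengths_admissible[OF K N(1)] Q(2) by simp
  \<comment> \<open>The radius has to exceed \<open>2\<close> for \<open>\<rho> = r + 1 / r\<close>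
    to have a solution with \<open>r < 1\<close>.\<close>
  have "sqrt 4 < sqrt N" using N(2) by (intro real_sqrt_less_mono) simp
  then have big: "2 < graph_spectral_radius (fan_graph u Ps)"
    using fan_spectral_lower[OF P(1)] N(2) unfolding lP by simp
  have less: "(\<Sum>m\<leftarrow>map length Qs. path_defect r m) < (\<Sum>m\<leftarrow>map length Ps.
    path_defect r m)"
    if ne: "mset (map length Ps) \<noteq> optimal_lengths K T N" and r: "0 < r" "r < 1" for r
  proof -
    have "path_defect r 0 = 0" unfolding path_defect_def by simp
    from optimal_lengths_minimal[of "path_defect r", OF this path_defect_move[OF r] K N(1) P(2) ne]
    show ?thesis unfolding Q(2)[symmetric] weight_mset .
  qed
  have eq: "(\<Sum>m\<leftarrow>map length Qs. path_defect r m) = (\<Sum>m\<leftarrow>map length Ps.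
    path_defect r m)"
    if "mset (map length Ps) = optimal_lengths K T N" for r
    unfolding weight_mset[symmetric] that Q(2) ..
  show strict: "graph_spectral_radius (fan_graph u Ps) < graph_spectral_radius (fan_graph w Qs)"
    if "mset (map length Ps) \<noteq> optimal_lengths K T N"
    using that by (intro fan_spectral_compare(2)[OF P(1) Q(1) _ big] less) (simp_all add: lP lQ)
  show "graph_spectral_radius (fan_graph u Ps) \<le> graph_spectral_radius (fan_graph w Qs)"
  proof (cases "mset (map length Ps) = optimal_lengths K T N")
    case True
    show ?thesis
      by (rule fan_spectral_compare(1)[OF P(1) Q(1) _ big]) (simp_all only: lP lQ eq[OF True] order_refl)
  qed (use strict in simp)
qed

lemma bouquet_free_admissible:
  assumes l: "3 \<le> l" and free: "free_of (bouquet (Suc T) l) G"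
    and P: "distinct (u # concat Ps)" "verts (fan_graph u Ps) \<subseteq> verts G" "edges (fan_graph u Ps)
      \<subseteq> edges G" "[] \<notin> set Ps"
  shows "admissible (l - 1) T (length (concat Ps)) (mset (map length Ps))"
proof -
  have "\<not> Suc T \<le> (\<Sum>P\<leftarrow>Ps. length P div (l - 1))"
    using contains_bouquet[OF P(1-3) l] free by auto
  then have "(\<Sum>m\<leftarrow>map length Ps. m div (l - 1)) \<le> T" by (simp add: o_def)
  then have "(\<Sum>m\<in>#mset (map length Ps). m div (l - 1)) \<le> T"
    by (metis mset_map sum_mset_sum_list)
  moreover have "0 \<notin># mset (map length Ps)" using P(4) by auto
  ultimately show ?thesis unfolding admissible_def sum_mset_lengths by simp
qed

text \<open>The disjunction yields the maximum and its uniqueness together. If \<open>G\<close> is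
  at least as good as the fan, then \<open>\<rho> \<ge> sqrt N \<ge> 100\<close>, and
  \<open>hub_dominates\<close> produces \<open>u\<close>, whose neighbourhood spans a fan inside
  \<open>G\<close>. Either this fan is \<open>G\<close>, or the vertices left over can be attached
  to \<open>u\<close> with a gain; in both cases the comparison of lengths decides.\<close>

theorem extremal_dichotomy:
  fixes G :: "'a sgraph"
  assumes G: "simple_graph G" "outerplanar G" "free_of (bouquet (Suc T) l) G" "card (verts G) = Suc N"
    and l: "3 \<le> l" and N: "Suc T * (l - 1) - 1 \<le> N" "10000 \<le> N"
    and Q: "distinct (w # concat Qs)" "mset (map length Qs) = optimal_lengths (l - 1) T N"
  shows "graph_spectral_radius G < graph_spectral_radius (fan_graph w Qs) \<or>
    (G \<cong>\<^sub>g fan_graph w Qs \<and> graph_spectral_radius G \<le> graph_spectral_radius (fan_graph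
      w Qs))"
proof (rule ccontr)
  assume contra: "\<not> ?thesis"
  let ?\<rho> = "graph_spectral_radius G"
  have K: "2 \<le> l - 1" using l by simp
  have ge: "graph_spectral_radius (fan_graph w Qs) \<le> ?\<rho>" using contra by linarith
  have lQ: "length (concat Qs) = N"
    using length_concat_admissible[of "l - 1" T N Qs] optimal_lengths_admissible[OF K N(1)] Q(2) by simp
  have sq: "sqrt N \<le> ?\<rho>" using fan_spectral_lower[OF Q(1)] ge N(2) unfolding lQ by simp
  have "sqrt (100\<^sup>2) \<le> sqrt N" using N(2) by (intro real_sqrt_le_mono) simp
  then have r100: "100 \<le> ?\<rho>" using sq by simp
  have "real N = (sqrt N)\<^sup>2" by simp
  also have "\<dots> \<le> ?\<rho>\<^sup>2" using sq by (intro power_mono) simp_all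
  finally have r2: "real (card (verts G)) - 1 \<le> ?\<rho>\<^sup>2" using G(4) by simp
  have ne: "verts G \<noteq> {}" using G(4) by auto
  have "\<exists>u\<in>verts G. verts G = insert u (nbrs G u) \<or>
    (\<forall>G'. simple_graph G' \<longrightarrow> verts G' = verts G \<longrightarrow>
      (\<forall>v\<in>verts G - {u}. {u, v} \<in> edges G') \<longrightarrow>
      (\<forall>e\<in>edges G. e \<subseteq> insert u (nbrs G u) \<longrightarrow> e \<in> edges G')
        \<longrightarrow> ?\<rho> < graph_spectral_radius G')"
    by (rule hub_dominates[OF G(1) refl r100 r2 _ _ ne])
      (use outerplanar_codegree[OF G(2,1)] outerplanar_second_codegree[OF G(2,1)] in simp_all)
  then obtain u where u: "u \<in> verts G" and hub: "verts G = insert u (nbrs G u) \<or>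
    (\<forall>G'. simple_graph G' \<longrightarrow> verts G' = verts G \<longrightarrow>
      (\<forall>v\<in>verts G - {u}. {u, v} \<in> edges G') \<longrightarrow>
      (\<forall>e\<in>edges G. e \<subseteq> insert u (nbrs G u) \<longrightarrow> e \<in> edges G')
        \<longrightarrow> ?\<rho> < graph_spectral_radius G')"
    by (elim bexE)
  obtain Ps where Ps: "distinct (concat Ps)" "set (concat Ps) = nbrs G u" "[] \<notin> set Ps"
    "{e \<in> edges G. e \<subseteq> nbrs G u} = (\<Union>P\<in>set Ps. path_edges P)"
    using outerplanar_neighbourhood[OF G(2,1) u] by (elim exE conjE)
  have uN: "u \<notin> nbrs G u" by (rule nbrs_irrefl[OF G(1)])
  have NV: "nbrs G u \<subseteq> verts G" unfolding nbrs_def by auto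
  have dP: "distinct (u # concat Ps)" using Ps(1,2) uN by simp
  have spokes: "(\<lambda>v. {u, v}) ` nbrs G u \<subseteq> edges G" using nbrs_edge(1)[of _ G u] by auto
  have paths: "(\<Union>P\<in>set Ps. path_edges P) \<subseteq> edges G" unfolding Ps(4)[symmetric] by simp
  have fanE: "edges (fan_graph u Ps) = (\<lambda>v. {u, v}) ` nbrs G u \<union> (\<Union>P\<in>set Ps.
    path_edges P)"
    unfolding edges_fan Ps(2) ..
  have near: "e \<in> edges (fan_graph u Ps)" if e: "e \<in> edges G" "e \<subseteq> insert u (nbrs G u)" for e
  proof (cases "u \<in> e")
    case True
    obtain v where v: "e = {u, v}" "v \<noteq> u"
    proof -
      obtain x y where "e = {x, y}" "x \<noteq> y" using simple_graph_edge[OF G(1) e(1)] by (auto simp: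
        card_2_iff)
      then show ?thesis using True that[of x] that[of y] by (auto simp: insert_commute)
    qed
    then have "v \<in> nbrs G u" using e(2) by auto
    then show ?thesis unfolding fanE v(1) by (intro UnI1 imageI)
  next
    case False
    then have "e \<in> {e \<in> edges G. e \<subseteq> nbrs G u}" using e by auto
    then show ?thesis unfolding fanE Ps(4) by (rule UnI2)
  qed
  have sub: "verts (fan_graph u Ps) \<subseteq> verts G" "edges (fan_graph u Ps) \<subseteq> edges G"
    using u NV spokes paths unfolding verts_fan Ps(2) fanE by simp_all
  have adm: "admissible (l - 1) T (length (concat Ps)) (mset (map length Ps))"
    by (rule bouquet_free_admissible[OF l G(3) dP sub Ps(3)])
  have N4: "4 < N" using N(2) by simp
  show False
  proof (cases "verts G = insert u (nbrs G u)")
    case True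
    have "card (insert u (set (concat Ps))) = Suc (length (concat Ps))"
      using distinct_card[OF dP] by simp
    then have lP: "length (concat Ps) = N" using G(4) True Ps(2) by simp
    have "edges G \<subseteq> edges (fan_graph u Ps)"
      using near simple_graph_edge[OF G(1)] True by auto
    then have "edges (fan_graph u Ps) = edges G" using sub(2) by auto
    moreover have "verts (fan_graph u Ps) = verts G" unfolding verts_fan Ps(2) True[symmetric] ..
    ultimately have eq: "G = fan_graph u Ps" by simp
    note le = fan_admissible_le[OF K N(1) N4 dP adm[unfolded lP] Q]
    show False
    proof (cases "mset (map length Ps) = optimal_lengths (l - 1) T N")
      case True
      have "G \<cong>\<^sub>g fan_graph w Qs"
        unfolding eq by (rule fan_isomorphic_mset[OF dP Q(1)]) (simp only: True Q(2))
      then show False using contra le(1) unfolding eq by simp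
    next
      case False
      then show False using contra le(2) unfolding eq by simp
    qed
  next
    case False
    obtain ws where ws: "set ws = verts G - insert u (nbrs G u)" "distinct ws"
      using finite_distinct_list[of "verts G - insert u (nbrs G u)"] finite_verts[OF G(1)] by auto
    \<comment> \<open>The vertices not adjacent to \<open>u\<close> become paths of one vertex,
      which leave the quota untouched since \<open>1 div (l - 1) = 0\<close>.\<close>
    define Rs where "Rs = Ps @ map (\<lambda>w. [w]) ws"
    have cR: "concat Rs = concat Ps @ ws" unfolding Rs_def by (simp add: concat_map_singleton)
    have dR: "distinct (u # concat Rs)" using dP ws Ps(2) unfolding cR by auto
    have vR: "verts (fan_graph u Rs) = verts G"
      using ws(1) Ps(2) u NV unfolding verts_fan cR by auto
    have "card (insert u (set (concat Rs))) = Suc (length (concat Rs))"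
      using distinct_card[OF dR] by simp
    then have lR: "length (concat Rs) = N" using vR G(4) unfolding verts_fan by simp
    have eR: "edges (fan_graph u Ps) \<subseteq> edges (fan_graph u Rs)"
      unfolding edges_fan cR Rs_def by auto
    have "\<forall>v\<in>verts G - {u}. {u, v} \<in> edges (fan_graph u Rs)"
      using fan_hub(2)[OF dR] unfolding vR by simp
    moreover have "\<forall>e\<in>edges G. e \<subseteq> insert u (nbrs G u) \<longrightarrow> e \<in>
      edges (fan_graph u Rs)"
      using near eR by auto
    ultimately have "?\<rho> < graph_spectral_radius (fan_graph u Rs)"
      using hub False simple_fan[OF dR] vR by simp
    moreover have "admissible (l - 1) T N (mset (map length Rs))"
    proof -
      have "mset (map length Rs) = mset (map length Ps) + replicate_mset (length ws) 1"
        unfolding Rs_def by (simp add: o_def map_replicate_const)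
      moreover have "(\<Sum>m\<in>#replicate_mset (length ws) 1. m div (l - 1)) = 0" using K by simp
      moreover have "sum_mset (mset (map length Rs)) = N"
        unfolding sum_mset_lengths by (rule lR)
      ultimately show ?thesis using adm unfolding admissible_def by auto
    qed
    then have "graph_spectral_radius (fan_graph u Rs) \<le> graph_spectral_radius (fan_graph w Qs)"
      by (rule fan_admissible_le(1)[OF K N(1) N4 dR _ Q])
    ultimately show False using ge by linarith
  qed
qed

theorem fan_extremal:
  fixes Qs :: "'b list list"
  assumes l: "3 \<le> l" and N: "Suc T * (l - 1) - 1 \<le> N" "10000 \<le> N"
    and Q: "distinct (w # concat Qs)" "mset (map length Qs) = optimal_lengths (l - 1) T N"
  shows "spex_op_extremal (Suc N) (bouquet (Suc T) l) (fan_graph w Qs)"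
    and "\<And>G :: 'a sgraph. spex_op_extremal (Suc N) (bouquet (Suc T) l) G \<Longrightarrow> G
      \<cong>\<^sub>g fan_graph w Qs"
proof -
  let ?B = "fan_graph w Qs" and ?F = "bouquet (Suc T) l"
  have K: "2 \<le> l - 1" using l by simp
  note opt = optimal_lengths_admissible[OF K N(1)]
  have free: "free_of ?F (fan_graph u Ps)"
    if "distinct (u # concat Ps)" "mset (map length Ps) = optimal_lengths (l - 1) T N" for u :: 'c and Ps
  proof -
    have "(\<Sum>m\<in>#mset (map length Ps). m div (l - 1)) \<le> T" using opt unfolding that(2)
      admissible_def by simp
    then have "(\<Sum>P\<leftarrow>Ps. length P div (l - 1)) < Suc T"
      unfolding mset_map[symmetric] sum_mset_sum_list by (simp add: o_def)
    then show ?thesis by (rule fan_bouquet_free[OF that(1) l])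
  qed
  have lQ: "length (concat Qs) = N" using length_concat_admissible[of "l - 1" T N Qs] opt Q(2) by simp
  have cB: "card (verts ?B) = Suc N" using distinct_card[OF Q(1)] lQ by simp
  let ?S = "{graph_spectral_radius G | G :: nat sgraph.
            simple_graph G \<and> verts G = {..<Suc N} \<and> outerplanar G \<and> free_of ?F G}"
  have fin: "finite ?S"
  proof (rule finite_subset)
    show "?S \<subseteq> (\<lambda>E. graph_spectral_radius \<lparr>verts = {..<Suc N}, edges = E\<rparr>)
      ` Pow (Pow {..<Suc N})"
    proof
      fix x assume "x \<in> ?S"
      then obtain G :: "nat sgraph" where G: "x = graph_spectral_radius G" "simple_graph G" "verts G =
        {..<Suc N}"
        by auto
      have "edges G \<in> Pow (Pow {..<Suc N})" using simple_graph_edge[OF G(2)] unfolding G(3) by auto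
      moreover have "G = \<lparr>verts = {..<Suc N}, edges = edges G\<rparr>" using G(3) by simp
      ultimately show "x \<in> (\<lambda>E. graph_spectral_radius \<lparr>verts = {..<Suc N}, edges =
        E\<rparr>) ` Pow (Pow {..<Suc N})"
        using G(1) by (intro image_eqI[of _ _ "edges G"]) simp_all
    qed
  qed simp
  have upper: "x \<le> graph_spectral_radius ?B" if "x \<in> ?S" for x
  proof -
    obtain G :: "nat sgraph" where G: "x = graph_spectral_radius G" "simple_graph G" "verts G = {..<Suc N}"
      "outerplanar G" "free_of ?F G" using \<open>x \<in> ?S\<close> by auto
    have "card (verts G) = Suc N" unfolding G(3) by simp
    from extremal_dichotomy[OF G(2,4,5) this l N Q] show ?thesis unfolding G(1) by auto
  qed
  have attained: "graph_spectral_radius ?B \<in> ?S"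
  proof -
    \<comment> \<open>The maximum in \<open>spex_op\<close> ranges over graphs on an initial segment
      of the natural numbers, so the fan is relabelled.\<close>
    obtain f where "bij_betw f (verts ?B) {0..<card (verts ?B)}"
      using ex_bij_betw_finite_nat[of "verts ?B"] by auto
    then have f: "inj_on f (verts ?B)" "f ` verts ?B = {..<Suc N}"
      unfolding bij_betw_def cB by (simp_all add: atLeast0LessThan)
    define Rs where "Rs = map (map f) Qs"
    have "f w # concat Rs = map f (w # concat Qs)" unfolding Rs_def by (simp add: map_concat)
    moreover have "distinct (map f (w # concat Qs))" using Q(1) f(1) unfolding distinct_map by simp
    ultimately have dR: "distinct (f w # concat Rs)" by simp
    have lR: "map length Rs = map length Qs" unfolding Rs_def by simp
    have R: "mset (map length Rs) = optimal_lengths (l - 1) T N" unfolding lR by (rule Q(2))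
    have N4: "4 < N" using N(2) by simp
    \<comment> \<open>With equal length multisets the comparison of fans applies in both directions,
      which shows that the relabelling preserves the radius.\<close>
    have "graph_spectral_radius ?B = graph_spectral_radius (fan_graph (f w) Rs)"
      using fan_admissible_le(1)[OF K N(1) N4 Q(1) _ dR R] fan_admissible_le(1)[OF K N(1) N4 dR _ Q]
        opt Q(2) R by simp
    moreover have "verts (fan_graph (f w) Rs) = {..<Suc N}" unfolding Rs_def verts_fan_map by (rule f(2))
    ultimately show ?thesis using simple_fan[OF dR] outerplanar_fan[OF dR] free[OF dR R] by auto
  qed
  have spex: "spex_op (Suc N) ?F = graph_spectral_radius ?B"
    unfolding spex_op_def by (rule Max_eqI[OF fin upper attained])
  show "spex_op_extremal (Suc N) ?F ?B"
    unfolding spex_op_extremal_def spex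
    using simple_fan[OF Q(1)] cB outerplanar_fan[OF Q(1)] free[OF Q] by simp
  show "G \<cong>\<^sub>g ?B" if "spex_op_extremal (Suc N) ?F G" for G :: "'a sgraph"
    using extremal_dichotomy[of G T l N w Qs] that l N Q unfolding spex_op_extremal_def spex by auto
qed

theorem theorem2:
  fixes l t n :: nat
  assumes "l \<ge> 3" and "t \<ge> 1"
    and "real n \<ge> max (1.27 * 10 ^ 7) (6.5025 * 2 ^ ((t - 1) * (l - 1) + l))"
  shows "(t = 1 \<longrightarrow>
           spex_op_extremal n (bouquet t l) (K1 \<or>\<^sub>g H_op n (l - 2) (l - 2)) \<and>
           (\<forall>G :: 'a sgraph. spex_op_extremal n (bouquet t l) G \<longrightarrow>
              G \<cong>\<^sub>g K1 \<or>\<^sub>g H_op n (l - 2) (l - 2))) \<and>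
         (t \<ge> 2 \<longrightarrow>
           spex_op_extremal n (bouquet t l) (K1 \<or>\<^sub>g H_op n (t * l - t - 1) (l - 2)) \<and>
           (\<forall>G :: 'a sgraph. spex_op_extremal n (bouquet t l) G \<longrightarrow>
              G \<cong>\<^sub>g K1 \<or>\<^sub>g H_op n (t * l - t - 1) (l - 2)))"
proof -
  obtain T where T: "t = Suc T" using assms(2) by (cases t) auto
  have n: "real n \<ge> 1.27 * 10 ^ 7" "real n \<ge> 6.5025 * 2 ^ (T * (l - 1) + l)" using assms(3) T by
    simp_all
  then have n1: "n \<ge> 10001" by simp
  then obtain N where N: "n = Suc N" by (cases n) auto
  \<comment> \<open>As \<open>x < 2 ^ x\<close>, the exponential lower bound on \<open>n\<close>
    leaves room for a first path with \<open>(T + 1) * (l - 1) - 1\<close> vertices.\<close>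
  have "(2::real) ^ (T * (l - 1) + l) \<le> 6.5025 * 2 ^ (T * (l - 1) + l)" by simp
  then have "real (2 ^ (T * (l - 1) + l)) \<le> real n" using n(2) unfolding of_nat_power of_nat_numeral by
    linarith
  then have "2 ^ (T * (l - 1) + l) \<le> n" unfolding of_nat_le_iff .
  moreover have "T * (l - 1) + l < 2 ^ (T * (l - 1) + l)" by (rule less_exp)
  moreover have "Suc T * (l - 1) \<le> T * (l - 1) + l" by simp
  ultimately have size: "Suc T * (l - 1) - 1 \<le> N" using N by linarith
  have big: "10000 \<le> N" using n1 N by simp
  let ?ns = "H_op_lengths n (Suc T * (l - 1) - 1) (l - 1 - 1)"
  have B: "K1 \<or>\<^sub>g H_op n (Suc T * (l - 1) - 1) (l - 2) = fan_graph (Inl ()) (spoke_paths ?ns)"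
    unfolding H_op_paths join_path_graphs by (simp add: numeral_2_eq_2)
  have "mset (map length (spoke_paths ?ns)) = optimal_lengths (l - 1) T N"
    unfolding map_length_spoke_paths mset_H_op_lengths N by simp
  note E = fan_extremal[OF assms(1) size big distinct_spoke_paths this]
  have main: "spex_op_extremal n (bouquet t l) (K1 \<or>\<^sub>g H_op n (Suc T * (l - 1) - 1) (l - 2))"
    "\<And>G :: 'a sgraph. spex_op_extremal n (bouquet t l) G \<Longrightarrow> G \<cong>\<^sub>g K1
      \<or>\<^sub>g H_op n (Suc T * (l - 1) - 1) (l - 2)"
    unfolding B using E unfolding N T by simp_all
  \<comment> \<open>Both cases of the statement have first length \<open>t * (l - 1) - 1\<close>;
    for \<open>t = 1\<close> this is \<open>l - 2\<close>.\<close>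
  have e: "t * l - t - 1 = Suc T * (l - 1) - 1" unfolding T by (simp add: diff_mult_distrib2)
  show ?thesis
  proof (intro conjI impI allI)
    assume "t = 1"
    then have e1: "Suc T * (l - 1) - 1 = l - 2" using T by simp
    show "spex_op_extremal n (bouquet t l) (K1 \<or>\<^sub>g H_op n (l - 2) (l - 2))"
      using main(1) unfolding e1 .
    show "G \<cong>\<^sub>g K1 \<or>\<^sub>g H_op n (l - 2) (l - 2)"
      if "spex_op_extremal n (bouquet t l) G" for G :: "'a sgraph"
      using main(2)[OF that] unfolding e1 .
  next
    show "spex_op_extremal n (bouquet t l) (K1 \<or>\<^sub>g H_op n (t * l - t - 1) (l - 2))"
      unfolding e by (rule main(1))
    show "G \<cong>\<^sub>g K1 \<or>\<^sub>g H_op n (t * l - t - 1) (l - 2)"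
      if "spex_op_extremal n (bouquet t l) G" for G :: "'a sgraph"
      unfolding e by (rule main(2)[OF that])
  qed
qed

end
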